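(* Let $\mathcal{E}$ be a locally presentable and locally cartesian closed category, let $u\colon\mathcal{I}\to\mathcal{E}^\to$ be a functor, and let $(\mathsf{L},\mathsf{R})$ be an algebraic weak factorization system on $\mathcal{E}$ that is algebraically-free on $u\colon\mathcal{I}\to\mathcal{E}^\to$. Then the following are equivalent: (i) $(\mathsf{L},\mathsf{R})$ satisfies the functorial Frobenius condition; (ii) the triple $(\mathcal{I},\ \mathcal{I}^{\pitchfork},\ {}^{\pitchfork}(\mathcal{I}^{\pitchfork}))=(\mathcal{I},\ \mathsf{R}\text{-}\mathsf{Map},\ \mathsf{L}\text{-}\mathsf{map})$ satisfies the generalized functorial Frobenius condition.
   Context: $\mathcal{E}^\to$ is the arrow category of $\mathcal{E}$. For $u\colon\mathcal{I}\to\mathcal{E}^\to$, write $u_i\colon A_i\to B_i$ for the value at $i$. A right $\mathcal{I}$-map is a map $f\colon X\to Y$ with a function $\phi$ assigning to each $i\in\mathcal{I}$ and square $(s,t)\colon u_i\to f$ a diagonal filler $\phi(i,s,t)\colon B_i\to X$, such that for each $\sigma\colon i\to j$ in $\mathcal{I}$ with $u_\sigma=(a,b)$ and each square $(s,t)\colon u_j\to f$ one has $\phi(j,s,t)\circ b=\phi(i,s\circ a,t\circ b)$. Morphisms of right $\mathcal{I}$-maps are squares commuting with the fillers. $\mathcal{I}^{\pitchfork}$ is the category of right $\mathcal{I}$-maps, with its forgetful functor to $\mathcal{E}^\to$; ${}^{\pitchfork}\mathcal{I}$ is the dually defined category of left $\mathcal{I}$-maps (maps $f$ with chosen fillers for all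 squares $f\to u_i$, natural in $i$). An algebraic weak factorization system (awfs) $(\mathsf{L},\mathsf{R})$ is a functorial factorization $f=\mathsf{R}f\circ\mathsf{L}f$ (with $\mathsf{L},\mathsf{R}\colon\mathcal{E}^\to\to\mathcal{E}^\to$; $\mathsf{L}$ is copointed by the squares $(\mathrm{id},\mathsf{R}f)\colon\mathsf{L}f\to f$, $\mathsf{R}$ is pointed by the squares $(\mathsf{L}f,\mathrm{id})\colon f\to\mathsf{R}f$) together with a comultiplication $\mathsf{L}\to\mathsf{L}\mathsf{L}$ and a multiplication $\mathsf{R}\mathsf{R}\to\mathsf{R}$ making $\mathsf{L}$ a comonad and $\mathsf{R}$ a monad, such that the canonical $\mathsf{L}\mathsf{R}\to\mathsf{R}\mathsf{L}$ is a distributive law. $\mathsf{L}\text{-}\mathsf{map}$ is the category of coalgebras for the copointed endofunctor $\mathsf{L}$, $\mathsf{R}\text{-}\mathsf{map}$ that of algebras for the pointed endofunctor $\mathsf{R}$, and $\mathsf{R}\text{-}\mathsf{Map}$ that of algebras for the monad $\mathsf{R}$, all with forgetful functors to $\mathcal{E}^\to$; one has $\mathsf{L}\text{-}\mathsf{map}={}^{\pitchfork}(\mathsf{R}\text{-}\mathsf{Map})$. The awfs is algebraically-free on $u$ if $\mathsf{R}\text{-}\mathsf{Map}\cong\mathcal{I}^{\pitchfork}$ over $\mathcal{E}^\to$. Functorial Frobenius condition for $(\mathsf{L},\mathsf{R})$: the functor $P\colon\mathcal{E}^\to\times_{\mathcal{E}}\mathcal{E}^\to\to\mathcal{E}^\to$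 on cospans (pairs of arrows with common codomain), $(g,h)\mapsto h^*(g)$, lifts along the forgetful functors to a functor $\mathsf{L}\text{-}\mathsf{map}\times_{\mathcal{E}}\mathsf{R}\text{-}\mathsf{map}\to\mathsf{L}\text{-}\mathsf{map}$. For $u\colon\mathcal{I}\to\mathcal{E}^\to$, $\mathcal{I}_{/\mathcal{E}}$ is the category of tuples $(X,i,a,b)$ with $X\in\mathcal{E}$, $i\in\mathcal{I}$, $a\colon A_i\to X$, $b\colon B_i\to X$, $b\circ u_i=a$ (with the evident morphisms); it has a projection $(X,i,a,b)\mapsto X$ to $\mathcal{E}$. For $\mathcal{I}=\mathcal{E}^\to$ with the identity functor one gets $\mathcal{E}^\to_{/\mathcal{E}}$. The functor $Q\colon\mathcal{E}^\to_{/\mathcal{E}}\times_{\mathcal{E}}\mathcal{E}^\to\to\mathcal{E}^\to_{/\mathcal{E}}$ (pullback over $\mathcal{E}$ of the projection and the codomain functor) sends $(f,h)$, with $f$ an arrow over $X$ and $h\colon X'\to X$, to $h^*(f)$ over $X'$. For $u\colon\mathcal{I}\to\mathcal{E}^\to$, $v\colon\mathcal{J}\to\mathcal{E}^\to$, $w\colon\mathcal{K}\to\mathcal{E}^\to$, the triple $(\mathcal{I},\mathcal{J},\mathcal{K})$ satisfies the generalized functorial Frobenius condition if there is a functor $\tilde Q\colon\mathcal{I}_{/\mathcal{E}}\times_{\mathcal{E}}\mathcal{J}\to\mathcal{K}_{/\mathcal{E}}$ (where $\mathcal{J}\to\mathcal{E}$ is $\mathrm{cod}\circ v$) with $w_{/\mathcal{E}}\circ\tilde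 Q=Q\circ(u_{/\mathcal{E}}\times_{\mathcal{E}}v)$. *)

theory Defs
  imports Main "HOL-Library.FuncSet"
begin

unbundle cardinal_syntax

section \<open>Categories, functors, natural transformations\<close>

record ('o, 'a) cat =
  Ob :: "'o set"
  Ar :: "'a set"
  Dom :: "'a \<Rightarrow> 'o"
  Cod :: "'a \<Rightarrow> 'o"
  Ide :: "'o \<Rightarrow> 'a"
  Comp :: "'a \<Rightarrow> 'a \<Rightarrow> 'a"

abbreviation Comp_in :: "'a \<Rightarrow> ('o, 'a) cat \<Rightarrow> 'a \<Rightarrow> 'a"
    (\<open>(_ \<cdot>\<^bsub>_\<^esub> _)\<close> [71, 0, 70] 70)
  where "g \<cdot>\<^bsub>C\<^esub> f \<equiv> Comp C g f"

definition hom :: "('o, 'a) cat \<Rightarrow> 'o \<Rightarrow> 'o \<Rightarrow> 'a set" where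
  "hom C x y = {f \<in> Ar C. Dom C f = x \<and> Cod C f = y}"

definition category :: "('o, 'a) cat \<Rightarrow> bool" where
  "category C \<longleftrightarrow>
     (\<forall>f\<in>Ar C. Dom C f \<in> Ob C \<and> Cod C f \<in> Ob C) \<and>
     (\<forall>x\<in>Ob C. Ide C x \<in> hom C x x) \<and>
     (\<forall>f\<in>Ar C. \<forall>g\<in>Ar C. Dom C g = Cod C f \<longrightarrow> g \<cdot>\<^bsub>C\<^esub> f \<in> hom C (Dom C f) (Cod C g)) \<and>
     (\<forall>f\<in>Ar C. f \<cdot>\<^bsub>C\<^esub> Ide C (Dom C f) = f \<and> Ide C (Cod C f) \<cdot>\<^bsub>C\<^esub> f = f) \<and>
     (\<forall>f\<in>Ar C. \<forall>g\<in>Ar C. \<forall>h\<in>Ar C. Dom C g = Cod C f \<longrightarrow> Dom C h = Cod C g \<longrightarrow>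
        h \<cdot>\<^bsub>C\<^esub> (g \<cdot>\<^bsub>C\<^esub> f) = (h \<cdot>\<^bsub>C\<^esub> g) \<cdot>\<^bsub>C\<^esub> f)"

record ('o, 'a, 'p, 'b) func =
  OM :: "'o \<Rightarrow> 'p"
  AM :: "'a \<Rightarrow> 'b"

definition is_functor ::
  "('o, 'a) cat \<Rightarrow> ('p, 'b) cat \<Rightarrow> ('o, 'a, 'p, 'b) func \<Rightarrow> bool" where
  "is_functor C D F \<longleftrightarrow> category C \<and> category D \<and>
     (\<forall>x\<in>Ob C. OM F x \<in> Ob D) \<and>
     (\<forall>f\<in>Ar C. AM F f \<in> hom D (OM F (Dom C f)) (OM F (Cod C f))) \<and>
     (\<forall>x\<in>Ob C. AM F (Ide C x) = Ide D (OM F x)) \<and>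
     (\<forall>f\<in>Ar C. \<forall>g\<in>Ar C. Dom C g = Cod C f \<longrightarrow>
        AM F (g \<cdot>\<^bsub>C\<^esub> f) = AM F g \<cdot>\<^bsub>D\<^esub> AM F f)"

text \<open>Functors are total HOL functions, so they are compared only on the objects and arrows of
  their source category.\<close>

definition functor_eq ::
  "('o, 'a) cat \<Rightarrow> ('o, 'a, 'p, 'b) func \<Rightarrow> ('o, 'a, 'p, 'b) func \<Rightarrow> bool" where
  "functor_eq C F G \<longleftrightarrow> (\<forall>x\<in>Ob C. OM F x = OM G x) \<and> (\<forall>f\<in>Ar C. AM F f = AM G f)"

definition id_func :: "('o, 'a, 'o, 'a) func" where
  "id_func = \<lparr>OM = (\<lambda>x. x), AM = (\<lambda>f. f)\<rparr>"

definition comp_func ::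
  "('p, 'b, 'q, 'c) func \<Rightarrow> ('o, 'a, 'p, 'b) func \<Rightarrow> ('o, 'a, 'q, 'c) func" where
  "comp_func G F = \<lparr>OM = (\<lambda>x. OM G (OM F x)), AM = (\<lambda>f. AM G (AM F f))\<rparr>"

definition prod_func ::
  "('o, 'a, 'p, 'b) func \<Rightarrow> ('o2, 'a2, 'p2, 'b2) func \<Rightarrow> ('o \<times> 'o2, 'a \<times> 'a2, 'p \<times> 'p2, 'b \<times> 'b2) func"
  where
  "prod_func F G = \<lparr>OM = (\<lambda>(x, y). (OM F x, OM G y)), AM = (\<lambda>(f, g). (AM F f, AM G g))\<rparr>"

definition nat_trans ::
  "('o, 'a) cat \<Rightarrow> ('p, 'b) cat \<Rightarrow> ('o, 'a, 'p, 'b) func \<Rightarrow> ('o, 'a, 'p, 'b) func \<Rightarrow> ('o \<Rightarrow> 'b) \<Rightarrow> bool"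
  where
  "nat_trans C D F G \<tau> \<longleftrightarrow> is_functor C D F \<and> is_functor C D G \<and>
     (\<forall>x\<in>Ob C. \<tau> x \<in> hom D (OM F x) (OM G x)) \<and>
     (\<forall>f\<in>Ar C. \<tau> (Cod C f) \<cdot>\<^bsub>D\<^esub> AM F f = AM G f \<cdot>\<^bsub>D\<^esub> \<tau> (Dom C f))"

definition adjunction ::
  "('o, 'a) cat \<Rightarrow> ('p, 'b) cat \<Rightarrow> ('o, 'a, 'p, 'b) func \<Rightarrow> ('p, 'b, 'o, 'a) func \<Rightarrow>
   ('o \<Rightarrow> 'a) \<Rightarrow> ('p \<Rightarrow> 'b) \<Rightarrow> bool" where
  "adjunction C D F G \<eta> \<epsilon> \<longleftrightarrow> is_functor C D F \<and> is_functor D C G \<and>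
     nat_trans C C id_func (comp_func G F) \<eta> \<and> nat_trans D D (comp_func F G) id_func \<epsilon> \<and>
     (\<forall>x\<in>Ob C. \<epsilon> (OM F x) \<cdot>\<^bsub>D\<^esub> AM F (\<eta> x) = Ide D (OM F x)) \<and>
     (\<forall>y\<in>Ob D. AM G (\<epsilon> y) \<cdot>\<^bsub>C\<^esub> \<eta> (OM G y) = Ide C (OM G y))"

definition has_right_adjoint ::
  "('o, 'a) cat \<Rightarrow> ('p, 'b) cat \<Rightarrow> ('o, 'a, 'p, 'b) func \<Rightarrow> bool" where
  "has_right_adjoint C D F \<longleftrightarrow> (\<exists>G \<eta> \<epsilon>. adjunction C D F G \<eta> \<epsilon>)"

text \<open>The strict pullback of categories along \<open>F : C \<rightarrow> E\<close> and \<open>G : D \<rightarrow> E\<close>.\<close>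

definition fib_prod ::
  "('o, 'a) cat \<Rightarrow> ('p, 'b) cat \<Rightarrow> ('o, 'a, 'e, 'f) func \<Rightarrow> ('p, 'b, 'e, 'f) func \<Rightarrow> ('o \<times> 'p, 'a \<times> 'b) cat"
  where
  "fib_prod C D F G =
     \<lparr>Ob = {(x, y). x \<in> Ob C \<and> y \<in> Ob D \<and> OM F x = OM G y},
      Ar = {(f, g). f \<in> Ar C \<and> g \<in> Ar D \<and> AM F f = AM G g \<and>
              OM F (Dom C f) = OM G (Dom D g) \<and> OM F (Cod C f) = OM G (Cod D g)},
      Dom = (\<lambda>(f, g). (Dom C f, Dom D g)),
      Cod = (\<lambda>(f, g). (Cod C f, Cod D g)),
      Ide = (\<lambda>(x, y). (Ide C x, Ide D y)),
      Comp = (\<lambda>(f', g') (f, g). (f' \<cdot>\<^bsub>C\<^esub> f, g' \<cdot>\<^bsub>D\<^esub> g))\<rparr>"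

section \<open>Arrow category, slices, pullbacks\<close>

text \<open>An arrow \<open>(f, (s, t), g)\<close> of the arrow category is the commutative square with
  left side \<open>f\<close>, right side \<open>g\<close>, top \<open>s\<close> and bottom \<open>t\<close>.\<close>

type_synonym 'a sq = "'a \<times> ('a \<times> 'a) \<times> 'a"

definition top_of :: "'a sq \<Rightarrow> 'a" where
  "top_of q = fst (fst (snd q))"

definition bot_of :: "'a sq \<Rightarrow> 'a" where
  "bot_of q = snd (fst (snd q))"

definition arrow_cat :: "('o, 'a) cat \<Rightarrow> ('a, 'a sq) cat" where
  "arrow_cat E =
     \<lparr>Ob = Ar E,
      Ar = {(f, (s, t), g). f \<in> Ar E \<and> g \<in> Ar E \<and> s \<in> hom E (Dom E f) (Dom E g) \<and>
              t \<in> hom E (Cod E f) (Cod E g) \<and> t \<cdot>\<^bsub>E\<^esub> f = g \<cdot>\<^bsub>E\<^esub> s},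
      Dom = (\<lambda>(f, _, g). f),
      Cod = (\<lambda>(f, _, g). g),
      Ide = (\<lambda>f. (f, (Ide E (Dom E f), Ide E (Cod E f)), f)),
      Comp = (\<lambda>(g, (s', t'), h) (f, (s, t), _). (f, (s' \<cdot>\<^bsub>E\<^esub> s, t' \<cdot>\<^bsub>E\<^esub> t), h))\<rparr>"

abbreviation square :: "('o, 'a) cat \<Rightarrow> 'a \<Rightarrow> 'a \<Rightarrow> 'a \<Rightarrow> 'a \<Rightarrow> bool" where
  "square E f g s t \<equiv> (f, (s, t), g) \<in> Ar (arrow_cat E)"

definition cod_func :: "('o, 'a) cat \<Rightarrow> ('a, 'a sq, 'o, 'a) func" where
  "cod_func E = \<lparr>OM = Cod E, AM = bot_of\<rparr>"

definition slice :: "('o, 'a) cat \<Rightarrow> 'o \<Rightarrow> ('a, 'a \<times> 'a \<times> 'a) cat" where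
  "slice E X =
     \<lparr>Ob = {f \<in> Ar E. Cod E f = X},
      Ar = {(f, h, g). f \<in> Ar E \<and> g \<in> Ar E \<and> Cod E f = X \<and> Cod E g = X \<and>
              h \<in> hom E (Dom E f) (Dom E g) \<and> g \<cdot>\<^bsub>E\<^esub> h = f},
      Dom = (\<lambda>(f, _, g). f),
      Cod = (\<lambda>(f, _, g). g),
      Ide = (\<lambda>f. (f, Ide E (Dom E f), f)),
      Comp = (\<lambda>(_, k, g') (f, h, _). (f, k \<cdot>\<^bsub>E\<^esub> h, g'))\<rparr>"

definition is_pullback :: "('o, 'a) cat \<Rightarrow> 'a \<Rightarrow> 'a \<Rightarrow> 'a \<Rightarrow> 'a \<Rightarrow> bool" where
  "is_pullback E f g p q \<longleftrightarrow>
     f \<in> Ar E \<and> g \<in> Ar E \<and> Cod E f = Cod E g \<and>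
     p \<in> Ar E \<and> q \<in> Ar E \<and> Dom E p = Dom E q \<and> Cod E p = Dom E f \<and> Cod E q = Dom E g \<and>
     f \<cdot>\<^bsub>E\<^esub> p = g \<cdot>\<^bsub>E\<^esub> q \<and>
     (\<forall>z\<in>Ar E. \<forall>w\<in>Ar E. Dom E z = Dom E w \<longrightarrow> Cod E z = Dom E f \<longrightarrow> Cod E w = Dom E g \<longrightarrow>
        f \<cdot>\<^bsub>E\<^esub> z = g \<cdot>\<^bsub>E\<^esub> w \<longrightarrow>
        (\<exists>!m. m \<in> hom E (Dom E z) (Dom E p) \<and> p \<cdot>\<^bsub>E\<^esub> m = z \<and> q \<cdot>\<^bsub>E\<^esub> m = w))"

text \<open>A choice \<open>pb\<close> of pullbacks gives for each cospan \<open>(f, g)\<close> the pair of projections to the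
  domains of \<open>f\<close> and of \<open>g\<close>; in particular \<open>pbase pb f g\<close> is \<open>g\<^sup>*(f)\<close> as an arrow
  into the domain of \<open>g\<close>.\<close>

definition chosen_pullbacks :: "('o, 'a) cat \<Rightarrow> ('a \<Rightarrow> 'a \<Rightarrow> 'a \<times> 'a) \<Rightarrow> bool" where
  "chosen_pullbacks E pb \<longleftrightarrow> category E \<and>
     (\<forall>f\<in>Ar E. \<forall>g\<in>Ar E. Cod E f = Cod E g \<longrightarrow> is_pullback E f g (fst (pb f g)) (snd (pb f g)))"

definition ptotal :: "('a \<Rightarrow> 'a \<Rightarrow> 'a \<times> 'a) \<Rightarrow> 'a \<Rightarrow> 'a \<Rightarrow> 'a" where
  "ptotal pb f g = fst (pb f g)"

definition pbase :: "('a \<Rightarrow> 'a \<Rightarrow> 'a \<times> 'a) \<Rightarrow> 'a \<Rightarrow> 'a \<Rightarrow> 'a" where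
  "pbase pb f g = snd (pb f g)"

definition induced :: "('o, 'a) cat \<Rightarrow> ('a \<Rightarrow> 'a \<Rightarrow> 'a \<times> 'a) \<Rightarrow> 'a \<Rightarrow> 'a \<Rightarrow> 'a \<Rightarrow> 'a \<Rightarrow> 'a" where
  "induced E pb f g z w = (THE m. m \<in> hom E (Dom E z) (Dom E (ptotal pb f g)) \<and>
     ptotal pb f g \<cdot>\<^bsub>E\<^esub> m = z \<and> pbase pb f g \<cdot>\<^bsub>E\<^esub> m = w)"

text \<open>The map between the chosen pullbacks of the cospans \<open>(f, g)\<close> and \<open>(f', g')\<close> induced by
  \<open>s\<close> and \<open>y\<close> between the domains of \<open>f, f'\<close> and of \<open>g, g'\<close> respectively.\<close>

definition pb_map ::
  "('o, 'a) cat \<Rightarrow> ('a \<Rightarrow> 'a \<Rightarrow> 'a \<times> 'a) \<Rightarrow> 'a \<Rightarrow> 'a \<Rightarrow> 'a \<Rightarrow> 'a \<Rightarrow> 'a \<Rightarrow> 'a \<Rightarrow> 'a" where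
  "pb_map E pb f g f' g' s y =
     induced E pb f' g' (s \<cdot>\<^bsub>E\<^esub> ptotal pb f g) (y \<cdot>\<^bsub>E\<^esub> pbase pb f g)"

definition pullback_func ::
  "('o, 'a) cat \<Rightarrow> ('a \<Rightarrow> 'a \<Rightarrow> 'a \<times> 'a) \<Rightarrow> 'a \<Rightarrow> ('a, 'a \<times> 'a \<times> 'a, 'a, 'a \<times> 'a \<times> 'a) func" where
  "pullback_func E pb h =
     \<lparr>OM = (\<lambda>a. pbase pb a h),
      AM = (\<lambda>(a, m, a'). (pbase pb a h,
              pb_map E pb a h a' h m (Ide E (Dom E h)), pbase pb a' h))\<rparr>"

definition locally_cartesian_closed ::
  "('o, 'a) cat \<Rightarrow> ('a \<Rightarrow> 'a \<Rightarrow> 'a \<times> 'a) \<Rightarrow> bool" where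
  "locally_cartesian_closed E pb \<longleftrightarrow> chosen_pullbacks E pb \<and>
     (\<forall>h\<in>Ar E. has_right_adjoint (slice E (Cod E h)) (slice E (Dom E h)) (pullback_func E pb h))"

section \<open>Locally presentable categories\<close>

text \<open>Sizes are measured by a strongly inaccessible cardinal \<open>\<kappa>\<close> on a type \<open>'k\<close>, i.e. by a
  Grothendieck universe: a set is small if its cardinality is below \<open>\<kappa>\<close>.  Every small category
  is isomorphic to one whose objects and arrows are elements of \<open>'k\<close>, so diagram shapes are
  taken there.\<close>

definition inaccessible :: "'k rel \<Rightarrow> bool" where
  "inaccessible \<kappa> \<longleftrightarrow> Card_order \<kappa> \<and> natLeq <o \<kappa> \<and> regularCard \<kappa> \<and>
     (\<forall>A :: 'k set. |A| <o \<kappa> \<longrightarrow> |Pow A| <o \<kappa>)"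

definition cocone ::
  "('o, 'a) cat \<Rightarrow> ('j, 'm) cat \<Rightarrow> ('j, 'm, 'o, 'a) func \<Rightarrow> 'o \<Rightarrow> ('j \<Rightarrow> 'a) \<Rightarrow> bool" where
  "cocone E J D X c \<longleftrightarrow> X \<in> Ob E \<and> (\<forall>j\<in>Ob J. c j \<in> hom E (OM D j) X) \<and>
     (\<forall>m\<in>Ar J. c (Cod J m) \<cdot>\<^bsub>E\<^esub> AM D m = c (Dom J m))"

definition colimit ::
  "('o, 'a) cat \<Rightarrow> ('j, 'm) cat \<Rightarrow> ('j, 'm, 'o, 'a) func \<Rightarrow> 'o \<Rightarrow> ('j \<Rightarrow> 'a) \<Rightarrow> bool" where
  "colimit E J D X c \<longleftrightarrow> cocone E J D X c \<and>
     (\<forall>Y d. cocone E J D Y d \<longrightarrow> (\<exists>!k. k \<in> hom E X Y \<and> (\<forall>j\<in>Ob J. k \<cdot>\<^bsub>E\<^esub> c j = d j)))"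

definition cocomplete :: "'k rel \<Rightarrow> ('o, 'a) cat \<Rightarrow> bool" where
  "cocomplete \<kappa> E \<longleftrightarrow>
     (\<forall>(J :: ('k, 'k) cat) D. |Ar J| <o \<kappa> \<longrightarrow> is_functor J E D \<longrightarrow> (\<exists>X c. colimit E J D X c))"

definition poset_cat :: "'k set \<Rightarrow> 'k rel \<Rightarrow> ('k, 'k \<times> 'k) cat" where
  "poset_cat I r =
     \<lparr>Ob = I, Ar = r, Dom = fst, Cod = snd, Ide = (\<lambda>i. (i, i)), Comp = (\<lambda>q p. (fst p, snd q))\<rparr>"

text \<open>Small posets in which every subset of cardinality below \<open>\<mu>\<close> has an upper bound.\<close>

definition small_directed_poset :: "'k rel \<Rightarrow> 'k rel \<Rightarrow> 'k set \<Rightarrow> 'k rel \<Rightarrow> bool" where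
  "small_directed_poset \<kappa> \<mu> I r \<longleftrightarrow> |I| <o \<kappa> \<and> r \<subseteq> I \<times> I \<and> refl_on I r \<and> trans r \<and> antisym r \<and>
     (\<forall>S\<subseteq>I. |S| <o \<mu> \<longrightarrow> (\<exists>b\<in>I. \<forall>s\<in>S. (s, b) \<in> r))"

text \<open>The colimit cocone \<open>(X, c)\<close> is sent by the covariant hom functor of \<open>K\<close> to a colimit cocone
  in the category of small sets.  Its universal property is spelled out, the test object \<open>T\<close>
  being a small set; up to bijection all small sets are subsets of \<open>'k\<close>.\<close>

definition hom_preserves_colimit ::
  "'k rel \<Rightarrow> ('o, 'a) cat \<Rightarrow> 'o \<Rightarrow> ('j, 'm) cat \<Rightarrow> ('j, 'm, 'o, 'a) func \<Rightarrow> 'o \<Rightarrow> ('j \<Rightarrow> 'a) \<Rightarrow> bool"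
  where
  "hom_preserves_colimit \<kappa> E K J D X c \<longleftrightarrow>
     (\<forall>(T :: 'k set) h. |T| <o \<kappa> \<longrightarrow>
        (\<forall>j\<in>Ob J. \<forall>g\<in>hom E K (OM D j). h j g \<in> T) \<longrightarrow>
        (\<forall>m\<in>Ar J. \<forall>g\<in>hom E K (OM D (Dom J m)). h (Cod J m) (AM D m \<cdot>\<^bsub>E\<^esub> g) = h (Dom J m) g) \<longrightarrow>
        (\<exists>!k. k \<in> hom E K X \<rightarrow>\<^sub>E T \<and> (\<forall>j\<in>Ob J. \<forall>g\<in>hom E K (OM D j). k (c j \<cdot>\<^bsub>E\<^esub> g) = h j g)))"

definition presentable :: "'k rel \<Rightarrow> 'k rel \<Rightarrow> ('o, 'a) cat \<Rightarrow> 'o \<Rightarrow> bool" where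
  "presentable \<kappa> \<mu> E K \<longleftrightarrow> K \<in> Ob E \<and>
     (\<forall>I r D X c. small_directed_poset \<kappa> \<mu> I r \<longrightarrow> is_functor (poset_cat I r) E D \<longrightarrow>
        colimit E (poset_cat I r) D X c \<longrightarrow> hom_preserves_colimit \<kappa> E K (poset_cat I r) D X c)"

definition locally_presentable :: "'k rel \<Rightarrow> ('o, 'a) cat \<Rightarrow> bool" where
  "locally_presentable \<kappa> E \<longleftrightarrow> category E \<and>
     (\<forall>x\<in>Ob E. \<forall>y\<in>Ob E. |hom E x y| <o \<kappa>) \<and>
     cocomplete \<kappa> E \<and>
     (\<exists>\<mu> :: 'k rel. Cinfinite \<mu> \<and> regularCard \<mu> \<and> \<mu> <o \<kappa> \<and>
        (\<exists>G. |G| <o \<kappa> \<and> (\<forall>K\<in>G. presentable \<kappa> \<mu> E K) \<and>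
           (\<forall>X\<in>Ob E. \<exists>I r D c. small_directed_poset \<kappa> \<mu> I r \<and>
              is_functor (poset_cat I r) E D \<and> (\<forall>i\<in>I. OM D i \<in> G) \<and>
              colimit E (poset_cat I r) D X c)))"

section \<open>Categories of objects with structure over a given category\<close>

definition struct_cat ::
  "('o, 'a) cat \<Rightarrow> ('o \<times> 'x) set \<Rightarrow> ('o \<times> 'x \<Rightarrow> 'a \<Rightarrow> 'o \<times> 'x \<Rightarrow> bool) \<Rightarrow>
   ('o \<times> 'x, ('o \<times> 'x) \<times> 'a \<times> ('o \<times> 'x)) cat" where
  "struct_cat C S M =
     \<lparr>Ob = S,
      Ar = {(X, h, Y). X \<in> S \<and> Y \<in> S \<and> h \<in> hom C (fst X) (fst Y) \<and> M X h Y},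
      Dom = (\<lambda>(X, _, Y). X),
      Cod = (\<lambda>(X, _, Y). Y),
      Ide = (\<lambda>X. (X, Ide C (fst X), X)),
      Comp = (\<lambda>(_, k, Z) (X, h, _). (X, k \<cdot>\<^bsub>C\<^esub> h, Z))\<rparr>"

definition forget :: "('o \<times> 'x, ('o \<times> 'x) \<times> 'a \<times> ('o \<times> 'x), 'o, 'a) func" where
  "forget = \<lparr>OM = fst, AM = (\<lambda>(_, h, _). h)\<rparr>"

definition iso_over ::
  "('o, 'a) cat \<Rightarrow> ('p, 'b) cat \<Rightarrow> ('o, 'a, 'e, 'f) func \<Rightarrow> ('p, 'b, 'e, 'f) func \<Rightarrow> bool" where
  "iso_over C D U V \<longleftrightarrow> (\<exists>F G. is_functor C D F \<and> is_functor D C G \<and>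
     functor_eq C (comp_func G F) id_func \<and> functor_eq D (comp_func F G) id_func \<and>
     functor_eq C (comp_func V F) U)"

definition copointed_coalg ::
  "('o, 'a) cat \<Rightarrow> ('o, 'a, 'o, 'a) func \<Rightarrow> ('o \<Rightarrow> 'a) \<Rightarrow> ('o \<times> 'a, ('o \<times> 'a) \<times> 'a \<times> ('o \<times> 'a)) cat"
  where
  "copointed_coalg C T \<epsilon> = struct_cat C
     {(x, \<alpha>). x \<in> Ob C \<and> \<alpha> \<in> hom C x (OM T x) \<and> \<epsilon> x \<cdot>\<^bsub>C\<^esub> \<alpha> = Ide C x}
     (\<lambda>(x, \<alpha>) h (y, \<beta>). AM T h \<cdot>\<^bsub>C\<^esub> \<alpha> = \<beta> \<cdot>\<^bsub>C\<^esub> h)"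

definition pointed_alg ::
  "('o, 'a) cat \<Rightarrow> ('o, 'a, 'o, 'a) func \<Rightarrow> ('o \<Rightarrow> 'a) \<Rightarrow> ('o \<times> 'a, ('o \<times> 'a) \<times> 'a \<times> ('o \<times> 'a)) cat"
  where
  "pointed_alg C T \<eta> = struct_cat C
     {(x, \<alpha>). x \<in> Ob C \<and> \<alpha> \<in> hom C (OM T x) x \<and> \<alpha> \<cdot>\<^bsub>C\<^esub> \<eta> x = Ide C x}
     (\<lambda>(x, \<alpha>) h (y, \<beta>). h \<cdot>\<^bsub>C\<^esub> \<alpha> = \<beta> \<cdot>\<^bsub>C\<^esub> AM T h)"

definition monad_alg ::
  "('o, 'a) cat \<Rightarrow> ('o, 'a, 'o, 'a) func \<Rightarrow> ('o \<Rightarrow> 'a) \<Rightarrow> ('o \<Rightarrow> 'a) \<Rightarrow>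
   ('o \<times> 'a, ('o \<times> 'a) \<times> 'a \<times> ('o \<times> 'a)) cat" where
  "monad_alg C T \<eta> \<mu> = struct_cat C
     {(x, \<alpha>). x \<in> Ob C \<and> \<alpha> \<in> hom C (OM T x) x \<and> \<alpha> \<cdot>\<^bsub>C\<^esub> \<eta> x = Ide C x \<and>
        \<alpha> \<cdot>\<^bsub>C\<^esub> \<mu> x = \<alpha> \<cdot>\<^bsub>C\<^esub> AM T \<alpha>}
     (\<lambda>(x, \<alpha>) h (y, \<beta>). h \<cdot>\<^bsub>C\<^esub> \<alpha> = \<beta> \<cdot>\<^bsub>C\<^esub> AM T h)"

section \<open>Right and left maps\<close>

definition filler :: "('o, 'a) cat \<Rightarrow> 'a \<Rightarrow> 'a \<Rightarrow> 'a \<Rightarrow> 'a \<Rightarrow> 'a \<Rightarrow> bool" where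
  "filler E f g s t d \<longleftrightarrow> d \<in> hom E (Cod E f) (Dom E g) \<and> d \<cdot>\<^bsub>E\<^esub> f = s \<and> g \<cdot>\<^bsub>E\<^esub> d = t"

text \<open>Lifting functions are \<open>undefined\<close> off the lifting problems, so that equality of right maps
  (left maps) is equality of the map and of its fillers.\<close>

definition right_maps :: "('o, 'a) cat \<Rightarrow> ('i, 's) cat \<Rightarrow> ('i, 's, 'a, 'a sq) func \<Rightarrow>
    ('a \<times> ('i \<Rightarrow> 'a \<Rightarrow> 'a \<Rightarrow> 'a), ('a \<times> ('i \<Rightarrow> 'a \<Rightarrow> 'a \<Rightarrow> 'a)) \<times> 'a sq \<times> ('a \<times> ('i \<Rightarrow> 'a \<Rightarrow> 'a \<Rightarrow> 'a))) cat"
  where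
  "right_maps E I u = struct_cat (arrow_cat E)
     {(f, \<phi>). f \<in> Ar E \<and>
        (\<forall>i s t. if i \<in> Ob I \<and> square E (OM u i) f s t
                 then filler E (OM u i) f s t (\<phi> i s t) else \<phi> i s t = undefined) \<and>
        (\<forall>\<sigma>\<in>Ar I. \<forall>s t. square E (OM u (Cod I \<sigma>)) f s t \<longrightarrow>
           \<phi> (Cod I \<sigma>) s t \<cdot>\<^bsub>E\<^esub> bot_of (AM u \<sigma>) =
           \<phi> (Dom I \<sigma>) (s \<cdot>\<^bsub>E\<^esub> top_of (AM u \<sigma>)) (t \<cdot>\<^bsub>E\<^esub> bot_of (AM u \<sigma>)))}
     (\<lambda>(f, \<phi>) h (g, \<psi>). \<forall>i\<in>Ob I. \<forall>s t. square E (OM u i) f s t \<longrightarrow>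
        top_of h \<cdot>\<^bsub>E\<^esub> \<phi> i s t = \<psi> i (top_of h \<cdot>\<^bsub>E\<^esub> s) (bot_of h \<cdot>\<^bsub>E\<^esub> t))"

definition left_maps :: "('o, 'a) cat \<Rightarrow> ('i, 's) cat \<Rightarrow> ('i, 's, 'a, 'a sq) func \<Rightarrow>
    ('a \<times> ('i \<Rightarrow> 'a \<Rightarrow> 'a \<Rightarrow> 'a), ('a \<times> ('i \<Rightarrow> 'a \<Rightarrow> 'a \<Rightarrow> 'a)) \<times> 'a sq \<times> ('a \<times> ('i \<Rightarrow> 'a \<Rightarrow> 'a \<Rightarrow> 'a))) cat"
  where
  "left_maps E I u = struct_cat (arrow_cat E)
     {(f, \<phi>). f \<in> Ar E \<and>
        (\<forall>i s t. if i \<in> Ob I \<and> square E f (OM u i) s t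
                 then filler E f (OM u i) s t (\<phi> i s t) else \<phi> i s t = undefined) \<and>
        (\<forall>\<sigma>\<in>Ar I. \<forall>s t. square E f (OM u (Dom I \<sigma>)) s t \<longrightarrow>
           top_of (AM u \<sigma>) \<cdot>\<^bsub>E\<^esub> \<phi> (Dom I \<sigma>) s t =
           \<phi> (Cod I \<sigma>) (top_of (AM u \<sigma>) \<cdot>\<^bsub>E\<^esub> s) (bot_of (AM u \<sigma>) \<cdot>\<^bsub>E\<^esub> t))}
     (\<lambda>(f, \<phi>) h (g, \<psi>). \<forall>i\<in>Ob I. \<forall>s t. square E g (OM u i) s t \<longrightarrow>
        \<psi> i s t \<cdot>\<^bsub>E\<^esub> bot_of h = \<phi> i (s \<cdot>\<^bsub>E\<^esub> top_of h) (t \<cdot>\<^bsub>E\<^esub> bot_of h))"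

section \<open>Algebraic weak factorization systems\<close>

definition comonad ::
  "('o, 'a) cat \<Rightarrow> ('o, 'a, 'o, 'a) func \<Rightarrow> ('o \<Rightarrow> 'a) \<Rightarrow> ('o \<Rightarrow> 'a) \<Rightarrow> bool" where
  "comonad C L \<epsilon> \<delta> \<longleftrightarrow> nat_trans C C L id_func \<epsilon> \<and> nat_trans C C L (comp_func L L) \<delta> \<and>
     (\<forall>x\<in>Ob C. \<epsilon> (OM L x) \<cdot>\<^bsub>C\<^esub> \<delta> x = Ide C (OM L x) \<and>
        AM L (\<epsilon> x) \<cdot>\<^bsub>C\<^esub> \<delta> x = Ide C (OM L x) \<and>
        \<delta> (OM L x) \<cdot>\<^bsub>C\<^esub> \<delta> x = AM L (\<delta> x) \<cdot>\<^bsub>C\<^esub> \<delta> x)"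

definition monad ::
  "('o, 'a) cat \<Rightarrow> ('o, 'a, 'o, 'a) func \<Rightarrow> ('o \<Rightarrow> 'a) \<Rightarrow> ('o \<Rightarrow> 'a) \<Rightarrow> bool" where
  "monad C R \<eta> \<mu> \<longleftrightarrow> nat_trans C C id_func R \<eta> \<and> nat_trans C C (comp_func R R) R \<mu> \<and>
     (\<forall>x\<in>Ob C. \<mu> x \<cdot>\<^bsub>C\<^esub> \<eta> (OM R x) = Ide C (OM R x) \<and>
        \<mu> x \<cdot>\<^bsub>C\<^esub> AM R (\<eta> x) = Ide C (OM R x) \<and>
        \<mu> x \<cdot>\<^bsub>C\<^esub> \<mu> (OM R x) = \<mu> x \<cdot>\<^bsub>C\<^esub> AM R (\<mu> x))"

definition distributive_law ::
  "('o, 'a) cat \<Rightarrow> ('o, 'a, 'o, 'a) func \<Rightarrow> ('o \<Rightarrow> 'a) \<Rightarrow> ('o \<Rightarrow> 'a) \<Rightarrow>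
   ('o, 'a, 'o, 'a) func \<Rightarrow> ('o \<Rightarrow> 'a) \<Rightarrow> ('o \<Rightarrow> 'a) \<Rightarrow> ('o \<Rightarrow> 'a) \<Rightarrow> bool" where
  "distributive_law C L \<epsilon> \<delta> R \<eta> \<mu> \<Delta> \<longleftrightarrow>
     nat_trans C C (comp_func L R) (comp_func R L) \<Delta> \<and>
     (\<forall>x\<in>Ob C.
        \<Delta> x \<cdot>\<^bsub>C\<^esub> AM L (\<eta> x) = \<eta> (OM L x) \<and>
        AM R (\<epsilon> x) \<cdot>\<^bsub>C\<^esub> \<Delta> x = \<epsilon> (OM R x) \<and>
        \<Delta> x \<cdot>\<^bsub>C\<^esub> AM L (\<mu> x) = \<mu> (OM L x) \<cdot>\<^bsub>C\<^esub> (AM R (\<Delta> x) \<cdot>\<^bsub>C\<^esub> \<Delta> (OM R x)) \<and>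
        AM R (\<delta> x) \<cdot>\<^bsub>C\<^esub> \<Delta> x = \<Delta> (OM L x) \<cdot>\<^bsub>C\<^esub> (AM L (\<Delta> x) \<cdot>\<^bsub>C\<^esub> \<delta> (OM R x)))"

record 'a awfs_data =
  LF :: "('a, 'a sq, 'a, 'a sq) func"
  RF :: "('a, 'a sq, 'a, 'a sq) func"
  comult :: "'a \<Rightarrow> 'a sq"
  mult :: "'a \<Rightarrow> 'a sq"

definition functorial_factorization ::
  "('o, 'a) cat \<Rightarrow> ('a, 'a sq, 'a, 'a sq) func \<Rightarrow> ('a, 'a sq, 'a, 'a sq) func \<Rightarrow> bool" where
  "functorial_factorization E L R \<longleftrightarrow> category E \<and>
     is_functor (arrow_cat E) (arrow_cat E) L \<and> is_functor (arrow_cat E) (arrow_cat E) R \<and>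
     (\<forall>f\<in>Ar E. Dom E (OM L f) = Dom E f \<and> Cod E (OM L f) = Dom E (OM R f) \<and>
        Cod E (OM R f) = Cod E f \<and> OM R f \<cdot>\<^bsub>E\<^esub> OM L f = f) \<and>
     (\<forall>q\<in>Ar (arrow_cat E). top_of (AM L q) = top_of q \<and> bot_of (AM L q) = top_of (AM R q) \<and>
        bot_of (AM R q) = bot_of q)"

definition counit :: "('o, 'a) cat \<Rightarrow> 'a awfs_data \<Rightarrow> 'a \<Rightarrow> 'a sq" where
  "counit E W f = (OM (LF W) f, (Ide E (Dom E f), OM (RF W) f), f)"

definition unit :: "('o, 'a) cat \<Rightarrow> 'a awfs_data \<Rightarrow> 'a \<Rightarrow> 'a sq" where
  "unit E W f = (f, (OM (LF W) f, Ide E (Cod E f)), OM (RF W) f)"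

text \<open>The canonical \<open>LR \<rightarrow> RL\<close>: by the (co)unit laws the comultiplication at \<open>f\<close> is a square
  \<open>(id, \<sigma>)\<close> and the multiplication at \<open>f\<close> a square \<open>(\<pi>, id)\<close>, and the component at \<open>f\<close> is \<open>(\<sigma>, \<pi>)\<close>.\<close>

definition canonical :: "'a awfs_data \<Rightarrow> 'a \<Rightarrow> 'a sq" where
  "canonical W f = (OM (LF W) (OM (RF W) f), (bot_of (comult W f), top_of (mult W f)),
     OM (RF W) (OM (LF W) f))"

definition awfs :: "('o, 'a) cat \<Rightarrow> 'a awfs_data \<Rightarrow> bool" where
  "awfs E W \<longleftrightarrow> functorial_factorization E (LF W) (RF W) \<and>
     comonad (arrow_cat E) (LF W) (counit E W) (comult W) \<and>
     monad (arrow_cat E) (RF W) (unit E W) (mult W) \<and>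
     distributive_law (arrow_cat E) (LF W) (counit E W) (comult W)
       (RF W) (unit E W) (mult W) (canonical W)"

definition L_map :: "('o, 'a) cat \<Rightarrow> 'a awfs_data \<Rightarrow> ('a \<times> 'a sq, ('a \<times> 'a sq) \<times> 'a sq \<times> ('a \<times> 'a sq)) cat"
  where "L_map E W = copointed_coalg (arrow_cat E) (LF W) (counit E W)"

definition R_map :: "('o, 'a) cat \<Rightarrow> 'a awfs_data \<Rightarrow> ('a \<times> 'a sq, ('a \<times> 'a sq) \<times> 'a sq \<times> ('a \<times> 'a sq)) cat"
  where "R_map E W = pointed_alg (arrow_cat E) (RF W) (unit E W)"

definition R_Map :: "('o, 'a) cat \<Rightarrow> 'a awfs_data \<Rightarrow> ('a \<times> 'a sq, ('a \<times> 'a sq) \<times> 'a sq \<times> ('a \<times> 'a sq)) cat"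
  where "R_Map E W = monad_alg (arrow_cat E) (RF W) (unit E W) (mult W)"

definition algebraically_free_on ::
  "('o, 'a) cat \<Rightarrow> 'a awfs_data \<Rightarrow> ('i, 's) cat \<Rightarrow> ('i, 's, 'a, 'a sq) func \<Rightarrow> bool" where
  "algebraically_free_on E W I u \<longleftrightarrow> iso_over (R_Map E W) (right_maps E I u) forget forget"

section \<open>Frobenius conditions\<close>

definition P_func :: "('o, 'a) cat \<Rightarrow> ('a \<Rightarrow> 'a \<Rightarrow> 'a \<times> 'a) \<Rightarrow> ('a \<times> 'a, 'a sq \<times> 'a sq, 'a, 'a sq) func" where
  "P_func E pb =
     \<lparr>OM = (\<lambda>(g, h). pbase pb g h),
      AM = (\<lambda>((g, (s, t), g'), (h, (y, t'), h')).
              (pbase pb g h, (pb_map E pb g h g' h' s y, y), pbase pb g' h'))\<rparr>"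

definition functorial_frobenius ::
  "('o, 'a) cat \<Rightarrow> ('a \<Rightarrow> 'a \<Rightarrow> 'a \<times> 'a) \<Rightarrow> 'a awfs_data \<Rightarrow> bool" where
  "functorial_frobenius E pb W \<longleftrightarrow>
     (\<exists>P'. is_functor (fib_prod (L_map E W) (R_map E W)
                         (comp_func (cod_func E) forget) (comp_func (cod_func E) forget))
             (L_map E W) P' \<and>
           functor_eq (fib_prod (L_map E W) (R_map E W)
                         (comp_func (cod_func E) forget) (comp_func (cod_func E) forget))
             (comp_func forget P') (comp_func (P_func E pb) (prod_func forget forget)))"

text \<open>\<open>over_cat E I u\<close> is the category of tuples \<open>(X, i, a, b)\<close>; its arrows are pairs
  \<open>(x, \<sigma>)\<close> of an arrow of \<open>E\<close> and an arrow of \<open>I\<close>, together with source and target.\<close>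

definition over_cat :: "('o, 'a) cat \<Rightarrow> ('i, 's) cat \<Rightarrow> ('i, 's, 'a, 'a sq) func \<Rightarrow>
    ('o \<times> 'i \<times> 'a \<times> 'a, ('o \<times> 'i \<times> 'a \<times> 'a) \<times> ('a \<times> 's) \<times> ('o \<times> 'i \<times> 'a \<times> 'a)) cat" where
  "over_cat E I u =
     (let S = {(X, i, a, b). X \<in> Ob E \<and> i \<in> Ob I \<and> a \<in> hom E (Dom E (OM u i)) X \<and>
                 b \<in> hom E (Cod E (OM u i)) X \<and> b \<cdot>\<^bsub>E\<^esub> OM u i = a}
      in \<lparr>Ob = S,
          Ar = {((X, i, a, b), (x, \<sigma>), (X', i', a', b')).
                  (X, i, a, b) \<in> S \<and> (X', i', a', b') \<in> S \<and> x \<in> hom E X X' \<and> \<sigma> \<in> hom I i i' \<and>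
                  a' \<cdot>\<^bsub>E\<^esub> top_of (AM u \<sigma>) = x \<cdot>\<^bsub>E\<^esub> a \<and> b' \<cdot>\<^bsub>E\<^esub> bot_of (AM u \<sigma>) = x \<cdot>\<^bsub>E\<^esub> b},
          Dom = (\<lambda>(p, _, q). p),
          Cod = (\<lambda>(p, _, q). q),
          Ide = (\<lambda>(X, i, a, b). ((X, i, a, b), (Ide E X, Ide I i), (X, i, a, b))),
          Comp = (\<lambda>(_, (x', \<sigma>'), r) (p, (x, \<sigma>), _). (p, (x' \<cdot>\<^bsub>E\<^esub> x, \<sigma>' \<cdot>\<^bsub>I\<^esub> \<sigma>), r))\<rparr>)"

definition over_proj :: "('o \<times> 'i \<times> 'a \<times> 'a, ('o \<times> 'i \<times> 'a \<times> 'a) \<times> ('a \<times> 's) \<times> ('o \<times> 'i \<times> 'a \<times> 'a), 'o, 'a) func"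
  where
  "over_proj = \<lparr>OM = (\<lambda>(X, i, a, b). X), AM = (\<lambda>(_, (x, \<sigma>), _). x)\<rparr>"

definition over_obj :: "('i \<Rightarrow> 'p) \<Rightarrow> 'o \<times> 'i \<times> 'a \<times> 'a \<Rightarrow> 'o \<times> 'p \<times> 'a \<times> 'a" where
  "over_obj F = (\<lambda>(X, i, a, b). (X, F i, a, b))"

text \<open>The functor \<open>u\<^sub>/\<^sub>E : I\<^sub>/\<^sub>E \<rightarrow> E\<^sup>\<rightarrow>\<^sub>/\<^sub>E\<close>, where
  \<open>E\<^sup>\<rightarrow>\<^sub>/\<^sub>E\<close> is \<open>over_cat E (arrow_cat E) id_func\<close>.\<close>

definition over_func :: "('i, 's, 'a, 'a sq) func \<Rightarrow>
    ('o \<times> 'i \<times> 'a \<times> 'a, ('o \<times> 'i \<times> 'a \<times> 'a) \<times> ('a \<times> 's) \<times> ('o \<times> 'i \<times> 'a \<times> 'a),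
     'o \<times> 'a \<times> 'a \<times> 'a, ('o \<times> 'a \<times> 'a \<times> 'a) \<times> ('a \<times> 'a sq) \<times> ('o \<times> 'a \<times> 'a \<times> 'a)) func" where
  "over_func u = \<lparr>OM = over_obj (OM u),
     AM = (\<lambda>(p, (x, \<sigma>), q). (over_obj (OM u) p, (x, AM u \<sigma>), over_obj (OM u) q))\<rparr>"

text \<open>For \<open>f\<close> over \<open>X\<close> via \<open>a = b \<circ> f\<close> and \<open>h\<close> with codomain \<open>X\<close>, the arrow \<open>h\<^sup>*(f)\<close> goes from the
  chosen pullback of \<open>a\<close> to the chosen pullback of \<open>b\<close>.\<close>

definition Q_arrow :: "('o, 'a) cat \<Rightarrow> ('a \<Rightarrow> 'a \<Rightarrow> 'a \<times> 'a) \<Rightarrow> 'o \<times> 'a \<times> 'a \<times> 'a \<Rightarrow> 'a \<Rightarrow> 'a" where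
  "Q_arrow E pb = (\<lambda>(X, f, a, b) h. pb_map E pb a h b h f (Ide E (Dom E h)))"

definition Q_obj ::
  "('o, 'a) cat \<Rightarrow> ('a \<Rightarrow> 'a \<Rightarrow> 'a \<times> 'a) \<Rightarrow> 'o \<times> 'a \<times> 'a \<times> 'a \<Rightarrow> 'a \<Rightarrow> 'o \<times> 'a \<times> 'a \<times> 'a" where
  "Q_obj E pb = (\<lambda>(X, f, a, b) h. (Dom E h, Q_arrow E pb (X, f, a, b) h, pbase pb a h, pbase pb b h))"

definition Q_func :: "('o, 'a) cat \<Rightarrow> ('a \<Rightarrow> 'a \<Rightarrow> 'a \<times> 'a) \<Rightarrow>
    (('o \<times> 'a \<times> 'a \<times> 'a) \<times> 'a, (('o \<times> 'a \<times> 'a \<times> 'a) \<times> ('a \<times> 'a sq) \<times> ('o \<times> 'a \<times> 'a \<times> 'a)) \<times> 'a sq,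
     'o \<times> 'a \<times> 'a \<times> 'a, ('o \<times> 'a \<times> 'a \<times> 'a) \<times> ('a \<times> 'a sq) \<times> ('o \<times> 'a \<times> 'a \<times> 'a)) func" where
  "Q_func E pb =
     \<lparr>OM = (\<lambda>(p, h). Q_obj E pb p h),
      AM = (\<lambda>(((X, f, a, b), (x, (_, (s, t), _)), (X', f', a', b')), (h, (y, _), h')).
              (Q_obj E pb (X, f, a, b) h,
               (y, (Q_arrow E pb (X, f, a, b) h,
                    (pb_map E pb a h a' h' s y, pb_map E pb b h b' h' t y),
                    Q_arrow E pb (X', f', a', b') h')),
               Q_obj E pb (X', f', a', b') h'))\<rparr>"

definition generalized_frobenius ::
  "('o, 'a) cat \<Rightarrow> ('a \<Rightarrow> 'a \<Rightarrow> 'a \<times> 'a) \<Rightarrow>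
   ('i, 's) cat \<Rightarrow> ('i, 's, 'a, 'a sq) func \<Rightarrow>
   ('j, 't) cat \<Rightarrow> ('j, 't, 'a, 'a sq) func \<Rightarrow>
   ('l, 'r) cat \<Rightarrow> ('l, 'r, 'a, 'a sq) func \<Rightarrow> bool" where
  "generalized_frobenius E pb I u J v K w \<longleftrightarrow>
     (\<exists>Q'. is_functor (fib_prod (over_cat E I u) J over_proj (comp_func (cod_func E) v))
             (over_cat E K w) Q' \<and>
           functor_eq (fib_prod (over_cat E I u) J over_proj (comp_func (cod_func E) v))
             (comp_func (over_func w) Q')
             (comp_func (Q_func E pb) (prod_func (over_func u) v)))"

end

theory Submission
  imports Defs
begin

text \<open>
Both conditions say that left maps pull back to left maps along right maps, compatibly with morphisms.
They differ in the left maps that are pulled back: all of them, or only the generators \<open>u\<^sub>i\<close>, but then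
over an arbitrary base \<open>b : B\<^sub>i \<rightarrow> X\<close>. Write \<open>R\<close> for the category of right \<open>I\<close>-maps and \<open>L\<close> for the
category of left \<open>R\<close>-maps.

All functors in question are lifts through faithful forgetful functors to the arrow category, that
is, choices of structure making given squares into morphisms (\<open>frob_lift_iff\<close>,
\<open>gen_frob_lift_iff\<close>). Such choices can be moved along functors over the arrow category, so
it suffices to have comparison functors between the categories involved: algebraic freeness
identifies monad algebras with \<open>R\<close>; a coalgebra gives fillers against all algebras by passing through
the factorizations, and conversely fillers against free algebras give a coalgebra
(\<open>L_map_left_maps\<close>, \<open>left_maps_L_map\<close>). An algebra for the pointed endofunctor is a retract of a free
algebra over the same codomain, and left maps are closed under retracts (\<open>frob_choice_R_map\<close>).
What remains is to compare the two conditions for \<open>L\<close> and \<open>R\<close>.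

If all left maps can be pulled back, then so can \<open>u\<^sub>i\<close> over any base: the pullback of \<open>u\<^sub>i\<close> along
\<open>h : Y \<rightarrow> X\<close> over \<open>X\<close> is its pullback along the base change \<open>b\<^sup>*(h)\<close>, which is again a right map
(\<open>frob_imp_gen_frob\<close>).

For the converse let \<open>f\<close> be a left map into \<open>X\<close>. A lifting problem \<open>(s, t)\<close> of \<open>h\<^sup>*(f)\<close> against a
right map \<open>k\<close> is, by pulling \<open>k\<close> back along \<open>t\<close> and transposing along the adjunction between pullback
and pushforward, a lifting problem of \<open>f\<close> against the pushforward of \<open>t\<^sup>*(k)\<close> along \<open>h\<close>. So it is enough
that this pushforward is a right map. By the same transposition, its lifting problems against
\<open>u\<^sub>i\<close> are problems of \<open>h\<^sup>*(u\<^sub>i)\<close> against \<open>k\<close>, which the hypothesis solves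
(\<open>push_fill_Ob\<close>). The delicate point is naturality of the resulting fillers in \<open>f\<close>, \<open>h\<close> and \<open>k\<close>, because
pushforwards over different bases have to be compared as right maps
(\<open>frob_fill_natural\<close>, \<open>gen_frob_imp_frob\<close>).\<close>

section \<open>Calculating with arrows and chosen pullbacks\<close>

lemma hom_iff [simp]: "f \<in> hom C x y \<longleftrightarrow> f \<in> Ar C \<and> Dom C f = x \<and> Cod C f = y"
  by (simp add: hom_def)

lemma arrow_cat_simps [simp]:
  "Ob (arrow_cat E) = Ar E"
  "Dom (arrow_cat E) (f, q, g) = f" "Cod (arrow_cat E) (f, q, g) = g"
  "Ide (arrow_cat E) f = (f, (Ide E (Dom E f), Ide E (Cod E f)), f)"
  "Comp (arrow_cat E) (g, (s', t'), h) (f, (s, t), g') = (f, (Comp E s' s, Comp E t' t), h)"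
  by (auto simp: arrow_cat_def)

lemma top_bot_simps [simp]: "top_of (f, (s, t), g) = s" "bot_of (f, (s, t), g) = t"
  by (auto simp: top_of_def bot_of_def)

locale cat =
  fixes E :: "('o, 'a) cat"
  assumes category_E: "category E"
begin

abbreviation comp (infixr "\<cdot>" 70) where "g \<cdot> f \<equiv> Comp E g f"
abbreviation ide where "ide \<equiv> Ide E"
abbreviation dom where "dom \<equiv> Dom E"
abbreviation cod where "cod \<equiv> Cod E"
abbreviation arr where "arr f \<equiv> f \<in> Ar E"

lemma dom_Ob [simp]: "arr f \<Longrightarrow> dom f \<in> Ob E"
  and cod_Ob [simp]: "arr f \<Longrightarrow> cod f \<in> Ob E"
  and ide_arr [simp]: "x \<in> Ob E \<Longrightarrow> arr (ide x)"
  and dom_ide [simp]: "x \<in> Ob E \<Longrightarrow> dom (ide x) = x"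
  and cod_ide [simp]: "x \<in> Ob E \<Longrightarrow> cod (ide x) = x"
  and comp_arr [simp]: "arr f \<Longrightarrow> arr g \<Longrightarrow> dom g = cod f \<Longrightarrow> arr (g \<cdot> f)"
  and dom_comp [simp]: "arr f \<Longrightarrow> arr g \<Longrightarrow> dom g = cod f \<Longrightarrow> dom (g \<cdot> f) = dom f"
  and cod_comp [simp]: "arr f \<Longrightarrow> arr g \<Longrightarrow> dom g = cod f \<Longrightarrow> cod (g \<cdot> f) = cod g"
  using category_E by (auto simp: category_def)

lemma comp_ide_dom [simp]: "arr f \<Longrightarrow> dom f = x \<Longrightarrow> f \<cdot> ide x = f"
  and comp_ide_cod [simp]: "arr f \<Longrightarrow> cod f = x \<Longrightarrow> ide x \<cdot> f = f"
  using category_E by (auto simp: category_def)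

lemma assoc [simp]: "arr f \<Longrightarrow> arr g \<Longrightarrow> arr h \<Longrightarrow> dom g = cod f \<Longrightarrow> dom h = cod g \<Longrightarrow>
    (h \<cdot> g) \<cdot> f = h \<cdot> g \<cdot> f"
  using category_E by (simp add: category_def)

lemma comp_eq_extend:
  assumes "u \<cdot> v = w" "arr u" "arr v" "dom u = cod v" "arr r" "dom v = cod r"
  shows "u \<cdot> v \<cdot> r = w \<cdot> r"
  using assms by (metis assoc)

lemma square_iff: "square E f g s t \<longleftrightarrow> arr f \<and> arr g \<and> arr s \<and> arr t \<and> dom s = dom f \<and> cod s = dom g \<and>
    dom t = cod f \<and> cod t = cod g \<and> t \<cdot> f = g \<cdot> s"
  by (auto simp: arrow_cat_def)

lemma square_comp:
  assumes "square E f g s t" "square E g h s' t'"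
  shows "square E f h (s' \<cdot> s) (t' \<cdot> t)"
proof -
  note a = assms[unfolded square_iff]
  have "t' \<cdot> t \<cdot> f = t' \<cdot> g \<cdot> s"
    using a by argo
  also have "\<dots> = (h \<cdot> s') \<cdot> s"
    using a by (intro comp_eq_extend) auto
  finally show ?thesis
    using a by (simp add: square_iff)
qed

lemma category_arrow_cat: "category (arrow_cat E)"
  unfolding category_def
proof (intro conjI ballI impI)
  fix f assume "f \<in> Ar (arrow_cat E)"
  then show "Dom (arrow_cat E) f \<in> Ob (arrow_cat E)" "Cod (arrow_cat E) f \<in> Ob (arrow_cat E)"
    "Comp (arrow_cat E) f (Ide (arrow_cat E) (Dom (arrow_cat E) f)) = f"
    "Comp (arrow_cat E) (Ide (arrow_cat E) (Cod (arrow_cat E) f)) f = f"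
    by (auto simp: arrow_cat_def)
next
  fix x assume "x \<in> Ob (arrow_cat E)"
  then show "Ide (arrow_cat E) x \<in> hom (arrow_cat E) x x"
    by (auto simp: arrow_cat_def)
next
  fix q r assume "q \<in> Ar (arrow_cat E)" "r \<in> Ar (arrow_cat E)" "Dom (arrow_cat E) r = Cod (arrow_cat E) q"
  moreover obtain f s t g g' s' t' h where "q = (f, (s, t), g)" "r = (g', (s', t'), h)"
    by (cases q, cases r) auto
  ultimately show "Comp (arrow_cat E) r q \<in> hom (arrow_cat E) (Dom (arrow_cat E) q) (Cod (arrow_cat E) r)"
    using square_comp[of f s t g s' t' h] by simp
next
  fix f g h assume "f \<in> Ar (arrow_cat E)" "g \<in> Ar (arrow_cat E)" "h \<in> Ar (arrow_cat E)"
    "Dom (arrow_cat E) g = Cod (arrow_cat E) f" "Dom (arrow_cat E) h = Cod (arrow_cat E) g"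
  then show "Comp (arrow_cat E) h (Comp (arrow_cat E) g f) = Comp (arrow_cat E) (Comp (arrow_cat E) h g) f"
    by (auto simp: arrow_cat_def)
qed

end

locale pb_cat = cat E for E :: "('o, 'a) cat" +
  fixes pb :: "'a \<Rightarrow> 'a \<Rightarrow> 'a \<times> 'a"
  assumes chosen: "chosen_pullbacks E pb"
begin

abbreviation pA where "pA \<equiv> ptotal pb"
abbreviation pB where "pB \<equiv> pbase pb"
abbreviation pair where "pair \<equiv> induced E pb"
abbreviation pm where "pm \<equiv> pb_map E pb"

definition cospan :: "'a \<Rightarrow> 'a \<Rightarrow> bool" where
  "cospan f g \<longleftrightarrow> arr f \<and> arr g \<and> cod f = cod g"

definition PB :: "'a \<Rightarrow> 'a \<Rightarrow> 'o" where
  "PB f g = dom (pA f g)"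

definition cone :: "'a \<Rightarrow> 'a \<Rightarrow> 'a \<Rightarrow> 'a \<Rightarrow> bool" where
  "cone f g z w \<longleftrightarrow> cospan f g \<and> arr z \<and> arr w \<and> dom z = dom w \<and> cod z = dom f \<and> cod w = dom g \<and>
     f \<cdot> z = g \<cdot> w"

lemma cospan_arr: assumes "cospan f g" shows "arr f" "arr g" "cod f = cod g"
  using assms by (auto simp: cospan_def)

lemma pullback_chosen: "cospan f g \<Longrightarrow> is_pullback E f g (pA f g) (pB f g)"
  using chosen by (simp add: cospan_def chosen_pullbacks_def ptotal_def pbase_def)

lemma pb_proj [simp]:
  assumes "cospan f g"
  shows "arr (pA f g)" "arr (pB f g)" "dom (pA f g) = PB f g" "dom (pB f g) = PB f g"
    "cod (pA f g) = dom f" "cod (pB f g) = dom g" "PB f g \<in> Ob E"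
  using pullback_chosen[OF assms] unfolding is_pullback_def PB_def by auto

lemma pb_commutes: "cospan f g \<Longrightarrow> f \<cdot> pA f g = g \<cdot> pB f g"
  using pullback_chosen unfolding is_pullback_def by auto

lemma pb_commutes_extend:
  "cospan f g \<Longrightarrow> arr r \<Longrightarrow> cod r = PB f g \<Longrightarrow> f \<cdot> pA f g \<cdot> r = g \<cdot> pB f g \<cdot> r"
  using pb_commutes[of f g] by (metis assoc cospan_arr(1,2) pb_proj(1-6))

lemma pair_ex1: "cone f g z w \<Longrightarrow> \<exists>!m. m \<in> hom E (dom z) (PB f g) \<and> pA f g \<cdot> m = z \<and> pB f g \<cdot> m = w"
  using pullback_chosen unfolding is_pullback_def cone_def PB_def by blast

lemma pair_props [simp]:
  assumes "cone f g z w"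
  shows "arr (pair f g z w)" "dom (pair f g z w) = dom w" "cod (pair f g z w) = PB f g"
    "pA f g \<cdot> pair f g z w = z" "pB f g \<cdot> pair f g z w = w"
  using theI'[OF pair_ex1[OF assms]] assms
  unfolding PB_def induced_def[symmetric] cone_def by simp_all

lemma coneD:
  assumes "cone f g z w"
  shows "cospan f g" "arr z" "arr w" "dom z = dom w" "cod z = dom f" "cod w = dom g" "f \<cdot> z = g \<cdot> w"
  using assms by (auto simp: cone_def)

lemma pair_props_extend [simp]:
  assumes "cone f g z w" "arr r" "cod r = dom w"
  shows "pA f g \<cdot> pair f g z w \<cdot> r = z \<cdot> r" "pB f g \<cdot> pair f g z w \<cdot> r = w \<cdot> r"
  using assms coneD[OF assms(1)] by (auto intro!: comp_eq_extend)

lemma pb_eqI: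
  assumes "cospan f g" "arr m" "arr m'" "cod m = PB f g" "cod m' = PB f g"
    "pA f g \<cdot> m = pA f g \<cdot> m'" "pB f g \<cdot> m = pB f g \<cdot> m'"
  shows "m = m'"
proof -
  have d: "dom m = dom m'"
    using dom_comp[of m "pA f g"] dom_comp[of m' "pA f g"] assms(1-6) by (metis pb_proj(1,3))
  have "cone f g (pA f g \<cdot> m) (pB f g \<cdot> m)"
    using assms by (simp add: cone_def cospan_arr pb_commutes_extend)
  from pair_ex1[OF this] show ?thesis
    using assms d by auto
qed

lemma pair_comp:
  assumes "cone f g z w" "arr r" "cod r = dom w"
  shows "pair f g z w \<cdot> r = pair f g (z \<cdot> r) (w \<cdot> r)" and "cone f g (z \<cdot> r) (w \<cdot> r)"
proof -
  have "f \<cdot> z \<cdot> r = g \<cdot> w \<cdot> r"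
    using assms coneD[OF assms(1)] by (metis assoc cospan_arr(1,2))
  then show c: "cone f g (z \<cdot> r) (w \<cdot> r)"
    using assms coneD[OF assms(1)] by (simp add: cone_def)
  show "pair f g z w \<cdot> r = pair f g (z \<cdot> r) (w \<cdot> r)"
    by (rule pb_eqI[of f g]) (use assms coneD[OF assms(1)] c in simp_all)
qed

text \<open>The two outer legs \<open>s, y\<close> of a morphism of cospans already determine the induced map of pullbacks,
so the map between the vertices is only required to exist.\<close>

definition cospan_map :: "'a \<Rightarrow> 'a \<Rightarrow> 'a \<Rightarrow> 'a \<Rightarrow> 'a \<Rightarrow> 'a \<Rightarrow> bool" where
  "cospan_map f g f' g' s y \<longleftrightarrow> cospan f g \<and> cospan f' g' \<and>
     arr s \<and> dom s = dom f \<and> cod s = dom f' \<and> arr y \<and> dom y = dom g \<and> cod y = dom g' \<and>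
     (\<exists>x. arr x \<and> dom x = cod f \<and> cod x = cod f' \<and> f' \<cdot> s = x \<cdot> f \<and> g' \<cdot> y = x \<cdot> g)"

lemma cospan_mapD:
  assumes "cospan_map f g f' g' s y"
  shows "cospan f g" "cospan f' g'" "arr s" "dom s = dom f" "cod s = dom f'"
    "arr y" "dom y = dom g" "cod y = dom g'"
  using assms by (auto simp: cospan_map_def)

lemma cospan_map_cone:
  assumes "cospan_map f g f' g' s y"
  shows "cone f' g' (s \<cdot> pA f g) (y \<cdot> pB f g)"
proof -
  from assms obtain x where x: "arr x" "dom x = cod f" "cod x = cod f'" "f' \<cdot> s = x \<cdot> f" "g' \<cdot> y = x \<cdot> g"
    by (auto simp: cospan_map_def)
  note c = cospan_mapD[OF assms]
  have "f' \<cdot> s \<cdot> pA f g = (x \<cdot> f) \<cdot> pA f g"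
    using c x by (intro comp_eq_extend) (simp_all add: cospan_arr)
  also have "\<dots> = x \<cdot> g \<cdot> pB f g"
    using c x by (simp add: cospan_arr[of f g] pb_commutes)
  also have "\<dots> = (g' \<cdot> y) \<cdot> pB f g"
    using c x cospan_arr[of f g] by simp
  also have "\<dots> = g' \<cdot> y \<cdot> pB f g"
    using c cospan_arr[of f' g'] by simp
  finally show ?thesis
    using c by (simp add: cone_def)
qed

lemma pm_props [simp]:
  assumes "cospan_map f g f' g' s y"
  shows "arr (pm f g f' g' s y)" "dom (pm f g f' g' s y) = PB f g" "cod (pm f g f' g' s y) = PB f' g'"
    "pA f' g' \<cdot> pm f g f' g' s y = s \<cdot> pA f g" "pB f' g' \<cdot> pm f g f' g' s y = y \<cdot> pB f g"
  using cospan_map_cone[OF assms] cospan_mapD[OF assms] by (simp_all add: pb_map_def)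

lemma pm_props_extend [simp]:
  assumes "cospan_map f g f' g' s y" "arr r" "cod r = PB f g"
  shows "pA f' g' \<cdot> pm f g f' g' s y \<cdot> r = s \<cdot> pA f g \<cdot> r" "pB f' g' \<cdot> pm f g f' g' s y \<cdot> r = y \<cdot> pB f g \<cdot> r"
  using cospan_map_cone[OF assms(1)] cospan_mapD[OF assms(1)] assms by (simp_all add: pb_map_def)

lemma cospan_map_comp:
  assumes "cospan_map f g f' g' s y" "cospan_map f' g' f'' g'' s' y'"
  shows "cospan_map f g f'' g'' (s' \<cdot> s) (y' \<cdot> y)"
proof -
  from assms(1) obtain x where x: "arr x" "dom x = cod f" "cod x = cod f'" "f' \<cdot> s = x \<cdot> f" "g' \<cdot> y = x \<cdot> g"
    by (auto simp: cospan_map_def)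
  from assms(2) obtain x' where x': "arr x'" "dom x' = cod f'" "cod x' = cod f''" "f'' \<cdot> s' = x' \<cdot> f'" "g'' \<cdot> y' = x' \<cdot> g'"
    by (auto simp: cospan_map_def)
  note c = cospan_mapD[OF assms(1)] cospan_mapD[OF assms(2)]
  have "f'' \<cdot> s' \<cdot> s = (x' \<cdot> x) \<cdot> f"
    using c x x' comp_eq_extend[OF x'(4), of s] by (simp add: cospan_arr[of f'' g''] cospan_arr[of f g] cospan_arr[of f' g'])
  moreover have "g'' \<cdot> y' \<cdot> y = (x' \<cdot> x) \<cdot> g"
    using c x x' comp_eq_extend[OF x'(5), of y] by (simp add: cospan_arr[of f'' g''] cospan_arr[of f g] cospan_arr[of f' g'])
  ultimately show ?thesis
    using c x x' unfolding cospan_map_def by (auto intro!: exI[of _ "x' \<cdot> x"])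
qed

lemma pm_comp:
  assumes "cospan_map f g f' g' s y" "cospan_map f' g' f'' g'' s' y'"
  shows "pm f' g' f'' g'' s' y' \<cdot> pm f g f' g' s y = pm f g f'' g'' (s' \<cdot> s) (y' \<cdot> y)"
  using cospan_mapD[OF assms(1)] cospan_mapD[OF assms(2)] cospan_map_comp[OF assms] assms
  by - (rule pb_eqI[of f'' g'']; simp)

lemma cospan_map_ide:
  "cospan f g \<Longrightarrow> cospan_map f g f g (ide (dom f)) (ide (dom g))"
  unfolding cospan_map_def by (auto simp: cospan_arr intro!: exI[of _ "ide (cod g)"])

lemma pm_ide: "cospan f g \<Longrightarrow> pm f g f g (ide (dom f)) (ide (dom g)) = ide (PB f g)"
  using cospan_map_ide[of f g] by - (rule pb_eqI[of f g]; simp)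

lemma pm_pair:
  assumes "cospan_map f g f' g' s y" "cone f g z w"
  shows "pm f g f' g' s y \<cdot> pair f g z w = pair f' g' (s \<cdot> z) (y \<cdot> w)" "cone f' g' (s \<cdot> z) (y \<cdot> w)"
  using pair_comp[OF cospan_map_cone[OF assms(1)], of "pair f g z w"] cospan_mapD[OF assms(1)] coneD[OF assms(2)] assms(2)
  by (simp_all add: pb_map_def)

end

section \<open>Categories of structured arrows\<close>

lemma struct_cat_simps [simp]:
  "Ob (struct_cat C S M) = S"
  "Dom (struct_cat C S M) (X, h, Y) = X" "Cod (struct_cat C S M) (X, h, Y) = Y"
  "Ide (struct_cat C S M) X = (X, Ide C (fst X), X)"
  "Comp (struct_cat C S M) (Y', k, Z) (X, h, Y) = (X, Comp C k h, Z)"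
  "(X, h, Y) \<in> Ar (struct_cat C S M) \<longleftrightarrow>
     X \<in> S \<and> Y \<in> S \<and> h \<in> Ar C \<and> Dom C h = fst X \<and> Cod C h = fst Y \<and> M X h Y"
  by (auto simp: struct_cat_def)

lemma category_struct_cat:
  assumes C: "category C" and S: "\<And>X. X \<in> S \<Longrightarrow> fst X \<in> Ob C"
    and ide: "\<And>X. X \<in> S \<Longrightarrow> M X (Ide C (fst X)) X"
    and comp: "\<And>X Y Z h k. X \<in> S \<Longrightarrow> Y \<in> S \<Longrightarrow> Z \<in> S \<Longrightarrow> h \<in> hom C (fst X) (fst Y) \<Longrightarrow>
      k \<in> hom C (fst Y) (fst Z) \<Longrightarrow> M X h Y \<Longrightarrow> M Y k Z \<Longrightarrow> M X (Comp C k h) Z"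
  shows "category (struct_cat C S M)"
proof -
  interpret C: cat C using C by unfold_locales
  let ?K = "struct_cat C S M"
  show ?thesis
    unfolding category_def
  proof (intro conjI ballI impI)
    fix f g assume "f \<in> Ar ?K" "g \<in> Ar ?K" "Dom ?K g = Cod ?K f"
    moreover obtain X h Y Y' k Z where "f = (X, h, Y)" "g = (Y', k, Z)"
      by (cases f, cases g) auto
    ultimately show "Comp ?K g f \<in> hom ?K (Dom ?K f) (Cod ?K g)"
      using comp[of X Y Z h k] by auto
  qed (auto simp: S ide)
qed

lemma is_functor_forget:
  assumes "category (struct_cat C S M)" "category C" "\<And>X. X \<in> S \<Longrightarrow> fst X \<in> Ob C"
  shows "is_functor (struct_cat C S M) C forget"
  unfolding is_functor_def using assms by (auto simp: forget_def)

text \<open>The fixed shape of arrows in these categories makes the forgetful functor to the arrow category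
faithful: an arrow is its two ends together with the underlying square.\<close>

definition structured :: "('o, 'a) cat \<Rightarrow> ('a \<times> 'x, ('a \<times> 'x) \<times> 'a sq \<times> ('a \<times> 'x)) cat \<Rightarrow> bool" where
  "structured E K \<longleftrightarrow> category K \<and> (\<exists>S M. K = struct_cat (arrow_cat E) S M \<and> fst ` S \<subseteq> Ar E)"

lemma structuredE:
  assumes "structured E K"
  obtains S M where "K = struct_cat (arrow_cat E) S M" "category K" "\<And>X. X \<in> S \<Longrightarrow> fst X \<in> Ar E"
  using assms by (auto simp: structured_def)

lemma structured_simps:
  assumes "structured E K"
  shows "Dom K (X, h, Y) = X" "Cod K (X, h, Y) = Y"
    "Ide K X = (X, Ide (arrow_cat E) (fst X), X)"
    "Comp K (Y', k, Z) (X, h, Y) = (X, Comp (arrow_cat E) k h, Z)"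
  using assms by (auto elim!: structuredE)

lemma structured_Ob: "structured E K \<Longrightarrow> X \<in> Ob K \<Longrightarrow> fst X \<in> Ar E"
  by (auto elim!: structuredE)

lemma structured_Ar:
  assumes "structured E K" "(X, h, Y) \<in> Ar K"
  shows "X \<in> Ob K" "Y \<in> Ob K" "h \<in> Ar (arrow_cat E)" "Dom (arrow_cat E) h = fst X" "Cod (arrow_cat E) h = fst Y"
  using assms by (auto elim!: structuredE)

lemma structured_ArE:
  assumes "structured E K" "q \<in> Ar K"
  obtains f x s t g y where "q = ((f, x), (f, (s, t), g), (g, y))" "(f, x) \<in> Ob K" "(g, y) \<in> Ob K" "square E f g s t"
  using assms by (cases q) (auto elim!: structuredE)

lemma structured_functor:
  "category E \<Longrightarrow> structured E K \<Longrightarrow> is_functor K (arrow_cat E) forget"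
  by (auto elim!: structuredE intro!: is_functor_forget cat.category_arrow_cat[unfolded cat_def])

lemma forget_simps [simp]: "OM forget X = fst X" "AM forget (X, h, Y) = h"
  by (auto simp: forget_def)

lemma comp_func_simps [simp]: "OM (comp_func G F) x = OM G (OM F x)" "AM (comp_func G F) f = AM G (AM F f)"
  by (auto simp: comp_func_def)

lemma id_func_simps [simp]: "OM id_func x = x" "AM id_func f = f"
  by (auto simp: id_func_def)

lemma prod_func_simps [simp]:
  "OM (prod_func F G) (x, y) = (OM F x, OM G y)" "AM (prod_func F G) (f, g) = (AM F f, AM G g)"
  by (auto simp: prod_func_def)

lemma cod_func_simps [simp]: "OM (cod_func E) f = Cod E f" "AM (cod_func E) q = bot_of q"
  by (auto simp: cod_func_def)

lemma is_functorD:
  assumes "is_functor C D F"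
  shows "category C" "category D" "x \<in> Ob C \<Longrightarrow> OM F x \<in> Ob D"
    "f \<in> Ar C \<Longrightarrow> AM F f \<in> Ar D" "f \<in> Ar C \<Longrightarrow> Dom D (AM F f) = OM F (Dom C f)"
    "f \<in> Ar C \<Longrightarrow> Cod D (AM F f) = OM F (Cod C f)"
    "x \<in> Ob C \<Longrightarrow> AM F (Ide C x) = Ide D (OM F x)"
    "f \<in> Ar C \<Longrightarrow> g \<in> Ar C \<Longrightarrow> Dom C g = Cod C f \<Longrightarrow> AM F (Comp C g f) = Comp D (AM F g) (AM F f)"
  using assms by (auto simp: is_functor_def)

lemma is_functor_comp:
  assumes "is_functor C D F" "is_functor D B G"
  shows "is_functor C B (comp_func G F)"
  unfolding is_functor_def using is_functorD[OF assms(1)] is_functorD[OF assms(2)]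
  by (auto simp: is_functor_def)

lemma category_fib_prod:
  assumes F: "is_functor C B F" and G: "is_functor D B G"
  shows "category (fib_prod C D F G)"
proof -
  interpret C: cat C using is_functorD(1)[OF F] by unfold_locales
  interpret D: cat D using is_functorD(1)[OF G] by unfold_locales
  note f = is_functorD[OF F] and g = is_functorD[OF G]
  show ?thesis
    unfolding category_def by (auto simp: fib_prod_def f g)
qed

lemma functor_square:
  assumes "is_functor I (arrow_cat E) u" "\<sigma> \<in> Ar I"
  shows "AM u \<sigma> = (OM u (Dom I \<sigma>), (top_of (AM u \<sigma>), bot_of (AM u \<sigma>)), OM u (Cod I \<sigma>))"
    and "square E (OM u (Dom I \<sigma>)) (OM u (Cod I \<sigma>)) (top_of (AM u \<sigma>)) (bot_of (AM u \<sigma>))"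
proof -
  obtain f s t g where q: "AM u \<sigma> = (f, (s, t), g)"
    by (cases "AM u \<sigma>") auto
  show "AM u \<sigma> = (OM u (Dom I \<sigma>), (top_of (AM u \<sigma>), bot_of (AM u \<sigma>)), OM u (Cod I \<sigma>))"
    using is_functorD(5,6)[OF assms] q by simp
  then show "square E (OM u (Dom I \<sigma>)) (OM u (Cod I \<sigma>)) (top_of (AM u \<sigma>)) (bot_of (AM u \<sigma>))"
    using is_functorD(4)[OF assms] by simp
qed

lemma is_functor_cod_func:
  assumes "category E"
  shows "is_functor (arrow_cat E) E (cod_func E)"
proof -
  interpret cat E using assms by unfold_locales
  show ?thesis
    unfolding is_functor_def using category_arrow_cat assms by (auto simp: square_iff)
qed

lemma over_cat_simps:
  "(X, i, a, b) \<in> Ob (over_cat E I u) \<longleftrightarrow> X \<in> Ob E \<and> i \<in> Ob I \<and> a \<in> hom E (Dom E (OM u i)) X \<and>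
     b \<in> hom E (Cod E (OM u i)) X \<and> Comp E b (OM u i) = a"
  "(p, (x, \<sigma>), q) \<in> Ar (over_cat E I u) \<longleftrightarrow> p \<in> Ob (over_cat E I u) \<and> q \<in> Ob (over_cat E I u) \<and>
     x \<in> hom E (fst p) (fst q) \<and> \<sigma> \<in> hom I (fst (snd p)) (fst (snd q)) \<and>
     Comp E (fst (snd (snd q))) (top_of (AM u \<sigma>)) = Comp E x (fst (snd (snd p))) \<and>
     Comp E (snd (snd (snd q))) (bot_of (AM u \<sigma>)) = Comp E x (snd (snd (snd p)))"
  "Dom (over_cat E I u) (p, m, q) = p" "Cod (over_cat E I u) (p, m, q) = q"
  "Ide (over_cat E I u) (X, i, a, b) = ((X, i, a, b), (Ide E X, Ide I i), (X, i, a, b))"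
  "Comp (over_cat E I u) (q', (x', \<sigma>'), r) (p, (x, \<sigma>), q) = (p, (Comp E x' x, Comp I \<sigma>' \<sigma>), r)"
  by (auto simp: over_cat_def Let_def)

lemma over_proj_simps [simp]:
  "OM over_proj (X, i, a, b) = X" "AM over_proj (p, (x, \<sigma>), q) = x"
  by (auto simp: over_proj_def)

lemma category_over_cat:
  assumes "category E" and u: "is_functor I (arrow_cat E) u"
  shows "category (over_cat E I u)"
proof -
  interpret cat E using assms(1) by unfold_locales
  interpret I: cat I using is_functorD(1)[OF u] by unfold_locales
  note uu = is_functorD[OF u]
  have comp: "Comp (over_cat E I u) (q, (x', \<sigma>'), r) (p, (x, \<sigma>), q) \<in> Ar (over_cat E I u)"
    if 1: "(p, (x, \<sigma>), q) \<in> Ar (over_cat E I u)" and 2: "(q, (x', \<sigma>'), r) \<in> Ar (over_cat E I u)" for p x \<sigma> q x' \<sigma>' r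
  proof -
    obtain X i a b X' i' a' b' X'' i'' a'' b''
      where pqr: "p = (X, i, a, b)" "q = (X', i', a', b')" "r = (X'', i'', a'', b'')"
      by (cases p, cases q, cases r) auto
    have h: "arr x" "dom x = X" "cod x = X'" "\<sigma> \<in> Ar I" "Dom I \<sigma> = i" "Cod I \<sigma> = i'"
        "a' \<cdot> top_of (AM u \<sigma>) = x \<cdot> a" "b' \<cdot> bot_of (AM u \<sigma>) = x \<cdot> b"
        "arr x'" "dom x' = X'" "cod x' = X''" "\<sigma>' \<in> Ar I" "Dom I \<sigma>' = i'" "Cod I \<sigma>' = i''"
        "a'' \<cdot> top_of (AM u \<sigma>') = x' \<cdot> a'" "b'' \<cdot> bot_of (AM u \<sigma>') = x' \<cdot> b'"
      and ob: "p \<in> Ob (over_cat E I u)" "q \<in> Ob (over_cat E I u)" "r \<in> Ob (over_cat E I u)"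
      using 1 2 unfolding over_cat_simps(2) by (simp_all add: pqr)
    have h': "arr a" "dom a = dom (OM u i)" "cod a = X" "arr b" "dom b = cod (OM u i)" "cod b = X"
        "arr a'" "dom a' = dom (OM u i')" "cod a' = X'" "arr b'" "dom b' = cod (OM u i')" "cod b' = X'"
        "arr a''" "dom a'' = dom (OM u i'')" "cod a'' = X''" "arr b''" "dom b'' = cod (OM u i'')" "cod b'' = X''"
      using ob unfolding pqr over_cat_simps(1) by simp_all
    note s = h(4) h(12) and d = h(5,6,13,14)
    note sq = functor_square[OF u s(1), unfolded d] functor_square[OF u s(2), unfolded d]
    obtain t1 t2 b1 b2 where tb: "AM u \<sigma> = (OM u i, (t1, b1), OM u i')" "AM u \<sigma>' = (OM u i', (t2, b2), OM u i'')"
      using sq(1,3) by metis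
    have c: "AM u (Comp I \<sigma>' \<sigma>) = (OM u i, (t2 \<cdot> t1, b2 \<cdot> b1), OM u i'')"
      using uu(8)[OF s] d by (simp add: tb)
    have t: "arr t1" "arr t2" "arr b1" "arr b2" "dom t1 = dom (OM u i)" "cod t1 = dom (OM u i')"
      "dom t2 = dom (OM u i')" "cod t2 = dom (OM u i'')" "dom b1 = cod (OM u i)" "cod b1 = cod (OM u i')"
      "dom b2 = cod (OM u i')" "cod b2 = cod (OM u i'')"
      using sq(2,4) by (simp_all add: tb square_iff)
    have e: "a'' \<cdot> t2 \<cdot> t1 = x' \<cdot> x \<cdot> a" "b'' \<cdot> b2 \<cdot> b1 = x' \<cdot> x \<cdot> b"
      using h(7,8,15,16) h(1-3,9-11) h' t unfolding tb top_bot_simps by (metis assoc)+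
    show ?thesis
      unfolding over_cat_simps(2,6) using ob s d e h(1-3,9-11) h' by (simp add: pqr c I.comp_arr)
  qed
  show ?thesis
    unfolding category_def
  proof (intro conjI ballI impI)
    fix f g assume fg: "f \<in> Ar (over_cat E I u)" "g \<in> Ar (over_cat E I u)" "Dom (over_cat E I u) g = Cod (over_cat E I u) f"
    moreover obtain p x \<sigma> q q' x' \<sigma>' r where f: "f = (p, (x, \<sigma>), q)" and g: "g = (q', (x', \<sigma>'), r)"
      by (cases f, cases g) auto
    ultimately have "q' = q"
      by (simp add: over_cat_simps(3,4))
    then show "Comp (over_cat E I u) g f \<in> hom (over_cat E I u) (Dom (over_cat E I u) f) (Cod (over_cat E I u) g)"
      using comp[of p x \<sigma> q x' \<sigma>' r] fg(1,2) f g by (simp add: over_cat_simps(3,4,6))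
  next
    fix X assume "X \<in> Ob (over_cat E I u)"
    then show "Ide (over_cat E I u) X \<in> hom (over_cat E I u) X X"
      by (cases X) (auto simp: over_cat_simps uu)
  qed (auto simp: over_cat_simps)
qed

lemma is_functor_over_proj:
  assumes "category E" and u: "is_functor I (arrow_cat E) u"
  shows "is_functor (over_cat E I u) E over_proj"
  unfolding is_functor_def using category_over_cat[OF assms] assms(1)
  by (auto simp: over_cat_simps)

section \<open>Lifts of the pullback functors as choices of structure\<close>

lemma functor_square_ide:
  assumes "is_functor I (arrow_cat E) u" "i \<in> Ob I"
  shows "top_of (AM u (Ide I i)) = Ide E (Dom E (OM u i))" "bot_of (AM u (Ide I i)) = Ide E (Cod E (OM u i))"
  using is_functorD(7)[OF assms] by simp_all

lemma functor_square_comp: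
  assumes u: "is_functor I (arrow_cat E) u" and "\<sigma> \<in> Ar I" "\<sigma>' \<in> Ar I" "Dom I \<sigma>' = Cod I \<sigma>"
  shows "top_of (AM u (Comp I \<sigma>' \<sigma>)) = Comp E (top_of (AM u \<sigma>')) (top_of (AM u \<sigma>))"
    "bot_of (AM u (Comp I \<sigma>' \<sigma>)) = Comp E (bot_of (AM u \<sigma>')) (bot_of (AM u \<sigma>))"
proof -
  obtain f s t g f' s' t' g' where "AM u \<sigma> = (f, (s, t), g)" "AM u \<sigma>' = (f', (s', t'), g')"
    by (cases "AM u \<sigma>", cases "AM u \<sigma>'") auto
  then show "top_of (AM u (Comp I \<sigma>' \<sigma>)) = Comp E (top_of (AM u \<sigma>')) (top_of (AM u \<sigma>))"
    "bot_of (AM u (Comp I \<sigma>' \<sigma>)) = Comp E (bot_of (AM u \<sigma>')) (bot_of (AM u \<sigma>))"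
    using is_functorD(8)[OF assms] by simp_all
qed

text \<open>A functor over the arrow category between two such categories amounts to its effect on structures,
by faithfulness of the forgetful functors.\<close>

definition struct_map :: "('a \<times> 'x, ('a \<times> 'x) \<times> 'a sq \<times> ('a \<times> 'x)) cat \<Rightarrow>
    ('a \<times> 'y, ('a \<times> 'y) \<times> 'a sq \<times> ('a \<times> 'y)) cat \<Rightarrow> ('a \<times> 'x \<Rightarrow> 'y) \<Rightarrow> bool" where
  "struct_map K K' \<theta> \<longleftrightarrow> (\<forall>X\<in>Ob K. (fst X, \<theta> X) \<in> Ob K') \<and>
     (\<forall>X h Y. (X, h, Y) \<in> Ar K \<longrightarrow> ((fst X, \<theta> X), h, (fst Y, \<theta> Y)) \<in> Ar K')"

lemma struct_map_comp:
  "struct_map K K' \<theta> \<Longrightarrow> struct_map K' K'' \<zeta> \<Longrightarrow> struct_map K K'' (\<lambda>X. \<zeta> (fst X, \<theta> X))"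
  unfolding struct_map_def by (metis fst_conv)

lemma struct_map_of_functor:
  assumes K: "structured E K" and K': "structured E K'"
    and F: "is_functor K K' F" "functor_eq K (comp_func forget F) forget"
  shows "struct_map K K' (\<lambda>X. snd (OM F X))"
proof -
  have ob: "OM F X = (fst X, snd (OM F X))" if "X \<in> Ob K" for X
    using F(2) that by (cases "OM F X") (auto simp: functor_eq_def)
  have "((fst X, snd (OM F X)), h, (fst Y, snd (OM F Y))) \<in> Ar K'" if a: "(X, h, Y) \<in> Ar K" for X h Y
  proof -
    obtain X' h' Y' where q: "AM F (X, h, Y) = (X', h', Y')"
      by (cases "AM F (X, h, Y)") auto
    have "X' = OM F X" "Y' = OM F Y"
      using is_functorD(5,6)[OF F(1) a] by (simp_all add: q structured_simps[OF K] structured_simps[OF K'])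
    moreover have "h' = h"
      using F(2) a q by (auto simp: functor_eq_def)
    ultimately show ?thesis
      using is_functorD(4)[OF F(1) a] q ob structured_Ar[OF K a] by simp
  qed
  then show ?thesis
    unfolding struct_map_def using is_functorD(3)[OF F(1)] ob by metis
qed

context pb_cat begin

text \<open>The value at \<open>(\<sigma>, \<tau>)\<close> of a lift of the pullback functor whose choice of structures is \<open>\<chi>\<close>.\<close>

abbreviation (input) frob_mor where
  "frob_mor A v B w \<chi> \<sigma> \<tau> \<equiv>
     ((pB (OM v (Dom A \<sigma>)) (OM w (Dom B \<tau>)), \<chi> (Dom A \<sigma>) (Dom B \<tau>)),
      (pB (OM v (Dom A \<sigma>)) (OM w (Dom B \<tau>)),
       (pm (OM v (Dom A \<sigma>)) (OM w (Dom B \<tau>)) (OM v (Cod A \<sigma>)) (OM w (Cod B \<tau>)) (top_of (AM v \<sigma>)) (top_of (AM w \<tau>)),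
        top_of (AM w \<tau>)),
       pB (OM v (Cod A \<sigma>)) (OM w (Cod B \<tau>))),
      (pB (OM v (Cod A \<sigma>)) (OM w (Cod B \<tau>)), \<chi> (Cod A \<sigma>) (Cod B \<tau>)))"

definition frob_choice where
  "frob_choice A v B w K \<chi> \<longleftrightarrow>
    (\<forall>i\<in>Ob A. \<forall>j\<in>Ob B. cod (OM v i) = cod (OM w j) \<longrightarrow> (pB (OM v i) (OM w j), \<chi> i j) \<in> Ob K) \<and>
    (\<forall>\<sigma>\<in>Ar A. \<forall>\<tau>\<in>Ar B. bot_of (AM v \<sigma>) = bot_of (AM w \<tau>) \<longrightarrow>
      frob_mor A v B w \<chi> \<sigma> \<tau> \<in> Ar K)"

lemma frob_cospan_map:
  assumes v: "is_functor A (arrow_cat E) v" and w: "is_functor B (arrow_cat E) w"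
    and "\<sigma> \<in> Ar A" "\<tau> \<in> Ar B" "bot_of (AM v \<sigma>) = bot_of (AM w \<tau>)"
  shows "cospan_map (OM v (Dom A \<sigma>)) (OM w (Dom B \<tau>)) (OM v (Cod A \<sigma>)) (OM w (Cod B \<tau>)) (top_of (AM v \<sigma>)) (top_of (AM w \<tau>))"
  using functor_square(2)[OF v assms(3)] functor_square(2)[OF w assms(4)] assms(5)
  unfolding cospan_map_def cospan_def square_iff by auto

text \<open>The forgetful functor of \<open>K\<close> is faithful, so a lift of a functor through it is nothing but a choice
of structure on the objects for which the given squares become morphisms; functoriality of the lift
is then functoriality of the pullback functor.\<close>

lemma frob_lift_iff:
  assumes v: "is_functor A (arrow_cat E) v" and w: "is_functor B (arrow_cat E) w" and K: "structured E K"
  defines "D \<equiv> fib_prod A B (comp_func (cod_func E) v) (comp_func (cod_func E) w)"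
  shows "(\<exists>P'. is_functor D K P' \<and>
            functor_eq D (comp_func forget P') (comp_func (P_func E pb) (prod_func v w))) \<longleftrightarrow>
         (\<exists>\<chi>. frob_choice A v B w K \<chi>)"
proof
  assume "\<exists>P'. is_functor D K P' \<and>
            functor_eq D (comp_func forget P') (comp_func (P_func E pb) (prod_func v w))"
  then obtain P' where P': "is_functor D K P'"
    and eq: "functor_eq D (comp_func forget P') (comp_func (P_func E pb) (prod_func v w))" by blast
  define \<chi> where "\<chi> i j = snd (OM P' (i, j))" for i j
  have ob: "OM P' (i, j) = (pB (OM v i) (OM w j), \<chi> i j)" "OM P' (i, j) \<in> Ob K"
    if "i \<in> Ob A" "j \<in> Ob B" "cod (OM v i) = cod (OM w j)" for i j
  proof -
    have "(i, j) \<in> Ob D"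
      using that by (simp add: D_def fib_prod_def)
    then show "OM P' (i, j) = (pB (OM v i) (OM w j), \<chi> i j)" "OM P' (i, j) \<in> Ob K"
      using is_functorD(3)[OF P'] eq
      by (auto simp: functor_eq_def \<chi>_def P_func_def prod_eq_iff)
  qed
  have "frob_choice A v B w K \<chi>"
    unfolding frob_choice_def
  proof (intro conjI ballI impI)
    fix \<sigma> \<tau> assume s: "\<sigma> \<in> Ar A" "\<tau> \<in> Ar B" "bot_of (AM v \<sigma>) = bot_of (AM w \<tau>)"
    note c = frob_cospan_map[OF v w s]
    have D: "(\<sigma>, \<tau>) \<in> Ar D"
      using s functor_square(2)[OF v s(1)] functor_square(2)[OF w s(2)]
      by (auto simp: D_def fib_prod_def square_iff)
    have obs: "Dom A \<sigma> \<in> Ob A" "Cod A \<sigma> \<in> Ob A" "Dom B \<tau> \<in> Ob B" "Cod B \<tau> \<in> Ob B"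
      using is_functorD(1)[OF v] is_functorD(1)[OF w] s by (auto simp: category_def)
    obtain X h Y where q: "AM P' (\<sigma>, \<tau>) = (X, h, Y)"
      by (cases "AM P' (\<sigma>, \<tau>)") auto
    have "Dom D (\<sigma>, \<tau>) = (Dom A \<sigma>, Dom B \<tau>)" "Cod D (\<sigma>, \<tau>) = (Cod A \<sigma>, Cod B \<tau>)"
      by (simp_all add: D_def fib_prod_def)
    then have "X = OM P' (Dom A \<sigma>, Dom B \<tau>)" "Y = OM P' (Cod A \<sigma>, Cod B \<tau>)"
      using is_functorD(5,6)[OF P' D] by (simp_all add: q structured_simps[OF K])
    moreover have "h = AM (comp_func (P_func E pb) (prod_func v w)) (\<sigma>, \<tau>)"
      using eq D q by (auto simp: functor_eq_def)
    moreover have "AM (P_func E pb) (AM v \<sigma>, AM w \<tau>) = (pB (OM v (Dom A \<sigma>)) (OM w (Dom B \<tau>)),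
        (pm (OM v (Dom A \<sigma>)) (OM w (Dom B \<tau>)) (OM v (Cod A \<sigma>)) (OM w (Cod B \<tau>)) (top_of (AM v \<sigma>)) (top_of (AM w \<tau>)),
         top_of (AM w \<tau>)),
        pB (OM v (Cod A \<sigma>)) (OM w (Cod B \<tau>)))"
      by (subst functor_square(1)[OF v s(1)], subst functor_square(1)[OF w s(2)]) (simp add: P_func_def)
    ultimately show "frob_mor A v B w \<chi> \<sigma> \<tau> \<in> Ar K"
      using is_functorD(4)[OF P' D] q ob obs cospan_mapD(1,2)[OF c] by (simp add: cospan_def)
  qed (use ob in metis)
  then show "\<exists>\<chi>. frob_choice A v B w K \<chi>" by blast
next
  assume "\<exists>\<chi>. frob_choice A v B w K \<chi>"
  then obtain \<chi> where ob: "\<And>i j. i \<in> Ob A \<Longrightarrow> j \<in> Ob B \<Longrightarrow> cod (OM v i) = cod (OM w j) \<Longrightarrow> (pB (OM v i) (OM w j), \<chi> i j) \<in> Ob K"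
    and ar: "\<And>\<sigma> \<tau>. \<sigma> \<in> Ar A \<Longrightarrow> \<tau> \<in> Ar B \<Longrightarrow> bot_of (AM v \<sigma>) = bot_of (AM w \<tau>) \<Longrightarrow>
      frob_mor A v B w \<chi> \<sigma> \<tau> \<in> Ar K"
    unfolding frob_choice_def by metis
  define OP where "OP = (\<lambda>(i, j). (pB (OM v i) (OM w j), \<chi> i j))"
  define P' where "P' = \<lparr>OM = OP, AM = (\<lambda>(\<sigma>, \<tau>). (OP (Dom A \<sigma>, Dom B \<tau>),
       (pB (OM v (Dom A \<sigma>)) (OM w (Dom B \<tau>)),
        (pm (OM v (Dom A \<sigma>)) (OM w (Dom B \<tau>)) (OM v (Cod A \<sigma>)) (OM w (Cod B \<tau>)) (top_of (AM v \<sigma>)) (top_of (AM w \<tau>)),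
         top_of (AM w \<tau>)),
        pB (OM v (Cod A \<sigma>)) (OM w (Cod B \<tau>))), OP (Cod A \<sigma>, Cod B \<tau>)))\<rparr>"
  interpret A: cat A using is_functorD(1)[OF v] by unfold_locales
  interpret B: cat B using is_functorD(1)[OF w] by unfold_locales
  have fA: "is_functor A E (comp_func (cod_func E) v)" and fB: "is_functor B E (comp_func (cod_func E) w)"
    using is_functor_comp[OF v is_functor_cod_func[OF category_E]] is_functor_comp[OF w is_functor_cod_func[OF category_E]]
    by blast+
  have "is_functor D K P'"
    unfolding is_functor_def
  proof (intro conjI ballI impI)
    show "category D"
      unfolding D_def by (rule category_fib_prod[OF fA fB])
    show "category K"
      using K by (simp add: structured_def)
    fix x assume "x \<in> Ob D"
    then obtain i j where x: "x = (i, j)" "i \<in> Ob A" "j \<in> Ob B" "cod (OM v i) = cod (OM w j)"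
      by (cases x) (auto simp: D_def fib_prod_def)
    then show "OM P' x \<in> Ob K"
      using ob by (simp add: P'_def OP_def)
    have "arr (OM v i)" "arr (OM w j)"
      using is_functorD(3)[OF v x(2)] is_functorD(3)[OF w x(3)] by simp_all
    then have "cospan (OM v i) (OM w j)"
      using x by (simp add: cospan_def)
    then show "AM P' (Ide D x) = Ide K (OM P' x)"
      using x by (simp add: P'_def OP_def D_def fib_prod_def structured_simps[OF K]
          functor_square_ide[OF v] functor_square_ide[OF w] pm_ide)
  next
    fix q assume "q \<in> Ar D"
    then obtain \<sigma> \<tau> where q: "q = (\<sigma>, \<tau>)" "\<sigma> \<in> Ar A" "\<tau> \<in> Ar B" "bot_of (AM v \<sigma>) = bot_of (AM w \<tau>)"
      by (cases q) (auto simp: D_def fib_prod_def)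
    then show "AM P' q \<in> hom K (OM P' (Dom D q)) (OM P' (Cod D q))"
      using ar by (simp add: P'_def OP_def D_def fib_prod_def structured_simps[OF K])
    fix q' assume q': "q' \<in> Ar D" "Dom D q' = Cod D q"
    then obtain \<sigma>' \<tau>' where q': "q' = (\<sigma>', \<tau>')" "\<sigma>' \<in> Ar A" "\<tau>' \<in> Ar B" "bot_of (AM v \<sigma>') = bot_of (AM w \<tau>')"
        "Dom A \<sigma>' = Cod A \<sigma>" "Dom B \<tau>' = Cod B \<tau>"
      using q(1) by (cases q') (auto simp: D_def fib_prod_def)
    note c = frob_cospan_map[OF v w q(2-4)] frob_cospan_map[OF v w q'(2-4), unfolded q'(5,6)]
    show "AM P' (Comp D q' q) = Comp K (AM P' q') (AM P' q)"
      using q q' by (simp add: P'_def OP_def D_def fib_prod_def structured_simps[OF K]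
          functor_square_comp[OF v] functor_square_comp[OF w] pm_comp[OF c])
  qed
  moreover have "functor_eq D (comp_func forget P') (comp_func (P_func E pb) (prod_func v w))"
    unfolding functor_eq_def
  proof (intro conjI ballI)
    fix x assume "x \<in> Ob D"
    show "OM (comp_func forget P') x = OM (comp_func (P_func E pb) (prod_func v w)) x"
      by (cases x) (simp add: P'_def OP_def P_func_def)
  next
    fix q assume "q \<in> Ar D"
    then obtain \<sigma> \<tau> where q: "q = (\<sigma>, \<tau>)" "\<sigma> \<in> Ar A" "\<tau> \<in> Ar B"
      by (cases q) (auto simp: D_def fib_prod_def)
    have "AM (P_func E pb) (AM v \<sigma>, AM w \<tau>) = (pB (OM v (Dom A \<sigma>)) (OM w (Dom B \<tau>)),
        (pm (OM v (Dom A \<sigma>)) (OM w (Dom B \<tau>)) (OM v (Cod A \<sigma>)) (OM w (Cod B \<tau>)) (top_of (AM v \<sigma>)) (top_of (AM w \<tau>)),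
         top_of (AM w \<tau>)),
        pB (OM v (Cod A \<sigma>)) (OM w (Cod B \<tau>)))"
      by (subst functor_square(1)[OF v q(2)], subst functor_square(1)[OF w q(3)]) (simp add: P_func_def)
    then show "AM (comp_func forget P') q = AM (comp_func (P_func E pb) (prod_func v w)) q"
      using q by (simp add: P'_def)
  qed
  ultimately show "\<exists>P'. is_functor D K P' \<and>
            functor_eq D (comp_func forget P') (comp_func (P_func E pb) (prod_func v w))" by blast
qed

text \<open>The pullback \<open>h\<^sup>*(f)\<close> of \<open>f\<close>, taken over the codomain of \<open>b\<close>.\<close>

definition qarr where "qarr f b h = pm (b \<cdot> f) h b h f (ide (dom h))"

text \<open>The corresponding value for the functor on the categories of arrows over a base. An object
\<open>(X, i, a, b)\<close> is determined by \<open>i\<close> and \<open>b\<close>, since \<open>a = b u\<^sub>i\<close> and \<open>X\<close> is the codomain of \<open>b\<close>;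
so a choice of structures depends on \<open>i\<close>, \<open>b\<close> and the object pulled back along.\<close>

abbreviation (input) gen_frob_mor where
  "gen_frob_mor I u J v \<chi> \<sigma> \<tau> b b' \<equiv>
     ((qarr (OM u (Dom I \<sigma>)) b (OM v (Dom J \<tau>)), \<chi> (Dom I \<sigma>) b (Dom J \<tau>)),
     (qarr (OM u (Dom I \<sigma>)) b (OM v (Dom J \<tau>)),
      (pm (b \<cdot> OM u (Dom I \<sigma>)) (OM v (Dom J \<tau>)) (b' \<cdot> OM u (Cod I \<sigma>)) (OM v (Cod J \<tau>)) (top_of (AM u \<sigma>)) (top_of (AM v \<tau>)),
       pm b (OM v (Dom J \<tau>)) b' (OM v (Cod J \<tau>)) (bot_of (AM u \<sigma>)) (top_of (AM v \<tau>))),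
      qarr (OM u (Cod I \<sigma>)) b' (OM v (Cod J \<tau>))),
     (qarr (OM u (Cod I \<sigma>)) b' (OM v (Cod J \<tau>)), \<chi> (Cod I \<sigma>) b' (Cod J \<tau>)))"

definition gen_frob_choice where
  "gen_frob_choice I u J v K \<chi> \<longleftrightarrow>
    (\<forall>i\<in>Ob I. \<forall>j\<in>Ob J. \<forall>b. arr b \<longrightarrow> dom b = cod (OM u i) \<longrightarrow> cod b = cod (OM v j) \<longrightarrow>
      (qarr (OM u i) b (OM v j), \<chi> i b j) \<in> Ob K) \<and>
    (\<forall>\<sigma>\<in>Ar I. \<forall>\<tau>\<in>Ar J. \<forall>b b'. arr b \<longrightarrow> dom b = cod (OM u (Dom I \<sigma>)) \<longrightarrow> cod b = cod (OM v (Dom J \<tau>)) \<longrightarrow>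
      arr b' \<longrightarrow> dom b' = cod (OM u (Cod I \<sigma>)) \<longrightarrow> cod b' = cod (OM v (Cod J \<tau>)) \<longrightarrow>
      b' \<cdot> bot_of (AM u \<sigma>) = bot_of (AM v \<tau>) \<cdot> b \<longrightarrow>
      gen_frob_mor I u J v \<chi> \<sigma> \<tau> b b' \<in> Ar K)"

lemma frob_choice_mono:
  assumes "frob_choice A forget B forget K \<chi>" "struct_map A' A \<theta>" "struct_map B' B \<zeta>" "struct_map K K' \<xi>"
    and s: "structured E A" "structured E B" "structured E A'" "structured E B'"
  shows "frob_choice A' forget B' forget K' (\<lambda>X Y. \<xi> (pB (fst X) (fst Y), \<chi> (fst X, \<theta> X) (fst Y, \<zeta> Y)))"
  unfolding frob_choice_def
proof (intro conjI ballI impI)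
  fix X Y assume "X \<in> Ob A'" "Y \<in> Ob B'" "cod (OM forget X) = cod (OM forget Y)"
  then have "(pB (fst X) (fst Y), \<chi> (fst X, \<theta> X) (fst Y, \<zeta> Y)) \<in> Ob K"
    using assms(1-3) unfolding frob_choice_def struct_map_def by fastforce
  then show "(pB (OM forget X) (OM forget Y), \<xi> (pB (fst X) (fst Y), \<chi> (fst X, \<theta> X) (fst Y, \<zeta> Y))) \<in> Ob K'"
    using assms(4) unfolding struct_map_def by fastforce
next
  fix \<sigma> \<tau> assume a: "\<sigma> \<in> Ar A'" "\<tau> \<in> Ar B'" "bot_of (AM forget \<sigma>) = bot_of (AM forget \<tau>)"
  obtain X h Y where \<sigma>: "\<sigma> = (X, h, Y)" by (cases \<sigma>) auto
  obtain X' h' Y' where \<tau>: "\<tau> = (X', h', Y')" by (cases \<tau>) auto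
  have 1: "((fst X, \<theta> X), h, (fst Y, \<theta> Y)) \<in> Ar A" "((fst X', \<zeta> X'), h', (fst Y', \<zeta> Y')) \<in> Ar B"
    using assms(2,3) a(1,2) unfolding struct_map_def \<sigma> \<tau> by blast+
  have "((pB (fst X) (fst X'), \<chi> (fst X, \<theta> X) (fst X', \<zeta> X')),
         (pB (fst X) (fst X'), (pm (fst X) (fst X') (fst Y) (fst Y') (top_of h) (top_of h'), top_of h'), pB (fst Y) (fst Y')),
         (pB (fst Y) (fst Y'), \<chi> (fst Y, \<theta> Y) (fst Y', \<zeta> Y'))) \<in> Ar K"
    using assms(1)[unfolded frob_choice_def, THEN conjunct2, rule_format, OF 1] a(3)
    by (simp add: \<sigma> \<tau> structured_simps[OF s(1)] structured_simps[OF s(2)])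
  from assms(4)[unfolded struct_map_def, THEN conjunct2, rule_format, OF this]
  show "frob_mor A' forget B' forget (\<lambda>X Y. \<xi> (pB (fst X) (fst Y), \<chi> (fst X, \<theta> X) (fst Y, \<zeta> Y))) \<sigma> \<tau> \<in> Ar K'"
    by (simp add: \<sigma> \<tau> structured_simps[OF s(3)] structured_simps[OF s(4)])
qed

lemma gen_frob_choice_mono:
  assumes g: "gen_frob_choice I u J forget K \<chi>" and \<zeta>: "struct_map J' J \<zeta>" and \<xi>: "struct_map K K' \<xi>"
    and s: "structured E J" "structured E J'"
  shows "gen_frob_choice I u J' forget K' (\<lambda>i b Y. \<xi> (qarr (OM u i) b (fst Y), \<chi> i b (fst Y, \<zeta> Y)))"
  unfolding gen_frob_choice_def
proof (intro conjI ballI impI allI)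
  fix i Y b assume "i \<in> Ob I" "Y \<in> Ob J'" "arr b" "dom b = cod (OM u i)" "cod b = cod (OM forget Y)"
  then have "(qarr (OM u i) b (fst Y), \<chi> i b (fst Y, \<zeta> Y)) \<in> Ob K"
    using g \<zeta> unfolding gen_frob_choice_def struct_map_def by fastforce
  then show "(qarr (OM u i) b (OM forget Y), \<xi> (qarr (OM u i) b (fst Y), \<chi> i b (fst Y, \<zeta> Y))) \<in> Ob K'"
    using \<xi> unfolding struct_map_def by fastforce
next
  fix \<sigma> \<tau> b b' assume a: "\<sigma> \<in> Ar I" "\<tau> \<in> Ar J'" "arr b" "dom b = cod (OM u (Dom I \<sigma>))" "cod b = cod (OM forget (Dom J' \<tau>))"
    "arr b'" "dom b' = cod (OM u (Cod I \<sigma>))" "cod b' = cod (OM forget (Cod J' \<tau>))"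
    "b' \<cdot> bot_of (AM u \<sigma>) = bot_of (AM forget \<tau>) \<cdot> b"
  obtain X h Y where \<tau>: "\<tau> = (X, h, Y)" by (cases \<tau>) auto
  have 1: "((fst X, \<zeta> X), h, (fst Y, \<zeta> Y)) \<in> Ar J"
    using \<zeta> a(2) unfolding struct_map_def \<tau> by blast
  have "((qarr (OM u (Dom I \<sigma>)) b (fst X), \<chi> (Dom I \<sigma>) b (fst X, \<zeta> X)),
       (qarr (OM u (Dom I \<sigma>)) b (fst X),
        (pm (b \<cdot> OM u (Dom I \<sigma>)) (fst X) (b' \<cdot> OM u (Cod I \<sigma>)) (fst Y) (top_of (AM u \<sigma>)) (top_of h),
         pm b (fst X) b' (fst Y) (bot_of (AM u \<sigma>)) (top_of h)),
        qarr (OM u (Cod I \<sigma>)) b' (fst Y)),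
       (qarr (OM u (Cod I \<sigma>)) b' (fst Y), \<chi> (Cod I \<sigma>) b' (fst Y, \<zeta> Y))) \<in> Ar K"
    using g[unfolded gen_frob_choice_def, THEN conjunct2, rule_format, OF a(1) 1, of b b'] a
    by (simp add: \<tau> structured_simps[OF s(1)] structured_simps[OF s(2)])
  from \<xi>[unfolded struct_map_def, THEN conjunct2, rule_format, OF this]
  show "gen_frob_mor I u J' forget (\<lambda>i b Y. \<xi> (qarr (OM u i) b (fst Y), \<chi> i b (fst Y, \<zeta> Y))) \<sigma> \<tau> b b' \<in> Ar K'"
    by (simp add: \<tau> structured_simps[OF s(1)] structured_simps[OF s(2)])
qed

end

context pb_cat begin

lemma qarr_cospan_map:
  assumes "arr f" "arr b" "dom b = cod f" "arr h" "cod b = cod h"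
  shows "cospan_map (b \<cdot> f) h b h f (ide (dom h))"
  using assms unfolding cospan_map_def cospan_def by (auto intro!: exI[of _ "ide (cod h)"])

lemma qarr_props [simp]:
  assumes "arr f" "arr b" "dom b = cod f" "arr h" "cod b = cod h"
  shows "arr (qarr f b h)" "dom (qarr f b h) = PB (b \<cdot> f) h" "cod (qarr f b h) = PB b h"
    "pA b h \<cdot> qarr f b h = f \<cdot> pA (b \<cdot> f) h" "pB b h \<cdot> qarr f b h = pB (b \<cdot> f) h"
  using qarr_cospan_map[OF assms] cospan_mapD(1)[OF qarr_cospan_map[OF assms]] by (simp_all add: qarr_def)

lemma gen_frob_cospan_map:
  assumes u: "is_functor I (arrow_cat E) u" and v: "is_functor J (arrow_cat E) v"
    and s: "\<sigma> \<in> Ar I" "\<tau> \<in> Ar J"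
    and b: "arr b" "dom b = cod (OM u (Dom I \<sigma>))" "cod b = cod (OM v (Dom J \<tau>))"
    and b': "arr b'" "dom b' = cod (OM u (Cod I \<sigma>))" "cod b' = cod (OM v (Cod J \<tau>))"
    and e: "b' \<cdot> bot_of (AM u \<sigma>) = bot_of (AM v \<tau>) \<cdot> b"
  shows "cospan_map b (OM v (Dom J \<tau>)) b' (OM v (Cod J \<tau>)) (bot_of (AM u \<sigma>)) (top_of (AM v \<tau>))"
    "cospan_map (b \<cdot> OM u (Dom I \<sigma>)) (OM v (Dom J \<tau>)) (b' \<cdot> OM u (Cod I \<sigma>)) (OM v (Cod J \<tau>)) (top_of (AM u \<sigma>)) (top_of (AM v \<tau>))"
    "(b' \<cdot> OM u (Cod I \<sigma>)) \<cdot> top_of (AM u \<sigma>) = bot_of (AM v \<tau>) \<cdot> (b \<cdot> OM u (Dom I \<sigma>))"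
proof -
  note q = functor_square(2)[OF u s(1), unfolded square_iff] functor_square(2)[OF v s(2), unfolded square_iff]
  show "cospan_map b (OM v (Dom J \<tau>)) b' (OM v (Cod J \<tau>)) (bot_of (AM u \<sigma>)) (top_of (AM v \<tau>))"
    unfolding cospan_map_def cospan_def using q b b' e
    by (intro conjI exI[of _ "bot_of (AM v \<tau>)"]) auto
  have "(b' \<cdot> OM u (Cod I \<sigma>)) \<cdot> top_of (AM u \<sigma>) = b' \<cdot> bot_of (AM u \<sigma>) \<cdot> OM u (Dom I \<sigma>)"
    using q b' by simp
  also have "\<dots> = (bot_of (AM v \<tau>) \<cdot> b) \<cdot> OM u (Dom I \<sigma>)"
    using q b b' e by (intro comp_eq_extend) auto
  also have "\<dots> = bot_of (AM v \<tau>) \<cdot> (b \<cdot> OM u (Dom I \<sigma>))"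
    using q b by simp
  finally show 1: "(b' \<cdot> OM u (Cod I \<sigma>)) \<cdot> top_of (AM u \<sigma>) = bot_of (AM v \<tau>) \<cdot> (b \<cdot> OM u (Dom I \<sigma>))" .
  show "cospan_map (b \<cdot> OM u (Dom I \<sigma>)) (OM v (Dom J \<tau>)) (b' \<cdot> OM u (Cod I \<sigma>)) (OM v (Cod J \<tau>)) (top_of (AM u \<sigma>)) (top_of (AM v \<tau>))"
    unfolding cospan_map_def cospan_def using q b b' 1
    by (intro conjI exI[of _ "bot_of (AM v \<tau>)"]) auto
qed

lemma over_obj_simps [simp]: "over_obj F (X, i, a, b) = (X, F i, a, b)"
  by (simp add: over_obj_def)

lemma gen_frob_lift_iff:
  assumes u: "is_functor I (arrow_cat E) u" and v: "is_functor J (arrow_cat E) v" and K: "structured E K"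
  defines "D \<equiv> fib_prod (over_cat E I u) J over_proj (comp_func (cod_func E) v)"
  shows "(\<exists>Q'. is_functor D (over_cat E K forget) Q' \<and>
            functor_eq D (comp_func (over_func forget) Q') (comp_func (Q_func E pb) (prod_func (over_func u) v))) \<longleftrightarrow>
         (\<exists>\<chi>. gen_frob_choice I u J v K \<chi>)"
    (is "(\<exists>Q'. ?lift Q') \<longleftrightarrow> _")
proof -
  interpret I: cat I using is_functorD(1)[OF u] by unfold_locales
  interpret J: cat J using is_functorD(1)[OF v] by unfold_locales
  have uob: "arr (OM u i)" if "i \<in> Ob I" for i using is_functorD(3)[OF u that] by simp
  have vob: "arr (OM v i)" if "i \<in> Ob J" for i using is_functorD(3)[OF v that] by simp
  define obj where "obj i b = (cod b, i, b \<cdot> OM u i, b)" for i b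
  define mid where "mid \<sigma> b b' \<tau> = (qarr (OM u (Dom I \<sigma>)) b (OM v (Dom J \<tau>)),
        (pm (b \<cdot> OM u (Dom I \<sigma>)) (OM v (Dom J \<tau>)) (b' \<cdot> OM u (Cod I \<sigma>)) (OM v (Cod J \<tau>)) (top_of (AM u \<sigma>)) (top_of (AM v \<tau>)),
         pm b (OM v (Dom J \<tau>)) b' (OM v (Cod J \<tau>)) (bot_of (AM u \<sigma>)) (top_of (AM v \<tau>))),
        qarr (OM u (Cod I \<sigma>)) b' (OM v (Cod J \<tau>)))" for \<sigma> b b' \<tau>
  have Dob: "z \<in> Ob D \<longleftrightarrow> (\<exists>i b j. z = (obj i b, j) \<and> i \<in> Ob I \<and> j \<in> Ob J \<and> arr b \<and> dom b = cod (OM u i) \<and> cod b = cod (OM v j))" for z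
    by (cases z) (auto simp: D_def fib_prod_def over_cat_simps obj_def uob vob)
  have Dar: "z \<in> Ar D \<longleftrightarrow> (\<exists>\<sigma> b b' \<tau>. z = ((obj (Dom I \<sigma>) b, (bot_of (AM v \<tau>), \<sigma>), obj (Cod I \<sigma>) b'), \<tau>) \<and> \<sigma> \<in> Ar I \<and> \<tau> \<in> Ar J \<and>
      arr b \<and> dom b = cod (OM u (Dom I \<sigma>)) \<and> cod b = cod (OM v (Dom J \<tau>)) \<and>
      arr b' \<and> dom b' = cod (OM u (Cod I \<sigma>)) \<and> cod b' = cod (OM v (Cod J \<tau>)) \<and>
      b' \<cdot> bot_of (AM u \<sigma>) = bot_of (AM v \<tau>) \<cdot> b)" (is "_ \<longleftrightarrow> (\<exists>\<sigma> b b' \<tau>. ?R z \<sigma> b b' \<tau>)") for z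
  proof
    assume "z \<in> Ar D"
    moreover obtain X i a b x \<sigma> X' i' a' b' \<tau> where z: "z = (((X, i, a, b), (x, \<sigma>), (X', i', a', b')), \<tau>)"
      by (cases z) auto
    ultimately have "?R z \<sigma> b b' \<tau>"
      by (auto simp: D_def fib_prod_def over_cat_simps obj_def)
    then show "\<exists>\<sigma> b b' \<tau>. ?R z \<sigma> b b' \<tau>" by blast
  next
    assume "\<exists>\<sigma> b b' \<tau>. ?R z \<sigma> b b' \<tau>"
    then obtain \<sigma> b b' \<tau> where r: "?R z \<sigma> b b' \<tau>" by blast
    have "(b' \<cdot> OM u (Cod I \<sigma>)) \<cdot> top_of (AM u \<sigma>) = bot_of (AM v \<tau>) \<cdot> (b \<cdot> OM u (Dom I \<sigma>))"
      using gen_frob_cospan_map(3)[OF u v, of \<sigma> \<tau> b b'] r by blast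
    with r show "z \<in> Ar D"
      using functor_square(2)[OF v, of \<tau>, unfolded square_iff]
      by (auto simp: D_def fib_prod_def over_cat_simps obj_def uob vob)
  qed
  have Dsimps: "Dom D (z, \<tau>) = (Dom (over_cat E I u) z, Dom J \<tau>)" "Cod D (z, \<tau>) = (Cod (over_cat E I u) z, Cod J \<tau>)"
      "Ide D (p, j) = (Ide (over_cat E I u) p, Ide J j)" "Comp D (z, \<tau>) (z', \<tau>') = (Comp (over_cat E I u) z z', Comp J \<tau> \<tau>')"
    for z z' \<tau> \<tau>' p j by (simp_all add: D_def fib_prod_def)
  have QO: "OM (comp_func (Q_func E pb) (prod_func (over_func u) v)) (obj i b, j) =
      (dom (OM v j), qarr (OM u i) b (OM v j), pB (b \<cdot> OM u i) (OM v j), pB b (OM v j))" for i b j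
    by (simp add: Q_func_def Q_obj_def Q_arrow_def qarr_def over_func_def obj_def)
  have QA: "AM (comp_func (Q_func E pb) (prod_func (over_func u) v)) ((obj (Dom I \<sigma>) b, (x, \<sigma>), obj (Cod I \<sigma>) b'), \<tau>) =
      (OM (comp_func (Q_func E pb) (prod_func (over_func u) v)) (obj (Dom I \<sigma>) b, Dom J \<tau>),
       (top_of (AM v \<tau>), mid \<sigma> b b' \<tau>),
       OM (comp_func (Q_func E pb) (prod_func (over_func u) v)) (obj (Cod I \<sigma>) b', Cod J \<tau>))"
    if st: "\<sigma> \<in> Ar I" "\<tau> \<in> Ar J" for \<sigma> \<tau> b b' x
  proof -
    obtain s1 t1 s2 t2 where "AM u \<sigma> = (OM u (Dom I \<sigma>), (s1, t1), OM u (Cod I \<sigma>))"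
        "AM v \<tau> = (OM v (Dom J \<tau>), (s2, t2), OM v (Cod J \<tau>))"
      using functor_square(1)[OF u st(1)] functor_square(1)[OF v st(2)] by metis
    then show ?thesis
      by (simp add: over_func_def obj_def Q_func_def Q_obj_def Q_arrow_def qarr_def mid_def)
  qed
  note Ks = structured_simps[OF K]
  show ?thesis
  proof
    assume "\<exists>Q'. ?lift Q'"
    then obtain Q' where Q': "is_functor D (over_cat E K forget) Q'"
      and eq: "functor_eq D (comp_func (over_func forget) Q') (comp_func (Q_func E pb) (prod_func (over_func u) v))" by blast
    define \<chi> where "\<chi> i b j = snd (fst (snd (OM Q' (obj i b, j))))" for i b j
    have ob: "OM Q' (obj i b, j) = (dom (OM v j), (qarr (OM u i) b (OM v j), \<chi> i b j), pB (b \<cdot> OM u i) (OM v j), pB b (OM v j))"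
      "(qarr (OM u i) b (OM v j), \<chi> i b j) \<in> Ob K"
      if "i \<in> Ob I" "j \<in> Ob J" "arr b" "dom b = cod (OM u i)" "cod b = cod (OM v j)" for i b j
    proof -
      have d: "(obj i b, j) \<in> Ob D" using that Dob by blast
      obtain Y X a b'' where y: "OM Q' (obj i b, j) = (Y, X, a, b'')" by (cases "OM Q' (obj i b, j)") auto
      have "OM (comp_func (over_func forget) Q') (obj i b, j) = OM (comp_func (Q_func E pb) (prod_func (over_func u) v)) (obj i b, j)"
        using eq d by (auto simp: functor_eq_def)
      then show "OM Q' (obj i b, j) = (dom (OM v j), (qarr (OM u i) b (OM v j), \<chi> i b j), pB (b \<cdot> OM u i) (OM v j), pB b (OM v j))"
        unfolding QO by (auto simp: y over_func_def \<chi>_def prod_eq_iff)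
      then show "(qarr (OM u i) b (OM v j), \<chi> i b j) \<in> Ob K"
        using is_functorD(3)[OF Q' d] by (simp add: over_cat_simps)
    qed
    have "gen_frob_choice I u J v K \<chi>"
      unfolding gen_frob_choice_def mid_def[symmetric]
    proof (intro conjI ballI impI allI)
      fix \<sigma> \<tau> b b' assume a: "\<sigma> \<in> Ar I" "\<tau> \<in> Ar J" "arr b" "dom b = cod (OM u (Dom I \<sigma>))" "cod b = cod (OM v (Dom J \<tau>))"
        "arr b'" "dom b' = cod (OM u (Cod I \<sigma>))" "cod b' = cod (OM v (Cod J \<tau>))"
        "b' \<cdot> bot_of (AM u \<sigma>) = bot_of (AM v \<tau>) \<cdot> b"
      define z where "z = ((obj (Dom I \<sigma>) b, (bot_of (AM v \<tau>), \<sigma>), obj (Cod I \<sigma>) b'), \<tau>)"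
      have z: "z \<in> Ar D" using a Dar z_def by blast
      obtain P y \<rho> P' where q: "AM Q' z = (P, (y, \<rho>), P')" by (cases "AM Q' z") auto
      have P: "P = OM Q' (obj (Dom I \<sigma>) b, Dom J \<tau>)" "P' = OM Q' (obj (Cod I \<sigma>) b', Cod J \<tau>)"
        using is_functorD(5,6)[OF Q' z] unfolding q over_cat_simps(3,4) by (simp_all add: over_cat_simps(3,4) z_def Dsimps)
      have "AM (comp_func (over_func forget) Q') z = AM (comp_func (Q_func E pb) (prod_func (over_func u) v)) z"
        using eq z by (auto simp: functor_eq_def)
      then have \<rho>: "AM forget \<rho> = mid \<sigma> b b' \<tau>"
        unfolding z_def QA[OF a(1,2)] unfolding z_def[symmetric] by (simp add: q over_func_def)
      have "\<rho> \<in> Ar K" "Dom K \<rho> = fst (snd P)" "Cod K \<rho> = fst (snd P')"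
        using is_functorD(4)[OF Q' z] by (auto simp: q over_cat_simps)
      moreover obtain X h Y where "\<rho> = (X, h, Y)" by (cases \<rho>) auto
      ultimately show "((qarr (OM u (Dom I \<sigma>)) b (OM v (Dom J \<tau>)), \<chi> (Dom I \<sigma>) b (Dom J \<tau>)), mid \<sigma> b b' \<tau>,
          (qarr (OM u (Cod I \<sigma>)) b' (OM v (Cod J \<tau>)), \<chi> (Cod I \<sigma>) b' (Cod J \<tau>))) \<in> Ar K"
        using \<rho> P ob(1) a by (simp add: Ks)
    qed (use ob(2) in blast)
    then show "\<exists>\<chi>. gen_frob_choice I u J v K \<chi>" by blast
  next
    assume "\<exists>\<chi>. gen_frob_choice I u J v K \<chi>"
    then obtain \<chi> where \<chi>: "gen_frob_choice I u J v K \<chi>" by blast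
    note ob = \<chi>[unfolded gen_frob_choice_def, THEN conjunct1, rule_format]
    note ar = \<chi>[unfolded gen_frob_choice_def mid_def[symmetric], THEN conjunct2, rule_format]
    define OQ where "OQ = (\<lambda>((X :: 'o, i, a :: 'a, b), j). (dom (OM v j), (qarr (OM u i) b (OM v j), \<chi> i b j), pB (b \<cdot> OM u i) (OM v j), pB b (OM v j)))"
    define Q' where "Q' = \<lparr>OM = OQ, AM = (\<lambda>(((X, i, a, b), (x :: 'a, \<sigma>), (X', i', a', b')), \<tau>).
       (OQ ((X, i, a, b), Dom J \<tau>),
        (top_of (AM v \<tau>), ((qarr (OM u (Dom I \<sigma>)) b (OM v (Dom J \<tau>)), \<chi> (Dom I \<sigma>) b (Dom J \<tau>)), mid \<sigma> b b' \<tau>,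
          (qarr (OM u (Cod I \<sigma>)) b' (OM v (Cod J \<tau>)), \<chi> (Cod I \<sigma>) b' (Cod J \<tau>)))),
        OQ ((X', i', a', b'), Cod J \<tau>)))\<rparr>"
    have Q'O: "OM Q' (obj i b, j) = (dom (OM v j), (qarr (OM u i) b (OM v j), \<chi> i b j), pB (b \<cdot> OM u i) (OM v j), pB b (OM v j))" for i b j
      by (simp add: Q'_def OQ_def obj_def)
    have Q'A: "AM Q' ((obj (Dom I \<sigma>) b, (x, \<sigma>), obj (Cod I \<sigma>) b'), \<tau>) =
       (OM Q' (obj (Dom I \<sigma>) b, Dom J \<tau>),
        (top_of (AM v \<tau>), ((qarr (OM u (Dom I \<sigma>)) b (OM v (Dom J \<tau>)), \<chi> (Dom I \<sigma>) b (Dom J \<tau>)), mid \<sigma> b b' \<tau>,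
          (qarr (OM u (Cod I \<sigma>)) b' (OM v (Cod J \<tau>)), \<chi> (Cod I \<sigma>) b' (Cod J \<tau>)))),
        OM Q' (obj (Cod I \<sigma>) b', Cod J \<tau>))" for \<sigma> b b' \<tau> x
      by (simp add: Q'_def obj_def)
    have Q'ob: "OM Q' (obj i b, j) \<in> Ob (over_cat E K forget)"
      if "i \<in> Ob I" "j \<in> Ob J" "arr b" "dom b = cod (OM u i)" "cod b = cod (OM v j)" for i b j
    proof -
      have "cospan b (OM v j)" "cospan (b \<cdot> OM u i) (OM v j)"
        using that by (simp_all add: cospan_def uob vob)
      then show ?thesis
        using ob[OF that] that by (simp add: Q'O over_cat_simps uob vob)
    qed
    have "is_functor D (over_cat E K forget) Q'"
      unfolding is_functor_def
    proof (intro conjI ballI impI)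
      show "category D"
        unfolding D_def
        by (rule category_fib_prod[OF is_functor_over_proj[OF category_E u] is_functor_comp[OF v is_functor_cod_func[OF category_E]]])
      show "category (over_cat E K forget)"
        by (rule category_over_cat[OF category_E structured_functor[OF category_E K]])
      fix z assume "z \<in> Ob D"
      then obtain i b j where z: "z = (obj i b, j)" and i: "i \<in> Ob I" "j \<in> Ob J" "arr b" "dom b = cod (OM u i)" "cod b = cod (OM v j)"
        using Dob by blast
      then show "OM Q' z \<in> Ob (over_cat E K forget)"
        using Q'ob by blast
      have c: "cospan b (OM v j)" "cospan (b \<cdot> OM u i) (OM v j)"
        using i by (simp_all add: cospan_def uob vob)
      have e1: "Ide D z = ((obj (Dom I (Ide I i)) b, (ide (cod b), Ide I i), obj (Cod I (Ide I i)) b), Ide J j)"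
        using i by (simp add: z Dsimps obj_def over_cat_simps)
      have e2: "mid (Ide I i) b b (Ide J j) = Ide (arrow_cat E) (qarr (OM u i) b (OM v j))"
        using i c by (simp add: mid_def functor_square_ide[OF u] functor_square_ide[OF v] uob vob
            pm_ide[OF c(1)] pm_ide[OF c(2), simplified] dom_comp[of "OM u i" b, OF uob])
          (metis dom_comp pm_ide uob)
      show "AM Q' (Ide D z) = Ide (over_cat E K forget) (OM Q' z)"
        unfolding e1 Q'A e2 using i by (simp add: Q'O z over_cat_simps Ks functor_square_ide[OF v])
    next
      fix z assume "z \<in> Ar D"
      then obtain \<sigma> b b' \<tau> where z: "z = ((obj (Dom I \<sigma>) b, (bot_of (AM v \<tau>), \<sigma>), obj (Cod I \<sigma>) b'), \<tau>)"
        and s: "\<sigma> \<in> Ar I" "\<tau> \<in> Ar J" "arr b" "dom b = cod (OM u (Dom I \<sigma>))" "cod b = cod (OM v (Dom J \<tau>))"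
          "arr b'" "dom b' = cod (OM u (Cod I \<sigma>))" "cod b' = cod (OM v (Cod J \<tau>))" "b' \<cdot> bot_of (AM u \<sigma>) = bot_of (AM v \<tau>) \<cdot> b"
        using Dar by blast
      note c = gen_frob_cospan_map(1,2)[OF u v s]
      have t: "arr (top_of (AM v \<tau>))" "dom (top_of (AM v \<tau>)) = dom (OM v (Dom J \<tau>))" "cod (top_of (AM v \<tau>)) = dom (OM v (Cod J \<tau>))"
        using functor_square(2)[OF v s(2), unfolded square_iff] by simp_all
      have "AM Q' z \<in> Ar (over_cat E K forget)"
        unfolding z Q'A over_cat_simps(2)
        using ar[OF s] s Q'ob c t by (simp add: Ks Q'O) (simp add: mid_def)
      then show "AM Q' z \<in> hom (over_cat E K forget) (OM Q' (Dom D z)) (OM Q' (Cod D z))"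
        by (simp add: z Q'A Dsimps over_cat_simps(3,4))
      fix z' assume "z' \<in> Ar D" "Dom D z' = Cod D z"
      then obtain \<sigma>' b1 b'' \<tau>' where z': "z' = ((obj (Dom I \<sigma>') b1, (bot_of (AM v \<tau>'), \<sigma>'), obj (Cod I \<sigma>') b''), \<tau>')"
        and s1: "\<sigma>' \<in> Ar I" "\<tau>' \<in> Ar J" "arr b1" "dom b1 = cod (OM u (Dom I \<sigma>'))" "cod b1 = cod (OM v (Dom J \<tau>'))"
          "arr b''" "dom b'' = cod (OM u (Cod I \<sigma>'))" "cod b'' = cod (OM v (Cod J \<tau>'))" "b'' \<cdot> bot_of (AM u \<sigma>') = bot_of (AM v \<tau>') \<cdot> b1"
        and d1: "Dom D z' = Cod D z"
        using Dar by blast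
      have d: "Dom I \<sigma>' = Cod I \<sigma>" "b1 = b'" "Dom J \<tau>' = Cod J \<tau>"
        using d1 by (simp_all add: z z' Dsimps over_cat_simps(3,4) obj_def)
      note s' = s1[unfolded d]
      note c' = gen_frob_cospan_map(1,2)[OF u v s1, unfolded d]
      have zz: "Comp D z' z = ((obj (Dom I (Comp I \<sigma>' \<sigma>)) b, (bot_of (AM v \<tau>') \<cdot> bot_of (AM v \<tau>), Comp I \<sigma>' \<sigma>), obj (Cod I (Comp I \<sigma>' \<sigma>)) b''), Comp J \<tau>' \<tau>)"
        using s s' d by (simp add: z z' Dsimps over_cat_simps(6))
      have "mid (Comp I \<sigma>' \<sigma>) b b'' (Comp J \<tau>' \<tau>) = Comp (arrow_cat E) (mid \<sigma>' b' b'' \<tau>') (mid \<sigma> b b' \<tau>)"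
        using s s' d by (simp add: mid_def functor_square_comp[OF u] functor_square_comp[OF v] pm_comp[OF c(1) c'(1)] pm_comp[OF c(2) c'(2)])
      then show "AM Q' (Comp D z' z) = Comp (over_cat E K forget) (AM Q' z') (AM Q' z)"
        unfolding zz Q'A unfolding z z' Q'A over_cat_simps(6)
        using s s' d by (simp add: Ks functor_square_comp[OF v])
    qed
    moreover have "functor_eq D (comp_func (over_func forget) Q') (comp_func (Q_func E pb) (prod_func (over_func u) v))"
      unfolding functor_eq_def
    proof (intro conjI ballI)
      fix z assume "z \<in> Ob D"
      then obtain i b j where z: "z = (obj i b, j)" using Dob by blast
      show "OM (comp_func (over_func forget) Q') z = OM (comp_func (Q_func E pb) (prod_func (over_func u) v)) z"
        unfolding z QO by (simp add: Q'O over_func_def)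
    next
      fix z assume "z \<in> Ar D"
      then obtain \<sigma> b b' \<tau> where z: "z = ((obj (Dom I \<sigma>) b, (bot_of (AM v \<tau>), \<sigma>), obj (Cod I \<sigma>) b'), \<tau>)" and s: "\<sigma> \<in> Ar I" "\<tau> \<in> Ar J"
        using Dar by blast
      show "AM (comp_func (over_func forget) Q') z = AM (comp_func (Q_func E pb) (prod_func (over_func u) v)) z"
        unfolding z QA[OF s] QO by (simp add: Q'A Q'O over_func_def)
    qed
    ultimately show "\<exists>Q'. ?lift Q'" by blast
  qed
qed

end

section \<open>Maps with chosen fillers\<close>

context cat begin

lemma right_maps_Ob: "(f, \<phi>) \<in> Ob (right_maps E I u) \<longleftrightarrow> arr f \<and>
    (\<forall>i s t. if i \<in> Ob I \<and> square E (OM u i) f s t then filler E (OM u i) f s t (\<phi> i s t) else \<phi> i s t = undefined) \<and>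
    (\<forall>\<sigma>\<in>Ar I. \<forall>s t. square E (OM u (Cod I \<sigma>)) f s t \<longrightarrow>
       \<phi> (Cod I \<sigma>) s t \<cdot> bot_of (AM u \<sigma>) = \<phi> (Dom I \<sigma>) (s \<cdot> top_of (AM u \<sigma>)) (t \<cdot> bot_of (AM u \<sigma>)))"
  by (simp add: right_maps_def)

lemma right_maps_Ar: "((f, \<phi>), h, (g, \<psi>)) \<in> Ar (right_maps E I u) \<longleftrightarrow>
    (f, \<phi>) \<in> Ob (right_maps E I u) \<and> (g, \<psi>) \<in> Ob (right_maps E I u) \<and> h \<in> hom (arrow_cat E) f g \<and>
    (\<forall>i\<in>Ob I. \<forall>s t. square E (OM u i) f s t \<longrightarrow> top_of h \<cdot> \<phi> i s t = \<psi> i (top_of h \<cdot> s) (bot_of h \<cdot> t))"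
  unfolding right_maps_def struct_cat_simps by auto

lemma left_maps_Ob: "(f, \<phi>) \<in> Ob (left_maps E J v) \<longleftrightarrow> arr f \<and>
    (\<forall>i s t. if i \<in> Ob J \<and> square E f (OM v i) s t then filler E f (OM v i) s t (\<phi> i s t) else \<phi> i s t = undefined) \<and>
    (\<forall>\<sigma>\<in>Ar J. \<forall>s t. square E f (OM v (Dom J \<sigma>)) s t \<longrightarrow>
       top_of (AM v \<sigma>) \<cdot> \<phi> (Dom J \<sigma>) s t = \<phi> (Cod J \<sigma>) (top_of (AM v \<sigma>) \<cdot> s) (bot_of (AM v \<sigma>) \<cdot> t))"
  by (simp add: left_maps_def)

lemma left_maps_Ar: "((f, \<phi>), h, (g, \<psi>)) \<in> Ar (left_maps E J v) \<longleftrightarrow>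
    (f, \<phi>) \<in> Ob (left_maps E J v) \<and> (g, \<psi>) \<in> Ob (left_maps E J v) \<and> h \<in> hom (arrow_cat E) f g \<and>
    (\<forall>i\<in>Ob J. \<forall>s t. square E g (OM v i) s t \<longrightarrow> \<psi> i s t \<cdot> bot_of h = \<phi> i (s \<cdot> top_of h) (t \<cdot> bot_of h))"
  unfolding left_maps_def struct_cat_simps by auto

lemma right_filler:
  assumes "(f, \<phi>) \<in> Ob (right_maps E I u)" "i \<in> Ob I" "square E (OM u i) f s t"
  shows "arr (\<phi> i s t)" "dom (\<phi> i s t) = cod (OM u i)" "cod (\<phi> i s t) = dom f"
    "\<phi> i s t \<cdot> OM u i = s" "f \<cdot> \<phi> i s t = t"
  using assms unfolding right_maps_Ob by (auto simp: filler_def split: if_splits)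

lemma left_filler:
  assumes "(f, \<phi>) \<in> Ob (left_maps E J v)" "i \<in> Ob J" "square E f (OM v i) s t"
  shows "arr (\<phi> i s t)" "dom (\<phi> i s t) = cod f" "cod (\<phi> i s t) = dom (OM v i)"
    "\<phi> i s t \<cdot> f = s" "OM v i \<cdot> \<phi> i s t = t"
  using assms unfolding left_maps_Ob by (auto simp: filler_def split: if_splits)

lemma left_right_maps_square:
  "((f, \<phi>), (f', (s, t), g'), (g, \<psi>)) \<in> Ar (right_maps E I u) \<Longrightarrow> f' = f \<and> g' = g \<and> square E f g s t"
  "((f, \<phi>), (f', (s, t), g'), (g, \<psi>)) \<in> Ar (left_maps E J v) \<Longrightarrow> f' = f \<and> g' = g \<and> square E f g s t"
  unfolding right_maps_Ar left_maps_Ar by auto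

lemma right_maps_nat:
  assumes "(f, \<phi>) \<in> Ob (right_maps E I u)" "\<sigma> \<in> Ar I" "square E (OM u (Cod I \<sigma>)) f s t"
  shows "\<phi> (Cod I \<sigma>) s t \<cdot> bot_of (AM u \<sigma>) = \<phi> (Dom I \<sigma>) (s \<cdot> top_of (AM u \<sigma>)) (t \<cdot> bot_of (AM u \<sigma>))"
  using assms unfolding right_maps_Ob by blast

lemma left_maps_nat:
  assumes "(f, \<phi>) \<in> Ob (left_maps E J v)" "\<sigma> \<in> Ar J" "square E f (OM v (Dom J \<sigma>)) s t"
  shows "top_of (AM v \<sigma>) \<cdot> \<phi> (Dom J \<sigma>) s t = \<phi> (Cod J \<sigma>) (top_of (AM v \<sigma>) \<cdot> s) (bot_of (AM v \<sigma>) \<cdot> t)"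
  using assms unfolding left_maps_Ob by blast

lemma right_maps_mor:
  assumes "((f, \<phi>), (f', (h, k), g'), (g, \<psi>)) \<in> Ar (right_maps E I u)" "i \<in> Ob I" "square E (OM u i) f s t"
  shows "h \<cdot> \<phi> i s t = \<psi> i (h \<cdot> s) (k \<cdot> t)"
  using assms unfolding right_maps_Ar by simp

lemma left_maps_mor:
  assumes "((f, \<phi>), (f', (h, k), g'), (g, \<psi>)) \<in> Ar (left_maps E J v)" "i \<in> Ob J" "square E g (OM v i) s t"
  shows "\<psi> i s t \<cdot> k = \<phi> i (s \<cdot> h) (t \<cdot> k)"
  using assms unfolding left_maps_Ar by simp

lemma structured_right_maps: "structured E (right_maps E I u)"
proof -
  have "category (right_maps E I u)"
    unfolding right_maps_def
  proof (rule category_struct_cat[OF category_arrow_cat], goal_cases)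
    case (2 X)
    then show ?case
      by (cases X) (auto simp: square_iff filler_def split: if_splits)
  next
    case (3 X Y Z h k)
    obtain f \<phi> g \<psi> l \<chi> where X: "X = (f, \<phi>)" "Y = (g, \<psi>)" "Z = (l, \<chi>)"
      by (cases X, cases Y, cases Z) auto
    obtain s1 t1 where h: "h = (f, (s1, t1), g)"
      using 3(4) X by (cases h) auto
    obtain s2 t2 where k: "k = (g, (s2, t2), l)"
      using 3(5) X by (cases k) auto
    have fol: "(f, \<phi>) \<in> Ob (right_maps E I u)" "(g, \<psi>) \<in> Ob (right_maps E I u)"
      using 3(1,2) unfolding X right_maps_Ob by blast+
    have sq: "square E f g s1 t1" "square E g l s2 t2"
      using 3(4,5) unfolding h k by auto
    have "(s2 \<cdot> s1) \<cdot> \<phi> i s t = \<chi> i ((s2 \<cdot> s1) \<cdot> s) ((t2 \<cdot> t1) \<cdot> t)" if i: "i \<in> Ob I" "square E (OM u i) f s t" for i s t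
    proof -
      note q = square_comp[OF i(2) sq(1)]
      have "(s2 \<cdot> s1) \<cdot> \<phi> i s t = s2 \<cdot> s1 \<cdot> \<phi> i s t"
        using right_filler[OF fol(1) i] sq unfolding square_iff by simp
      also have "\<dots> = \<chi> i (s2 \<cdot> s1 \<cdot> s) (t2 \<cdot> t1 \<cdot> t)"
        using 3(6,7) i q unfolding X h k by simp
      also have "\<dots> = \<chi> i ((s2 \<cdot> s1) \<cdot> s) ((t2 \<cdot> t1) \<cdot> t)"
        using i sq unfolding square_iff by simp
      finally show ?thesis .
    qed
    then show ?case
      unfolding X h k by simp
  qed auto
  then show ?thesis
    unfolding structured_def right_maps_def by fastforce
qed

lemma structured_left_maps: "structured E (left_maps E J v)"
proof -
  have "category (left_maps E J v)"
    unfolding left_maps_def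
  proof (rule category_struct_cat[OF category_arrow_cat], goal_cases)
    case (2 X)
    then show ?case
      by (cases X) (auto simp: square_iff filler_def split: if_splits)
  next
    case (3 X Y Z h k)
    obtain f \<phi> g \<psi> l \<chi> where X: "X = (f, \<phi>)" "Y = (g, \<psi>)" "Z = (l, \<chi>)"
      by (cases X, cases Y, cases Z) auto
    obtain s1 t1 where h: "h = (f, (s1, t1), g)"
      using 3(4) X by (cases h) auto
    obtain s2 t2 where k: "k = (g, (s2, t2), l)"
      using 3(5) X by (cases k) auto
    have fol: "(l, \<chi>) \<in> Ob (left_maps E J v)" "(g, \<psi>) \<in> Ob (left_maps E J v)"
      using 3(2,3) unfolding X left_maps_Ob by blast+
    have sq: "square E f g s1 t1" "square E g l s2 t2"
      using 3(4,5) unfolding h k by auto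
    have "\<chi> i s t \<cdot> (t2 \<cdot> t1) = \<phi> i (s \<cdot> (s2 \<cdot> s1)) (t \<cdot> (t2 \<cdot> t1))" if i: "i \<in> Ob J" "square E l (OM v i) s t" for i s t
    proof -
      note q = square_comp[OF sq(2) i(2)]
      have "\<chi> i s t \<cdot> (t2 \<cdot> t1) = (\<chi> i s t \<cdot> t2) \<cdot> t1"
        using left_filler[OF fol(1) i] sq unfolding square_iff by simp
      also have "\<dots> = \<phi> i ((s \<cdot> s2) \<cdot> s1) ((t \<cdot> t2) \<cdot> t1)"
        using 3(6,7) i q unfolding X h k by simp
      also have "\<dots> = \<phi> i (s \<cdot> (s2 \<cdot> s1)) (t \<cdot> (t2 \<cdot> t1))"
        using i sq unfolding square_iff by simp
      finally show ?thesis .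
    qed
    then show ?case
      unfolding X h k by simp
  qed auto
  then show ?thesis
    unfolding structured_def left_maps_def by fastforce
qed

definition retract where
  "retract f g i0 i1 r0 r1 \<longleftrightarrow> square E f g i0 i1 \<and> square E g f r0 r1 \<and>
     r0 \<cdot> i0 = ide (dom f) \<and> r1 \<cdot> i1 = ide (cod f)"

text \<open>A problem for a retract \<open>f\<close> of \<open>g\<close> is extended to \<open>g\<close> along the retraction, solved there, and the
solution is restricted along the section.\<close>

definition retract_fill :: "('k, 'm) cat \<Rightarrow> ('k, 'm, 'a, 'a sq) func \<Rightarrow> 'a \<Rightarrow> ('k \<Rightarrow> 'a \<Rightarrow> 'a \<Rightarrow> 'a) \<Rightarrow>
    'a \<Rightarrow> 'a \<Rightarrow> 'a \<Rightarrow> 'k \<Rightarrow> 'a \<Rightarrow> 'a \<Rightarrow> 'a" where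
  "retract_fill J v f \<psi> r0 r1 i1 = (\<lambda>k s t. if k \<in> Ob J \<and> square E f (OM v k) s t
     then \<psi> k (s \<cdot> r0) (t \<cdot> r1) \<cdot> i1 else undefined)"

lemma left_maps_retract_Ob:
  assumes g: "(g, \<psi>) \<in> Ob (left_maps E J v)" and r: "retract f g i0 i1 r0 r1"
    and v: "is_functor J (arrow_cat E) v"
  shows "(f, retract_fill J v f \<psi> r0 r1 i1) \<in> Ob (left_maps E J v)"
  unfolding left_maps_Ob
proof (intro conjI allI ballI impI)
  have i: "square E f g i0 i1" and rr: "square E g f r0 r1" and e: "r0 \<cdot> i0 = ide (dom f)" "r1 \<cdot> i1 = ide (cod f)"
    using r by (simp_all add: retract_def)
  note ii = i[unfolded square_iff] and rr' = rr[unfolded square_iff]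
  show "arr f" using ii by simp
  have fil: "arr (\<psi> k (s \<cdot> r0) (t \<cdot> r1))" "dom (\<psi> k (s \<cdot> r0) (t \<cdot> r1)) = cod g"
      "cod (\<psi> k (s \<cdot> r0) (t \<cdot> r1)) = dom (OM v k)" "\<psi> k (s \<cdot> r0) (t \<cdot> r1) \<cdot> g = s \<cdot> r0" "OM v k \<cdot> \<psi> k (s \<cdot> r0) (t \<cdot> r1) = t \<cdot> r1"
    if "k \<in> Ob J" "square E f (OM v k) s t" for k s t
    using left_filler[OF g that(1) square_comp[OF rr that(2)]] by simp_all
  show "if k \<in> Ob J \<and> square E f (OM v k) s t then filler E f (OM v k) s t (retract_fill J v f \<psi> r0 r1 i1 k s t)
      else retract_fill J v f \<psi> r0 r1 i1 k s t = undefined" for k s t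
  proof (cases "k \<in> Ob J \<and> square E f (OM v k) s t")
    case True
    then have k: "k \<in> Ob J" "square E f (OM v k) s t" by auto
    let ?d = "\<psi> k (s \<cdot> r0) (t \<cdot> r1)"
    note q = k(2)[unfolded square_iff]
    have "?d \<cdot> i1 \<cdot> f = ?d \<cdot> g \<cdot> i0"
      using ii by simp
    also have "\<dots> = (s \<cdot> r0) \<cdot> i0"
      using fil[OF k] ii by (intro comp_eq_extend) auto
    also have "\<dots> = s"
      using ii rr' e q by simp
    finally have 1: "?d \<cdot> i1 \<cdot> f = s" .
    have "OM v k \<cdot> ?d \<cdot> i1 = (t \<cdot> r1) \<cdot> i1"
      using fil[OF k] ii q by (intro comp_eq_extend) auto
    also have "\<dots> = t"
      using ii rr' e q by simp
    finally show ?thesis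
      using True 1 fil[OF k] ii by (simp add: retract_fill_def filler_def)
  qed (auto simp: retract_fill_def)
  fix \<sigma> s t assume \<sigma>: "\<sigma> \<in> Ar J" and sq: "square E f (OM v (Dom J \<sigma>)) s t"
  note sv = functor_square(2)[OF v \<sigma>]
  note sv' = sv[unfolded square_iff] and sq' = sq[unfolded square_iff]
  have J: "Dom J \<sigma> \<in> Ob J" "Cod J \<sigma> \<in> Ob J"
    using is_functorD(1)[OF v] \<sigma> by (auto simp: category_def)
  have "top_of (AM v \<sigma>) \<cdot> \<psi> (Dom J \<sigma>) (s \<cdot> r0) (t \<cdot> r1) \<cdot> i1 =
      \<psi> (Cod J \<sigma>) (top_of (AM v \<sigma>) \<cdot> s \<cdot> r0) (bot_of (AM v \<sigma>) \<cdot> t \<cdot> r1) \<cdot> i1"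
    using left_maps_nat[OF g \<sigma> square_comp[OF rr sq]] fil[OF J(1) sq] ii sv'
    by (intro comp_eq_extend) auto
  then show "top_of (AM v \<sigma>) \<cdot> retract_fill J v f \<psi> r0 r1 i1 (Dom J \<sigma>) s t =
       retract_fill J v f \<psi> r0 r1 i1 (Cod J \<sigma>) (top_of (AM v \<sigma>) \<cdot> s) (bot_of (AM v \<sigma>) \<cdot> t)"
    using J sq square_comp[OF sq sv] sq' sv' rr' by (simp add: retract_fill_def)
qed

text \<open>This transport of fillers is functorial: it carries a map of retract diagrams whose middle part is a
morphism of left maps to a morphism between the retracts.\<close>

lemma left_maps_retract_Ar:
  assumes g: "((g, \<psi>), (g, (b0, b1), g'), (g', \<psi>')) \<in> Ar (left_maps E J v)"
    and r: "retract f g i0 i1 r0 r1" and r': "retract f' g' i0' i1' r0' r1'"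
    and v: "is_functor J (arrow_cat E) v" and a: "square E f f' a0 a1"
    and e: "b1 \<cdot> i1 = i1' \<cdot> a1" "r0' \<cdot> b0 = a0 \<cdot> r0" "r1' \<cdot> b1 = a1 \<cdot> r1"
  shows "((f, retract_fill J v f \<psi> r0 r1 i1), (f, (a0, a1), f'), (f', retract_fill J v f' \<psi>' r0' r1' i1')) \<in> Ar (left_maps E J v)"
  unfolding left_maps_Ar
proof (intro conjI ballI allI impI)
  note gob = g[unfolded left_maps_Ar, THEN conjunct1] g[unfolded left_maps_Ar, THEN conjunct2, THEN conjunct1]
  show "(f, retract_fill J v f \<psi> r0 r1 i1) \<in> Ob (left_maps E J v)"
    "(f', retract_fill J v f' \<psi>' r0' r1' i1') \<in> Ob (left_maps E J v)"
    by (rule left_maps_retract_Ob[OF _ _ v]; fact)+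
  show "(f, (a0, a1), f') \<in> hom (arrow_cat E) f f'"
    using a by simp
  fix k s t assume k: "k \<in> Ob J" and sq: "square E f' (OM v k) s t"
  have b: "square E g g' b0 b1"
    using left_right_maps_square(2)[OF g] by simp
  have rr: "square E g f r0 r1" and rr': "square E g' f' r0' r1'" and ii: "square E f g i0 i1" and ii': "square E f' g' i0' i1'"
    using r r' by (simp_all add: retract_def)
  note ty = b[unfolded square_iff] rr[unfolded square_iff] rr'[unfolded square_iff] ii[unfolded square_iff]
    ii'[unfolded square_iff] a[unfolded square_iff] sq[unfolded square_iff]
  note q = square_comp[OF rr' sq]
  note fil = left_filler[OF gob(2) k q]
  have "(\<psi>' k (s \<cdot> r0') (t \<cdot> r1') \<cdot> i1') \<cdot> a1 = \<psi>' k (s \<cdot> r0') (t \<cdot> r1') \<cdot> (b1 \<cdot> i1)"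
    using fil ty e(1) by simp
  also have "\<dots> = (\<psi>' k (s \<cdot> r0') (t \<cdot> r1') \<cdot> b1) \<cdot> i1"
    using fil ty by simp
  also have "\<psi>' k (s \<cdot> r0') (t \<cdot> r1') \<cdot> b1 = \<psi> k ((s \<cdot> r0') \<cdot> b0) ((t \<cdot> r1') \<cdot> b1)"
    by (rule left_maps_mor[OF g k q])
  also have "(s \<cdot> r0') \<cdot> b0 = (s \<cdot> a0) \<cdot> r0"
    using ty e(2) by simp
  also have "(t \<cdot> r1') \<cdot> b1 = (t \<cdot> a1) \<cdot> r1"
    using ty e(3) by simp
  finally show "retract_fill J v f' \<psi>' r0' r1' i1' k s t \<cdot> bot_of (f, (a0, a1), f') =
      retract_fill J v f \<psi> r0 r1 i1 k (s \<cdot> top_of (f, (a0, a1), f')) (t \<cdot> bot_of (f, (a0, a1), f'))"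
    using k sq square_comp[OF a sq] by (simp add: retract_fill_def)
qed

end

context pb_cat begin

lemma pullback_square: "cospan h b \<Longrightarrow> square E (pB h b) h (pA h b) b"
  by (simp add: square_iff cospan_arr pb_commutes)

text \<open>A filler into a pullback is a pair: the filler against \<open>h\<close> of the composite problem, and the bottom
of the given square.\<close>

definition base_change :: "('i, 's) cat \<Rightarrow> ('i, 's, 'a, 'a sq) func \<Rightarrow> 'a \<Rightarrow> ('i \<Rightarrow> 'a \<Rightarrow> 'a \<Rightarrow> 'a) \<Rightarrow>
    'a \<Rightarrow> 'i \<Rightarrow> 'a \<Rightarrow> 'a \<Rightarrow> 'a" where
  "base_change I u h \<phi> b = (\<lambda>i s t. if i \<in> Ob I \<and> square E (OM u i) (pB h b) s t
     then pair h b (\<phi> i (pA h b \<cdot> s) (b \<cdot> t)) t else undefined)"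

lemma base_change_filler:
  assumes h: "(h, \<phi>) \<in> Ob (right_maps E I u)" and c: "cospan h b"
    and i: "i \<in> Ob I" and q: "square E (OM u i) (pB h b) s t"
  shows "base_change I u h \<phi> b i s t = pair h b (\<phi> i (pA h b \<cdot> s) (b \<cdot> t)) t"
    and "cone h b (\<phi> i (pA h b \<cdot> s) (b \<cdot> t)) t"
    and "filler E (OM u i) (pB h b) s t (base_change I u h \<phi> b i s t)"
proof -
  let ?d = "\<phi> i (pA h b \<cdot> s) (b \<cdot> t)"
  show e: "base_change I u h \<phi> b i s t = pair h b ?d t"
    using i q by (simp add: base_change_def)
  note f = right_filler[OF h i square_comp[OF q pullback_square[OF c]]]
  note q' = q[unfolded square_iff]
  show k: "cone h b ?d t"
    using f q' c by (simp add: cone_def)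
  have "pair h b ?d t \<cdot> OM u i = s"
    by (rule pb_eqI[OF c]) (use k q' f c in auto)
  then show "filler E (OM u i) (pB h b) s t (base_change I u h \<phi> b i s t)"
    using k f q' c unfolding filler_def e by simp
qed

lemma base_change_Ob:
  assumes u: "is_functor I (arrow_cat E) u" and h: "(h, \<phi>) \<in> Ob (right_maps E I u)" and c: "cospan h b"
  shows "(pB h b, base_change I u h \<phi> b) \<in> Ob (right_maps E I u)"
  unfolding right_maps_Ob
proof (intro conjI allI ballI impI)
  show "arr (pB h b)" using c by simp
  show "if i \<in> Ob I \<and> square E (OM u i) (pB h b) s t then filler E (OM u i) (pB h b) s t (base_change I u h \<phi> b i s t)
     else base_change I u h \<phi> b i s t = undefined" for i s t
    using base_change_filler(3)[OF h c] by (auto simp: base_change_def)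
  fix \<sigma> s t assume \<sigma>: "\<sigma> \<in> Ar I" and q: "square E (OM u (Cod I \<sigma>)) (pB h b) s t"
  have I: "Dom I \<sigma> \<in> Ob I" "Cod I \<sigma> \<in> Ob I"
    using is_functorD(1)[OF u] \<sigma> by (auto simp: category_def)
  note su = functor_square(2)[OF u \<sigma>]
  note su' = su[unfolded square_iff] and q' = q[unfolded square_iff]
  note sq = pullback_square[OF c]
  note k = base_change_filler[OF h c I(2) q] and k' = base_change_filler[OF h c I(1) square_comp[OF su q]]
  have "\<phi> (Cod I \<sigma>) (pA h b \<cdot> s) (b \<cdot> t) \<cdot> bot_of (AM u \<sigma>) =
      \<phi> (Dom I \<sigma>) ((pA h b \<cdot> s) \<cdot> top_of (AM u \<sigma>)) ((b \<cdot> t) \<cdot> bot_of (AM u \<sigma>))"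
    by (rule right_maps_nat[OF h \<sigma> square_comp[OF q sq]])
  also have "\<dots> = \<phi> (Dom I \<sigma>) (pA h b \<cdot> (s \<cdot> top_of (AM u \<sigma>))) (b \<cdot> (t \<cdot> bot_of (AM u \<sigma>)))"
    using q' su' c cospan_arr[OF c] by simp
  finally show "base_change I u h \<phi> b (Cod I \<sigma>) s t \<cdot> bot_of (AM u \<sigma>) =
       base_change I u h \<phi> b (Dom I \<sigma>) (s \<cdot> top_of (AM u \<sigma>)) (t \<cdot> bot_of (AM u \<sigma>))"
    unfolding k(1) k'(1) using pair_comp(1)[OF k(2), of "bot_of (AM u \<sigma>)"] su' q' by simp
qed

lemma base_change_proj:
  assumes u: "is_functor I (arrow_cat E) u" and h: "(h, \<phi>) \<in> Ob (right_maps E I u)" and c: "cospan h b"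
  shows "((pB h b, base_change I u h \<phi> b), (pB h b, (pA h b, b), h), (h, \<phi>)) \<in> Ar (right_maps E I u)"
  unfolding right_maps_Ar
  using base_change_Ob[OF assms] h pullback_square[OF c] base_change_filler(1,2)[OF h c] by simp

text \<open>A map into a pullback is determined by its two projections. One of them agrees automatically for
fillers, so compatibility with fillers can be tested after composing with the projection to \<open>h\<close>.\<close>

lemma base_change_cartesian:
  assumes u: "is_functor I (arrow_cat E) u" and h: "(h, \<phi>) \<in> Ob (right_maps E I u)" and c: "cospan h b"
    and q: "square E g (pB h b) c0 c1"
    and m: "((g, \<gamma>), (g, (pA h b \<cdot> c0, b \<cdot> c1), h), (h, \<phi>)) \<in> Ar (right_maps E I u)"
  shows "((g, \<gamma>), (g, (c0, c1), pB h b), (pB h b, base_change I u h \<phi> b)) \<in> Ar (right_maps E I u)"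
  unfolding right_maps_Ar
proof (intro conjI ballI allI impI)
  show g: "(g, \<gamma>) \<in> Ob (right_maps E I u)" using m unfolding right_maps_Ar by blast
  show "(pB h b, base_change I u h \<phi> b) \<in> Ob (right_maps E I u)" by (rule base_change_Ob[OF u h c])
  show "(g, (c0, c1), pB h b) \<in> hom (arrow_cat E) g (pB h b)" using q by simp
  fix i s t assume i: "i \<in> Ob I" and s: "square E (OM u i) g s t"
  note f = right_filler[OF g i s]
  note s' = s[unfolded square_iff] and q' = q[unfolded square_iff]
  note k = base_change_filler[OF h c i square_comp[OF s q]]
  have "c0 \<cdot> \<gamma> i s t = pair h b (\<phi> i (pA h b \<cdot> (c0 \<cdot> s)) (b \<cdot> (c1 \<cdot> t))) (c1 \<cdot> t)"
  proof (rule pb_eqI[OF c])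
    have "pA h b \<cdot> c0 \<cdot> \<gamma> i s t = (pA h b \<cdot> c0) \<cdot> \<gamma> i s t"
      using f q' c by simp
    also have "\<dots> = \<phi> i ((pA h b \<cdot> c0) \<cdot> s) ((b \<cdot> c1) \<cdot> t)"
      by (rule right_maps_mor[OF m i s])
    also have "\<dots> = \<phi> i (pA h b \<cdot> (c0 \<cdot> s)) (b \<cdot> (c1 \<cdot> t))"
      using q' s' c cospan_arr[OF c] by simp
    also have "\<dots> = pA h b \<cdot> pair h b (\<phi> i (pA h b \<cdot> (c0 \<cdot> s)) (b \<cdot> (c1 \<cdot> t))) (c1 \<cdot> t)"
      using k(2) by simp
    finally show "pA h b \<cdot> c0 \<cdot> \<gamma> i s t = pA h b \<cdot> pair h b (\<phi> i (pA h b \<cdot> (c0 \<cdot> s)) (b \<cdot> (c1 \<cdot> t))) (c1 \<cdot> t)" .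
    have "pB h b \<cdot> c0 \<cdot> \<gamma> i s t = (c1 \<cdot> g) \<cdot> \<gamma> i s t"
      using f q' c by (intro comp_eq_extend) auto
    also have "\<dots> = c1 \<cdot> t"
      by (subst assoc) (use f q' s' in simp_all)
    finally show "pB h b \<cdot> c0 \<cdot> \<gamma> i s t = pB h b \<cdot> pair h b (\<phi> i (pA h b \<cdot> (c0 \<cdot> s)) (b \<cdot> (c1 \<cdot> t))) (c1 \<cdot> t)"
      using k(2) by simp
  qed (use f q' k(2) c s' in auto)
  then show "top_of (g, (c0, c1), pB h b) \<cdot> \<gamma> i s t =
      base_change I u h \<phi> b i (top_of (g, (c0, c1), pB h b) \<cdot> s) (bot_of (g, (c0, c1), pB h b) \<cdot> t)"
    using k(1) by simp
qed

end

section \<open>Pushforward\<close>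

lemma adjunction_transpose:
  assumes adj: "adjunction C D F G \<eta> \<epsilon>" and x: "x \<in> Ob C" and y: "y \<in> Ob D" and p: "p \<in> hom D (OM F x) y"
  shows "\<exists>!r. r \<in> hom C x (OM G y) \<and> Comp D (\<epsilon> y) (AM F r) = p"
proof -
  have F: "is_functor C D F" and G: "is_functor D C G"
    and \<eta>: "nat_trans C C id_func (comp_func G F) \<eta>" and \<epsilon>: "nat_trans D D (comp_func F G) id_func \<epsilon>"
    and t1: "\<And>x. x \<in> Ob C \<Longrightarrow> Comp D (\<epsilon> (OM F x)) (AM F (\<eta> x)) = Ide D (OM F x)"
    and t2: "\<And>y. y \<in> Ob D \<Longrightarrow> Comp C (AM G (\<epsilon> y)) (\<eta> (OM G y)) = Ide C (OM G y)"
    using adj by (auto simp: adjunction_def)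
  note F' = is_functorD[OF F] and G' = is_functorD[OF G]
  interpret C: cat C using F'(1) by unfold_locales
  interpret D: cat D using F'(2) by unfold_locales
  have \<eta>1: "\<eta> x \<in> Ar C" "Dom C (\<eta> x) = x" "Cod C (\<eta> x) = OM G (OM F x)" if "x \<in> Ob C" for x
    using \<eta> that by (auto simp: nat_trans_def)
  have \<eta>2: "Comp C (\<eta> (Cod C f)) f = Comp C (AM G (AM F f)) (\<eta> (Dom C f))" if "f \<in> Ar C" for f
    using \<eta> that by (auto simp: nat_trans_def)
  have \<epsilon>1: "\<epsilon> y \<in> Ar D" "Dom D (\<epsilon> y) = OM F (OM G y)" "Cod D (\<epsilon> y) = y" if "y \<in> Ob D" for y
    using \<epsilon> that by (auto simp: nat_trans_def)
  have \<epsilon>2: "Comp D (\<epsilon> (Cod D f)) (AM F (AM G f)) = Comp D f (\<epsilon> (Dom D f))" if "f \<in> Ar D" for f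
    using \<epsilon> that by (auto simp: nat_trans_def)
  have p': "p \<in> Ar D" "Dom D p = OM F x" "Cod D p = y" using p by auto
  show ?thesis
  proof (rule ex1I)
    let ?r = "Comp C (AM G p) (\<eta> x)"
    have "Comp D (\<epsilon> y) (AM F ?r) = Comp D (\<epsilon> y) (Comp D (AM F (AM G p)) (AM F (\<eta> x)))"
      using x p' by (simp add: F' G' \<eta>1)
    also have "\<dots> = Comp D (Comp D p (\<epsilon> (OM F x))) (AM F (\<eta> x))"
      using x y p' \<epsilon>2[OF p'(1)] by (intro D.comp_eq_extend) (simp_all add: F' G' \<eta>1 \<epsilon>1)
    also have "\<dots> = p"
      using x y p' by (simp add: F' G' \<eta>1 \<epsilon>1 t1)
    finally show "?r \<in> hom C x (OM G y) \<and> Comp D (\<epsilon> y) (AM F ?r) = p"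
      using x y p' by (simp add: F' G' \<eta>1)
  next
    fix r assume "r \<in> hom C x (OM G y) \<and> Comp D (\<epsilon> y) (AM F r) = p"
    then have r: "r \<in> Ar C" "Dom C r = x" "Cod C r = OM G y" and e: "Comp D (\<epsilon> y) (AM F r) = p" by auto
    have "Comp C (AM G p) (\<eta> x) = Comp C (AM G (\<epsilon> y)) (Comp C (AM G (AM F r)) (\<eta> x))"
      using x y r unfolding e[symmetric] by (simp add: F' G' \<eta>1 \<epsilon>1)
    also have "\<dots> = Comp C (AM G (\<epsilon> y)) (Comp C (\<eta> (OM G y)) r)"
      using \<eta>2[OF r(1)] r by simp
    also have "\<dots> = Comp C (Ide C (OM G y)) r"
      using x y r t2[OF y] by (intro C.comp_eq_extend) (simp_all add: F' G' \<eta>1 \<epsilon>1)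
    also have "\<dots> = r"
      using r by simp
    finally show "r = Comp C (AM G p) (\<eta> x)" by simp
  qed
qed

context pb_cat begin

definition over_transpose where
  "over_transpose h z m ev a p r \<longleftrightarrow> arr r \<and> dom r = dom a \<and> cod r = dom m \<and> m \<cdot> r = a \<and>
     ev \<cdot> pm a h m h r (ide (dom h)) = p"

text \<open>The universal property of the right adjoint of pulling back along \<open>h\<close> at the object \<open>z\<close> of the slice
over \<open>dom h\<close>: maps from \<open>a\<close> to \<open>m\<close> over \<open>cod h\<close> are maps from \<open>h\<^sup>*(a)\<close> to \<open>z\<close> over \<open>dom h\<close>, by
evaluation along the counit component \<open>ev\<close>.\<close>

definition is_pushforward where
  "is_pushforward h z m ev \<longleftrightarrow> arr m \<and> cod m = cod h \<and> arr ev \<and> dom ev = PB m h \<and> cod ev = dom z \<and> z \<cdot> ev = pB m h \<and>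
     (\<forall>a p. arr a \<longrightarrow> cod a = cod h \<longrightarrow> arr p \<longrightarrow> dom p = PB a h \<longrightarrow> cod p = dom z \<longrightarrow> z \<cdot> p = pB a h \<longrightarrow>
        (\<exists>!r. over_transpose h z m ev a p r))"

lemma pushforward_exists:
  assumes adj: "has_right_adjoint (slice E (cod h)) (slice E (dom h)) (pullback_func E pb h)"
    and h: "arr h" and z: "arr z" "cod z = dom h"
  shows "\<exists>m ev. is_pushforward h z m ev"
proof -
  obtain G \<eta> \<epsilon> where a: "adjunction (slice E (cod h)) (slice E (dom h)) (pullback_func E pb h) G \<eta> \<epsilon>"
    using adj unfolding has_right_adjoint_def by blast
  have zO: "z \<in> Ob (slice E (dom h))"
    using z by (simp add: slice_def)
  have "is_functor (slice E (dom h)) (slice E (cod h)) G"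
    using a by (simp add: adjunction_def)
  from is_functorD(3)[OF this zO] have m: "arr (OM G z)" "cod (OM G z) = cod h"
    by (simp_all add: slice_def)
  let ?m = "OM G z"
  have \<epsilon>: "\<epsilon> z \<in> hom (slice E (dom h)) (pB ?m h) z"
    using a zO by (auto simp: adjunction_def nat_trans_def pullback_func_def)
  then obtain ev where e: "\<epsilon> z = (pB ?m h, ev, z)"
    by (cases "\<epsilon> z") (auto simp: slice_def)
  have c: "cospan a' h" if "arr a'" "cod a' = cod h" for a'
    using that h by (simp add: cospan_def)
  have ev: "arr ev" "dom ev = PB ?m h" "cod ev = dom z" "z \<cdot> ev = pB ?m h"
    using \<epsilon> e m h c by (simp_all add: slice_def)
  have "\<exists>!r. over_transpose h z ?m ev a' p r"
    if a': "arr a'" "cod a' = cod h" and p: "arr p" "dom p = PB a' h" "cod p = dom z" "z \<cdot> p = pB a' h" for a' p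
  proof -
    have "a' \<in> Ob (slice E (cod h))" "(pB a' h, p, z) \<in> hom (slice E (dom h)) (OM (pullback_func E pb h) a') z"
      using a' p z h c by (simp_all add: slice_def pullback_func_def)
    from adjunction_transpose[OF a this(1) zO this(2)]
    have u: "\<exists>!r. r \<in> hom (slice E (cod h)) a' ?m \<and>
      Comp (slice E (dom h)) (\<epsilon> z) (AM (pullback_func E pb h) r) = (pB a' h, p, z)" .
    have iff: "over_transpose h z ?m ev a' p r \<longleftrightarrow> (a', r, ?m) \<in> hom (slice E (cod h)) a' ?m \<and>
      Comp (slice E (dom h)) (\<epsilon> z) (AM (pullback_func E pb h) (a', r, ?m)) = (pB a' h, p, z)" for r
      using a' m h by (auto simp: over_transpose_def slice_def pullback_func_def e)
    have hom: "\<exists>r'. r = (a', r', ?m)" if "r \<in> hom (slice E (cod h)) a' ?m" for r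
      using that by (cases r) (auto simp: slice_def)
    from u obtain r where r: "r \<in> hom (slice E (cod h)) a' ?m" "Comp (slice E (dom h)) (\<epsilon> z) (AM (pullback_func E pb h) r) = (pB a' h, p, z)"
      and un: "\<And>r'. r' \<in> hom (slice E (cod h)) a' ?m \<Longrightarrow> Comp (slice E (dom h)) (\<epsilon> z) (AM (pullback_func E pb h) r') = (pB a' h, p, z) \<Longrightarrow> r' = r"
      by blast
    obtain r' where r': "r = (a', r', ?m)" using hom[OF r(1)] by blast
    show ?thesis
    proof (rule ex1I)
      show "over_transpose h z ?m ev a' p r'"
        unfolding iff using r unfolding r' by blast
    next
      fix r'' assume "over_transpose h z ?m ev a' p r''"
      then have "(a', r'', ?m) = r"
        unfolding iff using un by blast
      then show "r'' = r'" using r' by simp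
    qed
  qed
  then have "is_pushforward h z ?m ev"
    unfolding is_pushforward_def using m ev by blast
  then show ?thesis by blast
qed

end

section \<open>From the Frobenius condition to its generalized form\<close>

lemma structured_Ar_comp:
  assumes K: "structured E K" and q: "((f, \<phi>), (f, (s, t), g), (g, \<psi>)) \<in> Ar K"
    and r: "((g, \<psi>), (g, (s', t'), k), (k, \<chi>)) \<in> Ar K"
  shows "((f, \<phi>), (f, (Comp E s' s, Comp E t' t), k), (k, \<chi>)) \<in> Ar K"
proof -
  have "category K" using K by (simp add: structured_def)
  then have "Comp K ((g, \<psi>), (g, (s', t'), k), (k, \<chi>)) ((f, \<phi>), (f, (s, t), g), (g, \<psi>)) \<in> Ar K"
    using cat.comp_arr[of K, unfolded cat_def, OF _ q r] by (simp add: structured_simps[OF K])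
  then show ?thesis
    by (simp add: structured_simps[OF K])
qed

context pb_cat begin

text \<open>Pulling \<open>f\<close> back along \<open>h\<close> over the codomain of \<open>b\<close> is pulling \<open>f\<close> back along the base change of \<open>h\<close>
along \<open>b\<close>. For a strict choice of pullbacks the two results are only isomorphic; the isomorphism
is recorded as a retract, so that fillers can be transported along it.\<close>

lemma qarr_retract:
  assumes f: "arr f" "arr b" "dom b = cod f" "arr h" "cod b = cod h"
  defines "a \<equiv> b \<cdot> f" and "h1 \<equiv> pB h b"
  shows "retract (qarr f b h) (pB f h1)
     (pair f h1 (pA a h) (pair h b (pB a h) (f \<cdot> pA a h))) (pair h b (pB b h) (pA b h))
     (pair a h (pA f h1) (pA h b \<cdot> pB f h1)) (pair b h (pB h b) (pA h b))"
    and "cone f h1 (pA a h) (pair h b (pB a h) (f \<cdot> pA a h))" "cone h b (pB a h) (f \<cdot> pA a h)"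
     "cone h b (pB b h) (pA b h)" "cone a h (pA f h1) (pA h b \<cdot> pB f h1)" "cone b h (pB h b) (pA h b)"
proof -
  have c: "cospan b h" "cospan h b" "cospan a h"
    using f by (simp_all add: cospan_def a_def)
  have c1: "cospan f h1"
    using f c by (simp add: cospan_def h1_def)
  have a: "arr a" "dom a = dom f" "cod a = cod h"
    using f by (simp_all add: a_def)
  show k2: "cone h b (pB a h) (f \<cdot> pA a h)"
    using pb_commutes[OF c(3)] c f a by (simp add: cone_def a_def)
  show k1: "cone f h1 (pA a h) (pair h b (pB a h) (f \<cdot> pA a h))"
    using k2 c c1 f a by (simp add: cone_def h1_def)
  show k3: "cone h b (pB b h) (pA b h)"
    using pb_commutes[OF c(1)] c f by (simp add: cone_def)
  show k5: "cone b h (pB h b) (pA h b)"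
    using pb_commutes[OF c(2)] c f by (simp add: cone_def)
  show k4: "cone a h (pA f h1) (pA h b \<cdot> pB f h1)"
  proof -
    have "a \<cdot> pA f h1 = b \<cdot> h1 \<cdot> pB f h1"
      using pb_commutes[OF c1] f c1 by (simp add: a_def)
    also have "\<dots> = h \<cdot> pA h b \<cdot> pB f h1"
      using pb_commutes_extend[OF c(2), of "pB f h1"] c1 c by (simp add: h1_def)
    finally show ?thesis
      using c c1 f a by (simp add: cone_def h1_def)
  qed
  have h1: "dom h1 = PB h b" "arr h1" "cod h1 = dom b" using c by (simp_all add: h1_def)
  let ?i0 = "pair f h1 (pA a h) (pair h b (pB a h) (f \<cdot> pA a h))" and ?i1 = "pair h b (pB b h) (pA b h)"
  let ?r0 = "pair a h (pA f h1) (pA h b \<cdot> pB f h1)" and ?r1 = "pair b h (pB h b) (pA h b)"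
  note q = qarr_props[OF f, folded a_def]
  have "?i1 \<cdot> qarr f b h = pB f h1 \<cdot> ?i0"
    by (rule pb_eqI[OF c(2)]) (use k1 k2 k3 q c c1 f a h1 in simp_all)
  then have 1: "square E (qarr f b h) (pB f h1) ?i0 ?i1"
    using k1 k2 k3 q c c1 h1 f a by (simp add: square_iff)
  have "?r1 \<cdot> pB f h1 = qarr f b h \<cdot> ?r0"
  proof (rule pb_eqI[OF c(1)])
    show "pA b h \<cdot> ?r1 \<cdot> pB f h1 = pA b h \<cdot> qarr f b h \<cdot> ?r0"
    proof -
      have "pA b h \<cdot> ?r1 \<cdot> pB f h1 = f \<cdot> pA f h1"
        using k5 c c1 h1 pb_commutes[OF c1] by (simp add: h1_def)
      also have "\<dots> = (f \<cdot> pA a h) \<cdot> ?r0"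
        using k4 f a c c1 by simp
      also have "\<dots> = pA b h \<cdot> qarr f b h \<cdot> ?r0"
        using k4 q c c1 by (intro comp_eq_extend[symmetric]) simp_all
      finally show ?thesis .
    qed
    show "pB b h \<cdot> ?r1 \<cdot> pB f h1 = pB b h \<cdot> qarr f b h \<cdot> ?r0"
    proof -
      have "pB b h \<cdot> ?r1 \<cdot> pB f h1 = pB a h \<cdot> ?r0"
        using k4 k5 c c1 h1 by simp
      also have "\<dots> = pB b h \<cdot> qarr f b h \<cdot> ?r0"
        using k4 q c c1 by (intro comp_eq_extend[symmetric]) simp_all
      finally show ?thesis .
    qed
  qed (use k4 k5 q c c1 h1 in simp_all)
  then have 2: "square E (pB f h1) (qarr f b h) ?r0 ?r1"
    using k4 k5 q c c1 h1 f a by (simp add: square_iff)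
  have 3: "?r0 \<cdot> ?i0 = ide (PB a h)"
    by (rule pb_eqI[OF c(3)]) (use k1 k2 k4 c c1 h1 f a in simp_all)
  have 4: "?r1 \<cdot> ?i1 = ide (PB b h)"
    by (rule pb_eqI[OF c(1)]) (use k3 k5 c in simp_all)
  show "retract (qarr f b h) (pB f h1) ?i0 ?i1 ?r0 ?r1"
    unfolding retract_def using 1 2 3 4 q by simp
qed

lemma qarr_retract_natural:
  assumes f: "arr f" "arr b" "dom b = cod f" "arr h" "cod b = cod h"
    and f': "arr f'" "arr b'" "dom b' = cod f'" "arr h'" "cod b' = cod h'"
    and st: "square E f f' s t" and yx: "square E h h' y x" and e: "b' \<cdot> t = x \<cdot> b"
  defines "a \<equiv> b \<cdot> f" and "h1 \<equiv> pB h b" and "a' \<equiv> b' \<cdot> f'" and "h1' \<equiv> pB h' b'"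
  defines "z \<equiv> pm h b h' b' y t"
  shows "z \<cdot> pair h b (pB b h) (pA b h) = pair h' b' (pB b' h') (pA b' h') \<cdot> pm b h b' h' t y"
    and "pair a' h' (pA f' h1') (pA h' b' \<cdot> pB f' h1') \<cdot> pm f h1 f' h1' s z = pm a h a' h' s y \<cdot> pair a h (pA f h1) (pA h b \<cdot> pB f h1)"
    and "pair b' h' (pB h' b') (pA h' b') \<cdot> z = pm b h b' h' t y \<cdot> pair b h (pB h b) (pA h b)"
    and "square E (qarr f b h) (qarr f' b' h') (pm a h a' h' s y) (pm b h b' h' t y)"
proof -
  note k = qarr_retract(2-)[OF f, folded a_def h1_def] and k' = qarr_retract(2-)[OF f', folded a'_def h1'_def]
  note s = st[unfolded square_iff] and y = yx[unfolded square_iff]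
  have c: "cospan b h" "cospan h b" "cospan a h" "cospan b' h'" "cospan h' b'" "cospan a' h'"
    using f f' by (simp_all add: cospan_def a_def a'_def)
  have c1: "cospan f h1" "cospan f' h1'"
    using f f' c by (simp_all add: cospan_def h1_def h1'_def)
  have m1: "cospan_map h b h' b' y t" "cospan_map b h b' h' t y"
    unfolding cospan_map_def using c s y f f' e by (auto intro!: exI[of _ x])
  have "a' \<cdot> s = x \<cdot> a"
  proof -
    have "a' \<cdot> s = b' \<cdot> t \<cdot> f"
      using s f' by (simp add: a'_def)
    also have "\<dots> = (x \<cdot> b) \<cdot> f"
      using s f' f e by (intro comp_eq_extend) simp_all
    finally show ?thesis
      using f y by (simp add: a_def)
  qed
  then have m2: "cospan_map a h a' h' s y"
    unfolding cospan_map_def using c s y f f' by (auto simp: a_def a'_def intro!: exI[of _ x])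
  have z: "arr z" "dom z = PB h b" "cod z = PB h' b'" "h1' \<cdot> z = t \<cdot> h1"
    using m1(1) by (simp_all add: z_def h1'_def h1_def)
  have m3: "cospan_map f h1 f' h1' s z"
    unfolding cospan_map_def using c1 s z f f' c by (auto simp: h1_def h1'_def intro!: exI[of _ t])
  have h1: "dom h1 = PB h b" "arr h1" "cod h1 = dom b" "dom h1' = PB h' b'" "arr h1'" "cod h1' = dom b'"
    using c by (simp_all add: h1_def h1'_def)
  have a: "dom a = dom f" "dom a' = dom f'"
    using f f' by (simp_all add: a_def a'_def)
  show "z \<cdot> pair h b (pB b h) (pA b h) = pair h' b' (pB b' h') (pA b' h') \<cdot> pm b h b' h' t y"
    by (rule pb_eqI[OF c(5)]) (use k k' m1 c s y in \<open>simp_all add: z_def h1_def h1'_def\<close>)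
  show "pair b' h' (pB h' b') (pA h' b') \<cdot> z = pm b h b' h' t y \<cdot> pair b h (pB h b) (pA h b)"
    by (rule pb_eqI[OF c(4)]) (use k k' m1 c s y in \<open>simp_all add: z_def h1_def h1'_def\<close>)
  show "pair a' h' (pA f' h1') (pA h' b' \<cdot> pB f' h1') \<cdot> pm f h1 f' h1' s z = pm a h a' h' s y \<cdot> pair a h (pA f h1) (pA h b \<cdot> pB f h1)"
  proof (rule pb_eqI[OF c(6)])
    have "pA h' b' \<cdot> z \<cdot> pB f h1 = (y \<cdot> pA h b) \<cdot> pB f h1"
      using m1 c c1 h1 z by (intro comp_eq_extend) (simp_all add: z_def)
    then show "pB a' h' \<cdot> pair a' h' (pA f' h1') (pA h' b' \<cdot> pB f' h1') \<cdot> pm f h1 f' h1' s z =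
       pB a' h' \<cdot> pm a h a' h' s y \<cdot> pair a h (pA f h1) (pA h b \<cdot> pB f h1)"
      using k k' m1 m2 m3 c c1 h1 a z s y by simp
  qed (use k k' m1 m2 m3 c c1 h1 a z s y in simp_all)
  note q = qarr_props[OF f, folded a_def] qarr_props[OF f', folded a'_def]
  have "pm b h b' h' t y \<cdot> qarr f b h = qarr f' b' h' \<cdot> pm a h a' h' s y"
  proof (rule pb_eqI[OF c(4)])
    have "pA b' h' \<cdot> pm b h b' h' t y \<cdot> qarr f b h = t \<cdot> f \<cdot> pA a h"
      using m1 q c by simp
    also have "\<dots> = (f' \<cdot> s) \<cdot> pA a h"
      using s c a by (intro comp_eq_extend) simp_all
    also have "\<dots> = f' \<cdot> pA a' h' \<cdot> pm a h a' h' s y"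
      using m2 s c a by simp
    also have "\<dots> = (f' \<cdot> pA a' h') \<cdot> pm a h a' h' s y"
      using m2 s c a by simp
    also have "\<dots> = pA b' h' \<cdot> qarr f' b' h' \<cdot> pm a h a' h' s y"
      using m2 q c by (intro comp_eq_extend[symmetric]) simp_all
    finally show "pA b' h' \<cdot> pm b h b' h' t y \<cdot> qarr f b h = pA b' h' \<cdot> qarr f' b' h' \<cdot> pm a h a' h' s y" .
    have "pB b' h' \<cdot> pm b h b' h' t y \<cdot> qarr f b h = y \<cdot> pB a h"
      using m1 q c by simp
    also have "\<dots> = pB a' h' \<cdot> pm a h a' h' s y"
      using m2 by simp
    also have "\<dots> = pB b' h' \<cdot> qarr f' b' h' \<cdot> pm a h a' h' s y"
      using m2 q c by (intro comp_eq_extend[symmetric]) simp_all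
    finally show "pB b' h' \<cdot> pm b h b' h' t y \<cdot> qarr f b h = pB b' h' \<cdot> qarr f' b' h' \<cdot> pm a h a' h' s y" .
  qed (use m1 m2 q c in simp_all)
  then show "square E (qarr f b h) (qarr f' b' h') (pm a h a' h' s y) (pm b h b' h' t y)"
    using m1 m2 q by (simp add: square_iff)
qed

lemma base_change_mor:
  assumes u: "is_functor I (arrow_cat E) u"
    and m: "((h, \<phi>), (h, (y, x), h'), (h', \<phi>')) \<in> Ar (right_maps E I u)"
    and c: "cospan_map h b h' b' y t" and e: "b' \<cdot> t = x \<cdot> b"
  shows "((pB h b, base_change I u h \<phi> b), (pB h b, (pm h b h' b' y t, t), pB h' b'),
      (pB h' b', base_change I u h' \<phi>' b')) \<in> Ar (right_maps E I u)"
proof (rule base_change_cartesian[OF u])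
  have ob: "(h, \<phi>) \<in> Ob (right_maps E I u)" "(h', \<phi>') \<in> Ob (right_maps E I u)"
    using m unfolding right_maps_Ar by blast+
  note c' = cospan_mapD[OF c]
  show "(h', \<phi>') \<in> Ob (right_maps E I u)" by fact
  show "cospan h' b'" by (rule c')
  show "square E (pB h b) (pB h' b') (pm h b h' b' y t) t"
    using c c' by (simp add: square_iff)
  have "((pB h b, base_change I u h \<phi> b), (pB h b, (y \<cdot> pA h b, x \<cdot> b), h'), (h', \<phi>')) \<in> Ar (right_maps E I u)"
    by (rule structured_Ar_comp[OF structured_right_maps base_change_proj[OF u ob(1) c'(1)] m])
  then show "((pB h b, base_change I u h \<phi> b), (pB h b, (pA h' b' \<cdot> pm h b h' b' y t, b' \<cdot> t), h'), (h', \<phi>')) \<in> Ar (right_maps E I u)"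
    using c e by simp
qed

text \<open>The canonical functor from \<open>I\<close> to the left maps against its right maps: \<open>u\<^sub>i\<close> is filled
against a right map by the structure that the latter has at \<open>i\<close>.\<close>

definition unit_fill where
  "unit_fill R f i = (\<lambda>k s t. if k \<in> Ob R \<and> square E f (fst k) s t then snd k i s t else undefined)"

lemma unit_fill_Ob:
  fixes I u
  defines "R \<equiv> right_maps E I u"
  assumes u: "is_functor I (arrow_cat E) u" and i: "i \<in> Ob I"
  shows "(OM u i, unit_fill R (OM u i) i) \<in> Ob (left_maps E R forget)"
  unfolding left_maps_Ob
proof (intro conjI allI ballI impI)
  show "arr (OM u i)" using is_functorD(3)[OF u i] by simp
  show "if k \<in> Ob R \<and> square E (OM u i) (OM forget k) s t
      then filler E (OM u i) (OM forget k) s t (unit_fill R (OM u i) i k s t) else unit_fill R (OM u i) i k s t = undefined" for k s t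
    using i by (cases k) (auto simp: unit_fill_def R_def right_maps_Ob)
  fix \<sigma> s t assume \<sigma>: "\<sigma> \<in> Ar R" and q: "square E (OM u i) (OM forget (Dom R \<sigma>)) s t"
  note sR = structured_right_maps[of I u, folded R_def]
  obtain f \<phi> s' t' g \<psi> where \<sigma>e: "\<sigma> = ((f, \<phi>), (f, (s', t'), g), (g, \<psi>))" "(f, \<phi>) \<in> Ob R" "(g, \<psi>) \<in> Ob R" "square E f g s' t'"
    using structured_ArE[OF sR \<sigma>] by metis
  have "square E (OM u i) f s t" using q by (simp add: \<sigma>e structured_simps[OF sR])
  then show "top_of (AM forget \<sigma>) \<cdot> unit_fill R (OM u i) i (Dom R \<sigma>) s t =
      unit_fill R (OM u i) i (Cod R \<sigma>) (top_of (AM forget \<sigma>) \<cdot> s) (bot_of (AM forget \<sigma>) \<cdot> t)"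
    using right_maps_mor[OF \<sigma>[unfolded \<sigma>e R_def] i, of s t] square_comp[OF _ \<sigma>e(4), of "OM u i" s t] \<sigma>e(2,3)
    by (simp add: \<sigma>e(1) structured_simps[OF sR] unit_fill_def)
qed

lemma unit_fill_Ar:
  fixes I u
  defines "R \<equiv> right_maps E I u"
  assumes u: "is_functor I (arrow_cat E) u" and \<sigma>: "\<sigma> \<in> Ar I"
  shows "((OM u (Dom I \<sigma>), unit_fill R (OM u (Dom I \<sigma>)) (Dom I \<sigma>)), AM u \<sigma>,
     (OM u (Cod I \<sigma>), unit_fill R (OM u (Cod I \<sigma>)) (Cod I \<sigma>))) \<in> Ar (left_maps E R forget)"
  unfolding left_maps_Ar
proof (intro conjI allI ballI impI)
  have I: "Dom I \<sigma> \<in> Ob I" "Cod I \<sigma> \<in> Ob I"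
    using is_functorD(1)[OF u] \<sigma> by (auto simp: category_def)
  note sq = functor_square[OF u \<sigma>]
  show "(OM u (Dom I \<sigma>), unit_fill R (OM u (Dom I \<sigma>)) (Dom I \<sigma>)) \<in> Ob (left_maps E R forget)"
    "(OM u (Cod I \<sigma>), unit_fill R (OM u (Cod I \<sigma>)) (Cod I \<sigma>)) \<in> Ob (left_maps E R forget)"
    using unit_fill_Ob[OF u I(1)] unit_fill_Ob[OF u I(2)] by (simp_all add: R_def)
  show "AM u \<sigma> \<in> hom (arrow_cat E) (OM u (Dom I \<sigma>)) (OM u (Cod I \<sigma>))"
    using is_functorD(4-6)[OF u \<sigma>] by simp
  fix k s t assume k: "k \<in> Ob R" and q: "square E (OM u (Cod I \<sigma>)) (OM forget k) s t"
  obtain f \<phi> where kf: "k = (f, \<phi>)" by (cases k)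
  show "unit_fill R (OM u (Cod I \<sigma>)) (Cod I \<sigma>) k s t \<cdot> bot_of (AM u \<sigma>) =
      unit_fill R (OM u (Dom I \<sigma>)) (Dom I \<sigma>) k (s \<cdot> top_of (AM u \<sigma>)) (t \<cdot> bot_of (AM u \<sigma>))"
    using right_maps_nat[OF k[unfolded kf R_def] \<sigma>, of s t] k q square_comp[OF sq(2), of s t f]
    by (simp add: unit_fill_def kf)
qed

text \<open>The generator \<open>u\<^sub>i\<close> is a left map, and the base change of \<open>h\<close> along \<open>b\<close> is a right map with the
same codomain. Pulling the former back along the latter gives a left map by assumption, and
\<open>qarr_retract\<close> moves its structure to the pullback taken over the codomain of \<open>b\<close>.\<close>

proposition frob_imp_gen_frob:
  fixes I u
  defines "R \<equiv> right_maps E I u"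
  defines "L \<equiv> left_maps E R forget"
  assumes u: "is_functor I (arrow_cat E) u" and \<chi>: "frob_choice L forget R forget L \<chi>"
  shows "\<exists>\<chi>'. gen_frob_choice I u R forget L \<chi>'"
proof -
  note sR = structured_right_maps[of I u, folded R_def]
  note sL = structured_left_maps[of R forget, folded L_def]
  have fR: "is_functor R (arrow_cat E) forget"
    by (rule structured_functor[OF category_E sR])
  define gg where "gg i b h \<phi> = \<chi> (OM u i, unit_fill R (OM u i) i) (pB h b, base_change I u h \<phi> b)" for i b h \<phi>
  define \<chi>' where "\<chi>' i b = (\<lambda>(h, \<phi>). retract_fill R forget (qarr (OM u i) b h) (gg i b h \<phi>)
     (pair (b \<cdot> OM u i) h (pA (OM u i) (pB h b)) (pA h b \<cdot> pB (OM u i) (pB h b))) (pair b h (pB h b) (pA h b))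
     (pair h b (pB b h) (pA b h)))" for i b
  have uob: "arr (OM u i)" if "i \<in> Ob I" for i using is_functorD(3)[OF u that] by simp
  have "gen_frob_choice I u R forget L \<chi>'"
    unfolding gen_frob_choice_def
  proof (intro conjI ballI allI impI)
    fix i j b assume i: "i \<in> Ob I" and j: "j \<in> Ob R" and b: "arr b" "dom b = cod (OM u i)" "cod b = cod (OM forget j)"
    obtain h \<phi> where h: "j = (h, \<phi>)" by (cases j)
    have h': "arr h" "cod b = cod h" using structured_Ob[OF sR j] b by (simp_all add: h)
    then have c: "cospan h b" using b by (simp add: cospan_def)
    have "(OM u i, unit_fill R (OM u i) i) \<in> Ob L"
      using unit_fill_Ob[OF u i] by (simp add: L_def R_def)
    moreover have "(pB h b, base_change I u h \<phi> b) \<in> Ob R"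
      using base_change_Ob[OF u _ c] j by (simp add: R_def h)
    ultimately have "(pB (OM u i) (pB h b), gg i b h \<phi>) \<in> Ob L"
      using \<chi>[unfolded frob_choice_def, THEN conjunct1, rule_format, of "(OM u i, unit_fill R (OM u i) i)" "(pB h b, base_change I u h \<phi> b)"] c b
      by (simp add: gg_def)
    from left_maps_retract_Ob[OF this[unfolded L_def] qarr_retract(1)[OF uob[OF i] b(1,2) h'] fR]
    show "(qarr (OM u i) b (OM forget j), \<chi>' i b j) \<in> Ob L"
      by (simp add: L_def \<chi>'_def h)
  next
    fix \<sigma> \<tau> b b' assume \<sigma>: "\<sigma> \<in> Ar I" and \<tau>: "\<tau> \<in> Ar R"
      and b: "arr b" "dom b = cod (OM u (Dom I \<sigma>))" "cod b = cod (OM forget (Dom R \<tau>))"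
      and b': "arr b'" "dom b' = cod (OM u (Cod I \<sigma>))" "cod b' = cod (OM forget (Cod R \<tau>))"
      and e: "b' \<cdot> bot_of (AM u \<sigma>) = bot_of (AM forget \<tau>) \<cdot> b"
    obtain h \<phi> y x h' \<phi>' where \<tau>e: "\<tau> = ((h, \<phi>), (h, (y, x), h'), (h', \<phi>'))" "(h, \<phi>) \<in> Ob R" "(h', \<phi>') \<in> Ob R" and yx: "square E h h' y x"
      using structured_ArE[OF sR \<tau>] by metis
    note rs = structured_simps[OF sR]
    let ?i = "Dom I \<sigma>" and ?i' = "Cod I \<sigma>"
    obtain s t where st: "AM u \<sigma> = (OM u ?i, (s, t), OM u ?i')" using functor_square(1)[OF u \<sigma>] by metis
    have sq: "square E (OM u ?i) (OM u ?i') s t"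
      using is_functorD(4)[OF u \<sigma>] by (simp add: st)
    have I: "?i \<in> Ob I" "?i' \<in> Ob I"
      using is_functorD(1)[OF u] \<sigma> by (auto simp: category_def)
    have bh: "cod b = cod h" "cod b' = cod h'" and hh: "arr h" "arr h'" and e': "b' \<cdot> t = x \<cdot> b"
      using b b' e yx by (simp_all add: \<tau>e rs st square_iff)
    have c: "cospan_map h b h' b' y t"
      unfolding cospan_map_def cospan_def using yx sq b b' bh e' unfolding square_iff by (intro conjI exI[of _ x]) simp_all
    have bc: "((pB h b, base_change I u h \<phi> b), (pB h b, (pm h b h' b' y t, t), pB h' b'),
      (pB h' b', base_change I u h' \<phi>' b')) \<in> Ar R"
      using base_change_mor[OF u _ c e'] \<tau> by (simp add: R_def \<tau>e)
    have un: "((OM u ?i, unit_fill R (OM u ?i) ?i), AM u \<sigma>, (OM u ?i', unit_fill R (OM u ?i') ?i')) \<in> Ar L"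
      using unit_fill_Ar[OF u \<sigma>] by (simp add: L_def R_def)
    have "((pB (OM u ?i) (pB h b), gg ?i b h \<phi>),
       (pB (OM u ?i) (pB h b), (pm (OM u ?i) (pB h b) (OM u ?i') (pB h' b') s (pm h b h' b' y t), pm h b h' b' y t), pB (OM u ?i') (pB h' b')),
       (pB (OM u ?i') (pB h' b'), gg ?i' b' h' \<phi>')) \<in> Ar L"
      using \<chi>[unfolded frob_choice_def, THEN conjunct2, rule_format, OF un bc]
      by (simp add: gg_def rs structured_simps[OF sL] st)
    from left_maps_retract_Ar[OF this[unfolded L_def] qarr_retract(1)[OF uob[OF I(1)] b(1,2) hh(1) bh(1)] qarr_retract(1)[OF uob[OF I(2)] b'(1,2) hh(2) bh(2)] fR]
      qarr_retract_natural[OF uob[OF I(1)] b(1,2) hh(1) bh(1) uob[OF I(2)] b'(1,2) hh(2) bh(2) sq yx e']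
    show "gen_frob_mor I u R forget \<chi>' \<sigma> \<tau> b b' \<in> Ar L"
      by (simp add: \<tau>e rs st L_def \<chi>'_def)
  qed
  then show ?thesis by blast
qed

end

section \<open>From the generalized Frobenius condition to the Frobenius condition\<close>

locale lcc_cat = pb_cat E pb for E :: "('o, 'a) cat" and pb +
  assumes right_adjoints: "h \<in> Ar E \<Longrightarrow> has_right_adjoint (slice E (Cod E h)) (slice E (Dom E h)) (pullback_func E pb h)"
begin

definition pushforward :: "'a \<Rightarrow> 'a \<Rightarrow> 'a \<times> 'a" where
  "pushforward h z = (SOME p. is_pushforward h z (fst p) (snd p))"

lemma pushforward:
  assumes "arr h" "arr z" "cod z = dom h"
  shows "is_pushforward h z (fst (pushforward h z)) (snd (pushforward h z))"
proof -
  obtain m ev where "is_pushforward h z m ev"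
    using pushforward_exists[OF right_adjoints assms] assms(1) by blast
  then have "\<exists>p. is_pushforward h z (fst p) (snd p)" by auto
  then show ?thesis unfolding pushforward_def by (rule someI_ex)
qed

text \<open>The pushforward along \<open>h\<close> of \<open>t\<^sup>*(k)\<close>. By the universal properties of pushforward and pullback, its
sections over \<open>a\<close> are the maps \<open>c : h\<^sup>*(a) \<rightarrow> dom k\<close> with \<open>k c = t h\<^sup>*(a)\<close>. The functions \<open>up\<close>
and \<open>down\<close> below are the two directions of this correspondence, in which the counit no longer appears.\<close>

definition lifts :: "'a \<Rightarrow> 'a \<Rightarrow> 'a \<Rightarrow> 'a" where
  "lifts h k t = fst (pushforward h (pB k t))"

definition up :: "'a \<Rightarrow> 'a \<Rightarrow> 'a \<Rightarrow> 'a \<Rightarrow> 'a" where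
  "up h k t r = pA k t \<cdot> snd (pushforward h (pB k t)) \<cdot> pm (lifts h k t \<cdot> r) h (lifts h k t) h r (ide (dom h))"

definition down :: "'a \<Rightarrow> 'a \<Rightarrow> 'a \<Rightarrow> 'a \<Rightarrow> 'a \<Rightarrow> 'a" where
  "down h k t a c = (THE r. over_transpose h (pB k t) (lifts h k t) (snd (pushforward h (pB k t))) a (pair k t c (pB a h)) r)"

context
  fixes h k t
  assumes h: "arr h" and kt: "cospan k t" and t: "dom t = dom h"
begin

lemma lifts_pushforward: "is_pushforward h (pB k t) (lifts h k t) (snd (pushforward h (pB k t)))"
  unfolding lifts_def by (rule pushforward) (use h kt t in simp_all)

lemma lifts_arr: "arr (lifts h k t)" "cod (lifts h k t) = cod h"
  using lifts_pushforward by (auto simp: is_pushforward_def)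

lemma lifts_cospan_map:
  assumes "arr r" "cod r = dom (lifts h k t)"
  shows "cospan_map (lifts h k t \<cdot> r) h (lifts h k t) h r (ide (dom h))"
  using assms h lifts_arr unfolding cospan_map_def cospan_def by (auto intro!: exI[of _ "ide (cod h)"])

lemma ev_props:
  "arr (snd (pushforward h (pB k t)))" "dom (snd (pushforward h (pB k t))) = PB (lifts h k t) h"
  "cod (snd (pushforward h (pB k t))) = PB k t" "pB k t \<cdot> snd (pushforward h (pB k t)) = pB (lifts h k t) h"
  using lifts_pushforward kt by (auto simp: is_pushforward_def)

lemma up_props:
  assumes "arr r" "cod r = dom (lifts h k t)"
  shows "arr (up h k t r)" "dom (up h k t r) = PB (lifts h k t \<cdot> r) h" "cod (up h k t r) = dom k"
    "k \<cdot> up h k t r = t \<cdot> pB (lifts h k t \<cdot> r) h"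
    "pB k t \<cdot> snd (pushforward h (pB k t)) \<cdot> pm (lifts h k t \<cdot> r) h (lifts h k t) h r (ide (dom h)) = pB (lifts h k t \<cdot> r) h"
proof -
  let ?ev = "snd (pushforward h (pB k t))" and ?pm = "pm (lifts h k t \<cdot> r) h (lifts h k t) h r (ide (dom h))"
  note c = lifts_cospan_map[OF assms] and ev = ev_props
  note c' = cospan_mapD[OF c]
  show "arr (up h k t r)" "dom (up h k t r) = PB (lifts h k t \<cdot> r) h" "cod (up h k t r) = dom k"
    using c ev kt by (simp_all add: up_def)
  have "pB k t \<cdot> ?ev \<cdot> ?pm = pB (lifts h k t) h \<cdot> ?pm"
    using c ev kt by (intro comp_eq_extend) simp_all
  then show 1: "pB k t \<cdot> ?ev \<cdot> ?pm = pB (lifts h k t \<cdot> r) h"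
    using c c' h by simp
  have "k \<cdot> up h k t r = t \<cdot> pB k t \<cdot> ?ev \<cdot> ?pm"
    unfolding up_def using c ev kt by (intro pb_commutes_extend) simp_all
  then show "k \<cdot> up h k t r = t \<cdot> pB (lifts h k t \<cdot> r) h"
    using 1 by simp
qed

lemma up_eqI:
  assumes "arr r" "cod r = dom (lifts h k t)" "arr r'" "cod r' = dom (lifts h k t)"
    "lifts h k t \<cdot> r = a" "lifts h k t \<cdot> r' = a" "up h k t r = up h k t r'"
  shows "r = r'"
proof -
  let ?ev = "snd (pushforward h (pB k t))" and ?M = "lifts h k t"
  let ?p = "\<lambda>r. ?ev \<cdot> pm a h ?M h r (ide (dom h))"
  note c = lifts_cospan_map[OF assms(1,2), unfolded assms(5)] lifts_cospan_map[OF assms(3,4), unfolded assms(6)]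
  note u = up_props[OF assms(1,2), unfolded up_def assms(5)] up_props[OF assms(3,4), unfolded up_def assms(6)]
  have a: "arr a" "cod a = cod h" "dom r = dom a" "dom r' = dom a"
    using assms lifts_arr cod_comp[of r ?M] dom_comp[of r ?M] comp_arr[of r ?M] dom_comp[of r' ?M] by auto
  have p: "?p r = ?p r'"
  proof (rule pb_eqI[OF kt])
    show "pA k t \<cdot> ?p r = pA k t \<cdot> ?p r'"
      using assms(7) unfolding up_def assms(5,6) .
  qed (use c u ev_props in simp_all)
  have "over_transpose h (pB k t) ?M ?ev a (?p r) r" "over_transpose h (pB k t) ?M ?ev a (?p r) r'"
    using assms a p by (simp_all add: over_transpose_def)
  moreover have "\<exists>!r'. over_transpose h (pB k t) ?M ?ev a (?p r) r'"
    using lifts_pushforward[unfolded is_pushforward_def, THEN conjunct2, THEN conjunct2, THEN conjunct2, THEN conjunct2, THEN conjunct2, THEN conjunct2,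
        rule_format, OF a(1,2), of "?p r"] c u ev_props kt by simp
  ultimately show ?thesis by blast
qed

lemma down_props:
  assumes a: "arr a" "cod a = cod h" and c: "arr c" "dom c = PB a h" "cod c = dom k" "k \<cdot> c = t \<cdot> pB a h"
  shows "arr (down h k t a c)" "dom (down h k t a c) = dom a" "cod (down h k t a c) = dom (lifts h k t)"
    "lifts h k t \<cdot> down h k t a c = a" "up h k t (down h k t a c) = c"
proof -
  have cs: "cospan a h" using a h by (simp add: cospan_def)
  have cn: "cone k t c (pB a h)" using c kt cs t by (simp add: cone_def)
  have "\<exists>!r. over_transpose h (pB k t) (lifts h k t) (snd (pushforward h (pB k t))) a (pair k t c (pB a h)) r"
    using lifts_pushforward[unfolded is_pushforward_def, THEN conjunct2, THEN conjunct2, THEN conjunct2, THEN conjunct2, THEN conjunct2, THEN conjunct2,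
        rule_format, OF a, of "pair k t c (pB a h)"] cn cs kt by simp
  from theI'[OF this] have "over_transpose h (pB k t) (lifts h k t) (snd (pushforward h (pB k t))) a (pair k t c (pB a h)) (down h k t a c)"
    unfolding down_def .
  then show "arr (down h k t a c)" "dom (down h k t a c) = dom a" "cod (down h k t a c) = dom (lifts h k t)"
    "lifts h k t \<cdot> down h k t a c = a" "up h k t (down h k t a c) = c"
    using cn by (simp_all add: over_transpose_def up_def)
qed

text \<open>Naturality of transposition in a form that allows \<open>h\<close> to change along with \<open>a\<close>; \<open>up_comp\<close> is the case of
a fixed \<open>h\<close>.\<close>

lemma up_pm:
  assumes r: "arr r" "cod r = dom (lifts h k t)" and c: "cospan_map a h2 (lifts h k t \<cdot> r) h g y"
  shows "cospan_map a h2 (lifts h k t \<cdot> r \<cdot> g) h (ide (dom a)) y"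
    and "up h k t r \<cdot> pm a h2 (lifts h k t \<cdot> r) h g y =
         up h k t (r \<cdot> g) \<cdot> pm a h2 (lifts h k t \<cdot> r \<cdot> g) h (ide (dom a)) y"
proof -
  let ?M = "lifts h k t"
  note c' = cospan_mapD[OF c]
  have g: "arr (r \<cdot> g)" "cod (r \<cdot> g) = dom ?M" "dom g = dom a" "arr g" "cod g = dom r"
    using r c' lifts_arr by simp_all
  note m0 = lifts_cospan_map[OF r] and m1 = lifts_cospan_map[OF g(1,2)]
  show m2: "cospan_map a h2 (?M \<cdot> r \<cdot> g) h (ide (dom a)) y"
    using c r lifts_arr g c' unfolding cospan_map_def by (auto simp: cospan_def)
  have "pm (?M \<cdot> r) h ?M h r (ide (dom h)) \<cdot> pm a h2 (?M \<cdot> r) h g y = pm a h2 ?M h (r \<cdot> g) y"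
    using pm_comp[OF c m0] c' by simp
  moreover have "pm (?M \<cdot> r \<cdot> g) h ?M h (r \<cdot> g) (ide (dom h)) \<cdot> pm a h2 (?M \<cdot> r \<cdot> g) h (ide (dom a)) y = pm a h2 ?M h (r \<cdot> g) y"
    using pm_comp[OF m2 m1] c' g r by simp
  ultimately show "up h k t r \<cdot> pm a h2 (?M \<cdot> r) h g y = up h k t (r \<cdot> g) \<cdot> pm a h2 (?M \<cdot> r \<cdot> g) h (ide (dom a)) y"
    using m0 m1 m2 c ev_props kt by (simp add: up_def)
qed

lemma up_comp:
  assumes r: "arr r" "cod r = dom (lifts h k t)" and g: "arr g" "cod g = dom r"
  shows "up h k t (r \<cdot> g) = up h k t r \<cdot> pm (lifts h k t \<cdot> r \<cdot> g) h (lifts h k t \<cdot> r) h g (ide (dom h))"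
    and "cospan_map (lifts h k t \<cdot> r \<cdot> g) h (lifts h k t \<cdot> r) h g (ide (dom h))"
proof -
  let ?M = "lifts h k t" and ?a = "lifts h k t \<cdot> r \<cdot> g"
  show c: "cospan_map ?a h (?M \<cdot> r) h g (ide (dom h))"
    using r g h lifts_arr unfolding cospan_map_def cospan_def by (auto intro!: exI[of _ "ide (cod h)"])
  have "arr (r \<cdot> g)" "cod (r \<cdot> g) = dom ?M" using r g by simp_all
  note u = up_props[OF this]
  have "pm ?a h ?a h (ide (dom ?a)) (ide (dom h)) = ide (PB ?a h)"
    by (rule pm_ide[OF cospan_mapD(1)[OF c]])
  then show "up h k t (r \<cdot> g) = up h k t r \<cdot> pm ?a h (?M \<cdot> r) h g (ide (dom h))"
    using up_pm(2)[OF r c] u by simp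
qed

end

end

locale gen_frob = lcc_cat E pb for E :: "('o, 'a) cat" and pb +
  fixes I :: "('i, 's) cat" and u :: "('i, 's, 'a, 'a sq) func" and \<chi>
  assumes u: "is_functor I (arrow_cat E) u"
    and \<chi>: "gen_frob_choice I u (right_maps E I u) forget (left_maps E (right_maps E I u) forget) \<chi>"
begin

abbreviation "R \<equiv> right_maps E I u"
abbreviation "L \<equiv> left_maps E R forget"

lemmas sR = structured_right_maps[of I u]
lemmas sL = structured_left_maps[of R forget]
lemmas R_simps = structured_simps[OF structured_right_maps[of I u]]
lemmas L_simps = structured_simps[OF structured_left_maps[of R forget]]

lemma uob: "i \<in> Ob I \<Longrightarrow> arr (OM u i)"
  using is_functorD(3)[OF u] by simp

lemma \<chi>_Ob: "i \<in> Ob I \<Longrightarrow> (h, \<phi>) \<in> Ob R \<Longrightarrow> arr q \<Longrightarrow> dom q = cod (OM u i) \<Longrightarrow> cod q = cod h \<Longrightarrow>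
    (qarr (OM u i) q h, \<chi> i q (h, \<phi>)) \<in> Ob L"
  using \<chi> unfolding gen_frob_choice_def by fastforce

text \<open>Transposing a lifting problem of \<open>u\<^sub>i\<close> against \<open>lifts h k t\<close> gives a lifting problem of \<open>h\<^sup>*(u\<^sub>i)\<close>
against \<open>k\<close>. The latter is solved by the given choice of left structures, and the solution is
transposed back. This makes \<open>lifts h k t\<close> a right map.\<close>

definition push_fill where
  "push_fill h \<phi> k \<kappa> t = (\<lambda>i p q. if i \<in> Ob I \<and> square E (OM u i) (lifts h k t) p q
     then down h k t q (\<chi> i q (h, \<phi>) (k, \<kappa>) (up h k t p) (t \<cdot> pB q h)) else undefined)"

context
  fixes h \<phi> k \<kappa> t
  assumes hO: "(h, \<phi>) \<in> Ob R" and kO: "(k, \<kappa>) \<in> Ob R" and kt: "cospan k t" and t: "dom t = dom h"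
begin

lemma h_arr: "arr h"
  using structured_Ob[OF sR hO] by simp

lemmas M = lifts_arr[OF h_arr kt t]

lemma push_fill_square:
  assumes i: "i \<in> Ob I" and sq: "square E (OM u i) (lifts h k t) p q"
  shows "square E (qarr (OM u i) q h) k (up h k t p) (t \<cdot> pB q h)"
proof -
  note s = sq[unfolded square_iff]
  have p: "arr p" "cod p = dom (lifts h k t)" using s by simp_all
  note up = up_props[OF h_arr kt t p]
  have q: "arr q" "dom q = cod (OM u i)" "cod q = cod h" using s M by simp_all
  note qa = qarr_props[OF uob[OF i] q(1,2) h_arr q(3)]
  have e: "lifts h k t \<cdot> p = q \<cdot> OM u i" using s by simp
  have c: "cospan q h" using q h_arr by (simp add: cospan_def)
  show ?thesis
    using up qa e c kt t cospan_arr[OF kt] by (simp add: square_iff)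
qed

lemma push_fill_props:
  assumes i: "i \<in> Ob I" and sq: "square E (OM u i) (lifts h k t) p q"
  defines "r \<equiv> push_fill h \<phi> k \<kappa> t i p q"
  shows "arr r" "dom r = dom q" "cod r = dom (lifts h k t)" "lifts h k t \<cdot> r = q"
    and "up h k t r = \<chi> i q (h, \<phi>) (k, \<kappa>) (up h k t p) (t \<cdot> pB q h)" and "r \<cdot> OM u i = p"
proof -
  note s = sq[unfolded square_iff]
  note sq2 = push_fill_square[OF i sq]
  have q: "arr q" "dom q = cod (OM u i)" "cod q = cod h" using s M by simp_all
  note qa = qarr_props[OF uob[OF i] q(1,2) h_arr q(3)]
  have c: "cospan q h" using q h_arr by (simp add: cospan_def)
  note f = left_filler[OF \<chi>_Ob[OF i hO q] kO, of "up h k t p" "t \<cdot> pB q h", simplified, OF sq2]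
  have r: "r = down h k t q (\<chi> i q (h, \<phi>) (k, \<kappa>) (up h k t p) (t \<cdot> pB q h))"
    using i sq by (simp add: r_def push_fill_def)
  note d = down_props[OF h_arr kt t q(1,3), of "\<chi> i q (h, \<phi>) (k, \<kappa>) (up h k t p) (t \<cdot> pB q h)", folded r]
  show "arr r" "dom r = dom q" "cod r = dom (lifts h k t)" "lifts h k t \<cdot> r = q"
    and up: "up h k t r = \<chi> i q (h, \<phi>) (k, \<kappa>) (up h k t p) (t \<cdot> pB q h)"
    using d f qa by simp_all
  note r' = this
  show "r \<cdot> OM u i = p"
  proof (rule up_eqI[OF h_arr kt t])
    show "lifts h k t \<cdot> r \<cdot> OM u i = q \<cdot> OM u i"
      using r' q uob[OF i] M by (intro comp_eq_extend) simp_all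
    show "lifts h k t \<cdot> p = q \<cdot> OM u i" using s by simp
    show "up h k t (r \<cdot> OM u i) = up h k t p"
      using up_comp(1)[OF h_arr kt t r'(1,3) uob[OF i]] r' q f(4) \<open>lifts h k t \<cdot> r \<cdot> OM u i = q \<cdot> OM u i\<close>
      by (simp add: qarr_def)
  qed (use r' s q in simp_all)
qed

text \<open>Maps into \<open>lifts h k t\<close> agree if their transposes do, and for the transposes naturality in \<open>i\<close> is the
naturality of the choice \<open>\<chi>\<close> in its first variable.\<close>

lemma push_fill_Ob: "(lifts h k t, push_fill h \<phi> k \<kappa> t) \<in> Ob R"
  unfolding right_maps_Ob
proof (intro conjI allI ballI impI)
  show "arr (lifts h k t)" by (rule M)
  show "if i \<in> Ob I \<and> square E (OM u i) (lifts h k t) p q then filler E (OM u i) (lifts h k t) p q (push_fill h \<phi> k \<kappa> t i p q)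
     else push_fill h \<phi> k \<kappa> t i p q = undefined" for i p q
  proof (cases "i \<in> Ob I \<and> square E (OM u i) (lifts h k t) p q")
    case True
    then show ?thesis
      using push_fill_props[of i p q] by (simp add: filler_def square_iff)
  qed (auto simp: push_fill_def)
  fix \<sigma> p q assume \<sigma>: "\<sigma> \<in> Ar I" and sq: "square E (OM u (Cod I \<sigma>)) (lifts h k t) p q"
  obtain a b where ab: "AM u \<sigma> = (OM u (Dom I \<sigma>), (a, b), OM u (Cod I \<sigma>))" using functor_square(1)[OF u \<sigma>] by metis
  have sab: "square E (OM u (Dom I \<sigma>)) (OM u (Cod I \<sigma>)) a b"
    using is_functorD(4)[OF u \<sigma>] by (simp add: ab)
  have i: "Dom I \<sigma> \<in> Ob I" "Cod I \<sigma> \<in> Ob I"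
    using is_functorD(1)[OF u] \<sigma> by (auto simp: category_def)
  note s = sq[unfolded square_iff] and s2 = sab[unfolded square_iff]
  note sq2 = square_comp[OF sab sq]
  note r = push_fill_props[OF i(2) sq] and r2 = push_fill_props[OF i(1) sq2]
  have q: "arr q" "dom q = cod (OM u (Cod I \<sigma>))" "cod q = cod h" using s M by simp_all
  have qb: "arr (q \<cdot> b)" "dom (q \<cdot> b) = cod (OM u (Dom I \<sigma>))" "cod (q \<cdot> b) = cod h" using q s2 by simp_all
  have p: "arr p" "cod p = dom (lifts h k t)" "arr a" "cod a = dom p" using s s2 by simp_all
  have e: "lifts h k t \<cdot> p = q \<cdot> OM u (Cod I \<sigma>)" "lifts h k t \<cdot> p \<cdot> a = (q \<cdot> b) \<cdot> OM u (Dom I \<sigma>)"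
    using s sq2[unfolded square_iff] by simp_all
  have id: "((h, \<phi>), (h, (ide (dom h), ide (cod h)), h), (h, \<phi>)) \<in> Ar R"
    using structured_right_maps[of I u] hO h_arr by (auto simp: structured_def category_def R_simps)
  have mor: "((qarr (OM u (Dom I \<sigma>)) (q \<cdot> b) h, \<chi> (Dom I \<sigma>) (q \<cdot> b) (h, \<phi>)),
      (qarr (OM u (Dom I \<sigma>)) (q \<cdot> b) h, (pm ((q \<cdot> b) \<cdot> OM u (Dom I \<sigma>)) h (q \<cdot> OM u (Cod I \<sigma>)) h a (ide (dom h)),
        pm (q \<cdot> b) h q h b (ide (dom h))), qarr (OM u (Cod I \<sigma>)) q h),
      (qarr (OM u (Cod I \<sigma>)) q h, \<chi> (Cod I \<sigma>) q (h, \<phi>))) \<in> Ar L"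
    using \<chi>[unfolded gen_frob_choice_def, THEN conjunct2, rule_format, OF \<sigma> id, of "q \<cdot> b" q] q qb
    by (simp add: R_simps ab)
  have c: "cospan q h" "cospan (q \<cdot> b) h" using q qb h_arr by (simp_all add: cospan_def)
  have cm: "cospan_map (q \<cdot> b) h q h b (ide (dom h))"
    using c q s2 h_arr unfolding cospan_map_def by (auto intro!: exI[of _ "ide (cod h)"])
  have "\<chi> (Cod I \<sigma>) q (h, \<phi>) (k, \<kappa>) (up h k t p) (t \<cdot> pB q h) \<cdot> pm (q \<cdot> b) h q h b (ide (dom h)) =
      \<chi> (Dom I \<sigma>) (q \<cdot> b) (h, \<phi>) (k, \<kappa>) (up h k t p \<cdot> pm ((q \<cdot> b) \<cdot> OM u (Dom I \<sigma>)) h (q \<cdot> OM u (Cod I \<sigma>)) h a (ide (dom h)))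
        ((t \<cdot> pB q h) \<cdot> pm (q \<cdot> b) h q h b (ide (dom h)))"
    by (rule left_maps_mor[OF mor kO]) (use push_fill_square[OF i(2) sq] in simp)
  also have "up h k t p \<cdot> pm ((q \<cdot> b) \<cdot> OM u (Dom I \<sigma>)) h (q \<cdot> OM u (Cod I \<sigma>)) h a (ide (dom h)) = up h k t (p \<cdot> a)"
    using up_comp(1)[OF h_arr kt t p] unfolding e by simp
  also have "(t \<cdot> pB q h) \<cdot> pm (q \<cdot> b) h q h b (ide (dom h)) = t \<cdot> pB (q \<cdot> b) h"
    using cm c t cospan_arr[OF kt] by simp
  finally have main: "\<chi> (Cod I \<sigma>) q (h, \<phi>) (k, \<kappa>) (up h k t p) (t \<cdot> pB q h) \<cdot> pm (q \<cdot> b) h q h b (ide (dom h)) =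
     \<chi> (Dom I \<sigma>) (q \<cdot> b) (h, \<phi>) (k, \<kappa>) (up h k t (p \<cdot> a)) (t \<cdot> pB (q \<cdot> b) h)" .
  have rb: "lifts h k t \<cdot> push_fill h \<phi> k \<kappa> t (Cod I \<sigma>) p q \<cdot> b = q \<cdot> b"
    using r s s2 M by (intro comp_eq_extend) simp_all
  have "push_fill h \<phi> k \<kappa> t (Cod I \<sigma>) p q \<cdot> b = push_fill h \<phi> k \<kappa> t (Dom I \<sigma>) (p \<cdot> a) (q \<cdot> b)"
  proof (rule up_eqI[OF h_arr kt t])
    show "up h k t (push_fill h \<phi> k \<kappa> t (Cod I \<sigma>) p q \<cdot> b) = up h k t (push_fill h \<phi> k \<kappa> t (Dom I \<sigma>) (p \<cdot> a) (q \<cdot> b))"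
      using up_comp(1)[OF h_arr kt t r(1,3), of b] r r2 rb main s s2 by simp
  qed (use r r2 rb s s2 in simp_all)
  then show "push_fill h \<phi> k \<kappa> t (Cod I \<sigma>) p q \<cdot> bot_of (AM u \<sigma>) =
     push_fill h \<phi> k \<kappa> t (Dom I \<sigma>) (p \<cdot> top_of (AM u \<sigma>)) (q \<cdot> bot_of (AM u \<sigma>))"
    by (simp add: ab)
qed

end

end

lemma structured_ide_Ar:
  assumes K: "structured E K" and X: "(f, \<phi>) \<in> Ob K"
  shows "((f, \<phi>), (f, (Ide E (Dom E f), Ide E (Cod E f)), f), (f, \<phi>)) \<in> Ar K"
proof -
  have "category K" using K by (simp add: structured_def)
  then have "Ide K (f, \<phi>) \<in> Ar K" using X by (auto simp: category_def)
  then show ?thesis by (simp add: structured_simps[OF K])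
qed

context gen_frob begin

text \<open>A problem \<open>(s, t) : h\<^sup>*(f) \<rightarrow> k\<close> transposes to a problem of \<open>f\<close> against the right map \<open>lifts h k t\<close>
with the identity at the bottom, so the left structure \<open>l\<close> of \<open>f\<close> gives a section of that right map.
Its transpose is defined on the pullback of an identity along \<open>h\<close>, and the final pairing is the
isomorphism of \<open>dom h\<close> with that pullback.\<close>

definition frob_fill where
  "frob_fill f l h \<phi> = (\<lambda>k s t. if k \<in> Ob R \<and> square E (pB f h) (fst k) s t
     then up h (fst k) t (l (lifts h (fst k) t, push_fill h \<phi> (fst k) (snd k) t) (down h (fst k) t f s) (ide (cod h)))
       \<cdot> pair (ide (cod h)) h h (ide (dom h)) else undefined)"

lemma frob_fill_parts:
  assumes f: "(f, l) \<in> Ob L" and h: "(h, \<phi>) \<in> Ob R" and fh: "cod f = cod h"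
    and k: "(k, \<kappa>) \<in> Ob R" and sq: "square E (pB f h) k s t"
  defines "d \<equiv> down h k t f s"
  defines "r \<equiv> l (lifts h k t, push_fill h \<phi> k \<kappa> t) d (ide (cod h))"
  shows "cospan k t" "dom t = dom h"
    and "arr d" "dom d = dom f" "cod d = dom (lifts h k t)" "lifts h k t \<cdot> d = f" "up h k t d = s"
    and "square E f (lifts h k t) d (ide (cod h))"
    and "arr r" "dom r = cod h" "cod r = dom (lifts h k t)" "r \<cdot> f = d" "lifts h k t \<cdot> r = ide (cod h)"
    and "frob_fill f l h \<phi> (k, \<kappa>) s t = up h k t r \<cdot> pair (ide (cod h)) h h (ide (dom h))"
    and "cone (ide (cod h)) h h (ide (dom h))"
proof -
  have fa: "arr f" "arr h" using structured_Ob[OF sL f] structured_Ob[OF sR h] by simp_all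
  have c: "cospan f h" using fa fh by (simp add: cospan_def)
  note s = sq[unfolded square_iff]
  show kt: "cospan k t" and t: "dom t = dom h" using s c by (simp_all add: cospan_def)
  have M: "arr (lifts h k t)" "cod (lifts h k t) = cod h" by (rule lifts_arr[OF fa(2) kt t])+
  show d: "arr d" "dom d = dom f" "cod d = dom (lifts h k t)" "lifts h k t \<cdot> d = f" "up h k t d = s"
    using down_props[OF fa(2) kt t fa(1) fh, of s] s c unfolding d_def by simp_all
  show sq2: "square E f (lifts h k t) d (ide (cod h))"
    using d fa fh M by (simp add: square_iff)
  have MO: "(lifts h k t, push_fill h \<phi> k \<kappa> t) \<in> Ob R"
    by (rule push_fill_Ob[OF h k kt t])
  have "square E f (OM forget (lifts h k t, push_fill h \<phi> k \<kappa> t)) d (ide (cod h))" using sq2 by simp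
  note r = left_filler[OF f MO this, folded r_def]
  show "arr r" "dom r = cod h" "cod r = dom (lifts h k t)" "r \<cdot> f = d" "lifts h k t \<cdot> r = ide (cod h)"
    using r fh by simp_all
  show "frob_fill f l h \<phi> (k, \<kappa>) s t = up h k t r \<cdot> pair (ide (cod h)) h h (ide (dom h))"
    using k sq by (simp add: frob_fill_def r_def d_def)
  show "cone (ide (cod h)) h h (ide (dom h))"
    using fa by (simp add: cone_def cospan_def)
qed

lemma frob_fill_filler:
  assumes f: "(f, l) \<in> Ob L" and h: "(h, \<phi>) \<in> Ob R" and fh: "cod f = cod h"
    and k: "(k, \<kappa>) \<in> Ob R" and sq: "square E (pB f h) k s t"
  shows "filler E (pB f h) k s t (frob_fill f l h \<phi> (k, \<kappa>) s t)"
proof -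
  note p = frob_fill_parts[OF assms]
  let ?r = "l (lifts h k t, push_fill h \<phi> k \<kappa> t) (down h k t f s) (ide (cod h))"
  have fa: "arr f" "arr h" using structured_Ob[OF sL f] structured_Ob[OF sR h] by simp_all
  have c: "cospan f h" using fa fh by (simp add: cospan_def)
  note up = up_props[OF fa(2) p(1,2,9,11)] and cc = cospan_arr[OF p(1)]
  have ci: "cospan (ide (cod h)) h" using fa by (simp add: cospan_def)
  have 1: "k \<cdot> up h k t ?r \<cdot> pair (ide (cod h)) h h (ide (dom h)) = t"
  proof -
    have "k \<cdot> up h k t ?r \<cdot> pair (ide (cod h)) h h (ide (dom h)) = (t \<cdot> pB (ide (cod h)) h) \<cdot> pair (ide (cod h)) h h (ide (dom h))"
      using up p(13,15) cc fa by (intro comp_eq_extend) simp_all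
    then show ?thesis
      using p(2,15) cc fa ci by simp
  qed
  have cm: "cospan_map f h (ide (cod h)) h f (ide (dom h))"
    using up_comp(2)[OF fa(2) p(1,2,9,11) fa(1)] p fh by simp
  have "pair (ide (cod h)) h h (ide (dom h)) \<cdot> pB f h = pm f h (ide (cod h)) h f (ide (dom h))"
    by (rule pb_eqI[OF ci]) (use p(15) cm c fa pb_commutes[OF c] in simp_all)
  then have "up h k t ?r \<cdot> pair (ide (cod h)) h h (ide (dom h)) \<cdot> pB f h = s"
    using up_comp(1)[OF fa(2) p(1,2,9,11) fa(1)] p fh by simp
  then have 2: "(up h k t ?r \<cdot> pair (ide (cod h)) h h (ide (dom h))) \<cdot> pB f h = s"
    using up p(13,15) c fa by simp
  show ?thesis
    unfolding filler_def p(14) using 1 2 up p(13,15) c fa by simp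
qed

text \<open>Naturality in \<open>k\<close> and in \<open>(f, h)\<close> at once. The right maps \<open>lifts h k t\<close> and \<open>lifts h' k' t'\<close> live
over different objects, and there is no evident map between them. They are compared through
the base change \<open>N\<close> of the second along \<open>x\<close>: the projection \<open>n\<close> and a map \<open>e\<close> obtained by
transposition are both morphisms of right maps out of \<open>N\<close>, and the fillers chosen for \<open>f\<close> respect both.\<close>

lemma frob_fill_natural:
  assumes fm: "((f, l), (f, (\<alpha>, x), f'), (f', l')) \<in> Ar L"
    and hm: "((h, \<phi>), (h, (y, x), h'), (h', \<phi>')) \<in> Ar R"
    and km: "((k', \<kappa>'), (k', (c, d), k), (k, \<kappa>)) \<in> Ar R"
    and fh: "cod f = cod h" "cod f' = cod h'"
    and sq': "square E (pB f' h') k' s' t'"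
  shows "c \<cdot> frob_fill f' l' h' \<phi>' (k', \<kappa>') s' t' \<cdot> y =
      frob_fill f l h \<phi> (k, \<kappa>) (c \<cdot> s' \<cdot> pm f h f' h' \<alpha> y) (d \<cdot> t' \<cdot> y)"
proof -
  have fO: "(f, l) \<in> Ob L" "(f', l') \<in> Ob L" and hO: "(h, \<phi>) \<in> Ob R" "(h', \<phi>') \<in> Ob R" and kO: "(k', \<kappa>') \<in> Ob R" "(k, \<kappa>) \<in> Ob R"
    using fm hm km unfolding left_maps_Ar right_maps_Ar by blast+
  have fsq: "square E f f' \<alpha> x" and hsq: "square E h h' y x" and ksq: "square E k' k c d"
    using left_right_maps_square(2)[OF fm] left_right_maps_square(1)[OF hm] left_right_maps_square(1)[OF km] by simp_all
  note fs = fsq[unfolded square_iff] and hs = hsq[unfolded square_iff] and ks = ksq[unfolded square_iff]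
  have ar: "arr f" "arr f'" "arr h" "arr h'" "arr k" "arr k'" using fs hs ks by simp_all
  have cf: "cospan f h" "cospan f' h'" using ar fh by (simp_all add: cospan_def)
  have cmf: "cospan_map f h f' h' \<alpha> y"
    using cf fs hs fh unfolding cospan_map_def by (auto intro!: exI[of _ x])
  define s t where "s = c \<cdot> s' \<cdot> pm f h f' h' \<alpha> y" and "t = d \<cdot> t' \<cdot> y"
  note q' = sq'[unfolded square_iff]
  have pmsq: "square E (pB f h) (pB f' h') (pm f h f' h' \<alpha> y) y"
    using cmf cf hs by (simp add: square_iff)
  have sq: "square E (pB f h) k s t"
    using square_comp[OF pmsq square_comp[OF sq' ksq]] q' ks hs cmf cf by (simp add: s_def t_def)
  note P = frob_fill_parts[OF fO(1) hO(1) fh(1) kO(2) sq] and P' = frob_fill_parts[OF fO(2) hO(2) fh(2) kO(1) sq']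
  let ?M = "lifts h k t" and ?M' = "lifts h' k' t'"
  let ?\<mu> = "push_fill h \<phi> k \<kappa> t" and ?\<mu>' = "push_fill h' \<phi>' k' \<kappa>' t'"
  note up = up_props[OF ar(3) P(1,2)] and up' = up_props[OF ar(4) P'(1,2)]
  note M = lifts_arr[OF ar(3) P(1,2)] and M' = lifts_arr[OF ar(4) P'(1,2)]
  have MO: "(?M, ?\<mu>) \<in> Ob R" and MO': "(?M', ?\<mu>') \<in> Ob R"
    using push_fill_Ob[OF hO(1) kO(2) P(1,2)] push_fill_Ob[OF hO(2) kO(1) P'(1,2)] .
  have cM: "cospan ?M' x" using M' hs by (simp add: cospan_def)
  define N where "N = pB ?M' x"
  define n where "n = pA ?M' x"
  define \<nu> where "\<nu> = base_change I u ?M' ?\<mu>' x"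
  have N: "arr N" "cod N = cod h" "arr n" "dom n = dom N" "cod n = dom ?M'" "?M' \<cdot> n = x \<cdot> N"
    using cM hs pb_commutes[OF cM] by (simp_all add: N_def n_def)
  have NO: "(N, \<nu>) \<in> Ob R" and nm: "((N, \<nu>), (N, (n, x), ?M'), (?M', ?\<mu>')) \<in> Ar R"
    using base_change_Ob[OF u MO' cM] base_change_proj[OF u MO' cM] by (simp_all add: N_def n_def \<nu>_def)
  have cmN: "cospan_map N h (?M' \<cdot> n) h' (ide (dom N)) y"
    using N hs ar M' unfolding cospan_map_def cospan_def by (auto intro!: exI[of _ x])
  define ce where "ce = c \<cdot> up h' k' t' n \<cdot> pm N h (?M' \<cdot> n) h' (ide (dom N)) y"
  have cNh: "cospan N h" using cmN by (rule cospan_mapD)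
  note upn = up'[OF N(3,5)]
  have tt: "arr t'" "dom t' = dom h'" "cod t' = cod k'" "arr d" "cod t' = dom d" "cod d = cod k"
    using P'(1,2) cospan_arr[OF P'(1)] ks by simp_all
  have ce: "arr ce" "dom ce = PB N h" "cod ce = dom k" "k \<cdot> ce = t \<cdot> pB N h"
  proof -
    let ?w = "pm N h (?M' \<cdot> n) h' (ide (dom N)) y"
    show "arr ce" "dom ce = PB N h" "cod ce = dom k"
      using upn cmN ks by (simp_all add: ce_def)
    have "k \<cdot> ce = (d \<cdot> k') \<cdot> up h' k' t' n \<cdot> ?w"
      unfolding ce_def using upn cmN ks by (intro comp_eq_extend) simp_all
    also have "\<dots> = d \<cdot> k' \<cdot> up h' k' t' n \<cdot> ?w"
      using upn cmN ks by (intro assoc) simp_all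
    also have "k' \<cdot> up h' k' t' n \<cdot> ?w = (t' \<cdot> pB (?M' \<cdot> n) h') \<cdot> ?w"
      using upn cmN ks by (intro comp_eq_extend) simp_all
    also have "\<dots> = t' \<cdot> y \<cdot> pB N h"
      using cmN cospan_mapD(2)[OF cmN] tt hs by simp
    finally show "k \<cdot> ce = t \<cdot> pB N h"
      using tt hs cNh by (simp add: t_def)
  qed
  \<comment> \<open>On transposes, \<open>e\<close> turns a map into \<open>k'\<close> over \<open>h'\<close> into one into \<open>k\<close> over \<open>h\<close>, by
    restricting along \<open>y\<close> and composing with \<open>c\<close>; \<open>ce\<close> is the generic instance.\<close>
  define e where "e = down h k t N ce"
  have e: "arr e" "dom e = dom N" "cod e = dom ?M" "?M \<cdot> e = N" "up h k t e = ce"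
    using down_props[OF ar(3) P(1,2) N(1,2) ce] by (simp_all add: e_def)
  have L1: "up h k t (e \<cdot> g) = c \<cdot> up h' k' t' (n \<cdot> g) \<cdot> pm a h (?M' \<cdot> n \<cdot> g) h' (ide (dom a)) y"
      and L1c: "cospan_map a h (?M' \<cdot> n \<cdot> g) h' (ide (dom a)) y"
    if g: "arr g" "cod g = dom N" and a: "N \<cdot> g = a" for g a
  proof -
    have Mg: "?M \<cdot> e \<cdot> g = a"
      using comp_eq_extend[OF e(4) M(1) e(1) _ g(1)] e g a by simp
    note uc = up_comp[OF ar(3) P(1,2) e(1,3) g(1), unfolded e(2,4,5) Mg, OF g(2)]
    have da: "dom a = dom g" using g N a dom_comp[of g N] by simp
    have cm: "cospan_map a h (?M' \<cdot> n) h' g y"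
      using cospan_map_comp[OF uc(2) cmN] g hs by simp
    note pn = up_pm[OF ar(4) P'(1,2) N(3,5) cm]
    show "cospan_map a h (?M' \<cdot> n \<cdot> g) h' (ide (dom a)) y" by (rule pn(1))
    have "up h k t (e \<cdot> g) = c \<cdot> up h' k' t' n \<cdot> pm N h (?M' \<cdot> n) h' (ide (dom N)) y \<cdot> pm a h N h g (ide (dom h))"
      unfolding uc(1) ce_def using upn cmN ks uc(2) by simp
    also have "pm N h (?M' \<cdot> n) h' (ide (dom N)) y \<cdot> pm a h N h g (ide (dom h)) = pm a h (?M' \<cdot> n) h' g y"
      using pm_comp[OF uc(2) cmN] g hs by simp
    also have "up h' k' t' n \<cdot> \<dots> = up h' k' t' (n \<cdot> g) \<cdot> pm a h (?M' \<cdot> n \<cdot> g) h' (ide (dom a)) y"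
      by (rule pn(2))
    finally show "up h k t (e \<cdot> g) = c \<cdot> up h' k' t' (n \<cdot> g) \<cdot> pm a h (?M' \<cdot> n \<cdot> g) h' (ide (dom a)) y" .
  qed
  \<comment> \<open>That \<open>e\<close> respects fillers is checked on transposes, where it becomes the naturality of
    \<open>\<chi>\<close> in \<open>h\<close> together with the naturality of the chosen left structures in \<open>k\<close>.\<close>
  have esq: "square E N ?M e (ide (cod h))"
    using e N M ar by (simp add: square_iff)
  have em: "((N, \<nu>), (N, (e, ide (cod h)), ?M), (?M, ?\<mu>)) \<in> Ar R"
    unfolding right_maps_Ar
  proof (intro conjI ballI allI impI)
    show "(N, (e, ide (cod h)), ?M) \<in> hom (arrow_cat E) N ?M"
      using esq by simp
    fix i p q assume i: "i \<in> Ob I" and pq: "square E (OM u i) N p q"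
    note s1 = pq[unfolded square_iff]
    have q: "arr q" "dom q = cod (OM u i)" "cod q = cod h" using s1 N by simp_all
    have xq: "arr (x \<cdot> q)" "dom (x \<cdot> q) = cod (OM u i)" "cod (x \<cdot> q) = cod h'" using q hs by simp_all
    have p: "arr p" "cod p = dom N" "N \<cdot> p = q \<cdot> OM u i" using s1 by simp_all
    have nsq: "square E N ?M' n x" using left_right_maps_square(1)[OF nm] by simp
    have sqe: "square E (OM u i) ?M (e \<cdot> p) q"
      using square_comp[OF pq esq] q by simp
    have sqn: "square E (OM u i) ?M' (n \<cdot> p) (x \<cdot> q)"
      by (rule square_comp[OF pq nsq])
    note r = push_fill_props[OF hO(1) kO(2) P(1,2) i sqe] and r' = push_fill_props[OF hO(2) kO(1) P'(1,2) i sqn]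
    note fil = right_filler[OF NO i pq]
    have nf: "n \<cdot> \<nu> i p q = ?\<mu>' i (n \<cdot> p) (x \<cdot> q)"
      by (rule right_maps_mor[OF nm i pq])
    have Mnp: "?M' \<cdot> n \<cdot> p = (x \<cdot> q) \<cdot> OM u i"
      using sqn[unfolded square_iff] by simp
    have Mnn: "?M' \<cdot> n \<cdot> \<nu> i p q = x \<cdot> q"
      unfolding nf by (rule r'(4))
    have \<tau>: "((qarr (OM u i) q h, \<chi> i q (h, \<phi>)),
        (qarr (OM u i) q h, (pm (q \<cdot> OM u i) h ((x \<cdot> q) \<cdot> OM u i) h' (ide (dom (OM u i))) y,
          pm q h (x \<cdot> q) h' (ide (dom q)) y), qarr (OM u i) (x \<cdot> q) h'),
        (qarr (OM u i) (x \<cdot> q) h', \<chi> i (x \<cdot> q) (h', \<phi>'))) \<in> Ar L"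
    proof -
      have "Ide I i \<in> Ar I" "Dom I (Ide I i) = i" "Cod I (Ide I i) = i"
        using is_functorD(1)[OF u] i by (auto simp: category_def)
      then show ?thesis
        using \<chi>[unfolded gen_frob_choice_def, THEN conjunct2, rule_format, OF _ hm, of "Ide I i" q "x \<cdot> q"] q xq hs
        by (simp add: R_simps functor_square_ide[OF u i])
    qed
    have cq: "cospan_map q h (x \<cdot> q) h' (ide (dom q)) y"
      using L1c[OF fil(1,3,5)] unfolding Mnn .
    note psq = push_fill_square[OF hO(2) kO(1) P'(1,2) i sqn]
    have "e \<cdot> \<nu> i p q = ?\<mu> i (e \<cdot> p) q"
    proof (rule up_eqI[OF ar(3) P(1,2)])
      have "up h k t (e \<cdot> \<nu> i p q) = c \<cdot> \<chi> i (x \<cdot> q) (h', \<phi>') (k', \<kappa>') (up h' k' t' (n \<cdot> p)) (t' \<cdot> pB (x \<cdot> q) h') \<cdot> pm q h (x \<cdot> q) h' (ide (dom q)) y"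
        using L1[OF fil(1,3,5)] r'(5) unfolding Mnn unfolding nf by simp
      also have "\<dots> = (c \<cdot> \<chi> i (x \<cdot> q) (h', \<phi>') (k', \<kappa>') (up h' k' t' (n \<cdot> p)) (t' \<cdot> pB (x \<cdot> q) h')) \<cdot> pm q h (x \<cdot> q) h' (ide (dom q)) y"
      proof (rule assoc[symmetric])
        note lf = left_filler[OF \<chi>_Ob[OF i hO(2) xq] kO(1), of "up h' k' t' (n \<cdot> p)" "t' \<cdot> pB (x \<cdot> q) h'", simplified, OF psq]
        show "arr (\<chi> i (x \<cdot> q) (h', \<phi>') (k', \<kappa>') (up h' k' t' (n \<cdot> p)) (t' \<cdot> pB (x \<cdot> q) h'))" by (rule lf)
        show "dom (\<chi> i (x \<cdot> q) (h', \<phi>') (k', \<kappa>') (up h' k' t' (n \<cdot> p)) (t' \<cdot> pB (x \<cdot> q) h')) = cod (pm q h (x \<cdot> q) h' (ide (dom q)) y)"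
          using lf cq qarr_props[OF uob[OF i] xq(1,2) ar(4) xq(3)] by simp
        show "dom c = cod (\<chi> i (x \<cdot> q) (h', \<phi>') (k', \<kappa>') (up h' k' t' (n \<cdot> p)) (t' \<cdot> pB (x \<cdot> q) h'))"
          using lf ks by simp
      qed (use cq ks in simp_all)
      also have "c \<cdot> \<chi> i (x \<cdot> q) (h', \<phi>') (k', \<kappa>') (up h' k' t' (n \<cdot> p)) (t' \<cdot> pB (x \<cdot> q) h') =
          \<chi> i (x \<cdot> q) (h', \<phi>') (k, \<kappa>) (c \<cdot> up h' k' t' (n \<cdot> p)) (d \<cdot> t' \<cdot> pB (x \<cdot> q) h')"
        using left_maps_nat[OF \<chi>_Ob[OF i hO(2) xq] km] psq by (simp add: R_simps)
      also have "\<dots> \<cdot> pm q h (x \<cdot> q) h' (ide (dom q)) y =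
          \<chi> i q (h, \<phi>) (k, \<kappa>) ((c \<cdot> up h' k' t' (n \<cdot> p)) \<cdot> pm (q \<cdot> OM u i) h ((x \<cdot> q) \<cdot> OM u i) h' (ide (dom (OM u i))) y)
            ((d \<cdot> t' \<cdot> pB (x \<cdot> q) h') \<cdot> pm q h (x \<cdot> q) h' (ide (dom q)) y)"
        by (rule left_maps_mor[OF \<tau> kO(2)]) (use square_comp[OF psq ksq] in simp)
      also have "(d \<cdot> t' \<cdot> pB (x \<cdot> q) h') \<cdot> pm q h (x \<cdot> q) h' (ide (dom q)) y = t \<cdot> pB q h"
        using cq cospan_mapD(1,2)[OF cq] tt hs by (simp add: t_def)
      also have "(c \<cdot> up h' k' t' (n \<cdot> p)) \<cdot> pm (q \<cdot> OM u i) h ((x \<cdot> q) \<cdot> OM u i) h' (ide (dom (OM u i))) y = up h k t (e \<cdot> p)"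
      proof -
        have np: "arr (n \<cdot> p)" "cod (n \<cdot> p) = dom ?M'" using p N by simp_all
        have "dom (q \<cdot> OM u i) = dom (OM u i)" using q uob[OF i] by simp
        then show ?thesis
          using L1[OF p] L1c[OF p] up'[OF np] ks unfolding Mnp by simp
      qed
      also have "\<chi> i q (h, \<phi>) (k, \<kappa>) (up h k t (e \<cdot> p)) (t \<cdot> pB q h) = up h k t (?\<mu> i (e \<cdot> p) q)"
        by (rule r(5)[symmetric])
      finally show "up h k t (e \<cdot> \<nu> i p q) = up h k t (?\<mu> i (e \<cdot> p) q)" .
      show "?M \<cdot> e \<cdot> \<nu> i p q = q"
        using comp_eq_extend[OF e(4) M(1) e(1) _ fil(1)] e fil by simp
    qed (use r e fil in simp_all)
    then show "top_of (N, (e, ide (cod h)), ?M) \<cdot> \<nu> i p q =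
        ?\<mu> i (top_of (N, (e, ide (cod h)), ?M) \<cdot> p) (bot_of (N, (e, ide (cod h)), ?M) \<cdot> q)"
      using q by simp
  qed (rule NO MO)+
  define r where "r = l (?M, ?\<mu>) (down h k t f s) (ide (cod h))"
  define r' where "r' = l' (?M', ?\<mu>') (down h' k' t' f' s') (ide (cod h'))"
  note rP = P(9-14)[folded r_def] and rP' = P'(9-14)[folded r'_def]
  let ?d' = "down h' k' t' f' s'"
  have cnd: "cone ?M' x (?d' \<cdot> \<alpha>) f"
  proof -
    have "?M' \<cdot> ?d' \<cdot> \<alpha> = f' \<cdot> \<alpha>"
      using P'(3-6) M' fs by (intro comp_eq_extend) simp_all
    then show ?thesis
      using cM P'(3-6) fs by (simp add: cone_def)
  qed
  \<comment> \<open>The lifting problem of \<open>f\<close> against \<open>N\<close> lying above those for \<open>?M\<close> and \<open>?M'\<close>.\<close>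
  define g where "g = pair ?M' x (?d' \<cdot> \<alpha>) f"
  have g: "arr g" "dom g = dom f" "cod g = dom N" "n \<cdot> g = ?d' \<cdot> \<alpha>" "N \<cdot> g = f"
    using cnd cM by (simp_all add: g_def n_def N_def)
  have gsq: "square E f N g (ide (cod h))"
    using g N fh ar by (simp add: square_iff)
  define rn where "rn = l (N, \<nu>) g (ide (cod h))"
  have rn: "arr rn" "dom rn = cod h" "cod rn = dom N" "N \<cdot> rn = ide (cod h)"
    using left_filler[OF fO(1) NO, of g "ide (cod h)"] gsq fh by (simp_all add: rn_def)
  have 1: "n \<cdot> rn = r' \<cdot> x"
  proof -
    have "n \<cdot> rn = l (?M', ?\<mu>') (n \<cdot> g) (x \<cdot> ide (cod h))"
      using left_maps_nat[OF fO(1) nm, of g "ide (cod h)"] gsq by (simp add: rn_def R_simps)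
    also have "\<dots> = l (?M', ?\<mu>') (?d' \<cdot> \<alpha>) (ide (cod h') \<cdot> x)"
      using g hs by simp
    also have "\<dots> = r' \<cdot> x"
      using left_maps_mor[OF fm MO', of ?d' "ide (cod h')"] P'(8) by (simp add: r'_def)
    finally show ?thesis .
  qed
  have 2: "e \<cdot> rn = r"
  proof -
    have "e \<cdot> rn = l (?M, ?\<mu>) (e \<cdot> g) (ide (cod h) \<cdot> ide (cod h))"
      using left_maps_nat[OF fO(1) em, of g "ide (cod h)"] gsq by (simp add: rn_def R_simps)
    also have "e \<cdot> g = down h k t f s"
    proof (rule up_eqI[OF ar(3) P(1,2)])
      have Mf: "?M' \<cdot> ?d' \<cdot> \<alpha> = f' \<cdot> \<alpha>"
        using P'(3-6) M' fs by (intro comp_eq_extend) simp_all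
      have cm: "cospan_map f h (?M' \<cdot> ?d') h' \<alpha> y"
        using cmf P'(6) by simp
      have "up h k t (e \<cdot> g) = c \<cdot> up h' k' t' (?d' \<cdot> \<alpha>) \<cdot> pm f h (?M' \<cdot> ?d' \<cdot> \<alpha>) h' (ide (dom f)) y"
        using L1[OF g(1,3,5)] g(4) by simp
      also have "\<dots> = c \<cdot> up h' k' t' ?d' \<cdot> pm f h (?M' \<cdot> ?d') h' \<alpha> y"
        using up_pm(2)[OF ar(4) P'(1,2,3,5) cm] by simp
      also have "\<dots> = s"
        using P'(6,7) by (simp add: s_def)
      finally show "up h k t (e \<cdot> g) = up h k t (down h k t f s)"
        using P(7) by simp
      show "?M \<cdot> e \<cdot> g = f"
        using comp_eq_extend[OF e(4) M(1) e(1) _ g(1)] e g by simp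
    qed (use P(3-7) e g in simp_all)
    finally show ?thesis
      using ar by (simp add: r_def)
  qed
  have ci: "cospan_map (ide (cod h)) h x h' (ide (cod h)) y"
    using hs ar unfolding cospan_map_def cospan_def by (auto intro!: exI[of _ x])
  have ci': "cospan_map x h' (ide (cod h')) h' x (ide (dom h'))"
    using hs ar unfolding cospan_map_def cospan_def by (auto intro!: exI[of _ "ide (cod h')"])
  have Mx: "?M' \<cdot> r' \<cdot> x = x"
    using comp_eq_extend[OF rP'(5) M'(1) rP'(1) _ _] rP' hs by simp
  have ax: "up h' k' t' (r' \<cdot> x) = up h' k' t' r' \<cdot> pm x h' (ide (cod h')) h' x (ide (dom h'))"
    using up_comp(1)[OF ar(4) P'(1,2) rP'(1,3), of x] rP' hs unfolding Mx by simp
  note ur' = up'[OF rP'(1,3), unfolded rP'(5)]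
  have "frob_fill f l h \<phi> (k, \<kappa>) s t = (c \<cdot> up h' k' t' (r' \<cdot> x) \<cdot> pm (ide (cod h)) h x h' (ide (cod h)) y) \<cdot> pair (ide (cod h)) h h (ide (dom h))"
    using L1[OF rn(1,3,4)] rP(6) Mx ar unfolding 1 2 by simp
  also have "\<dots> = c \<cdot> up h' k' t' r' \<cdot> pm x h' (ide (cod h')) h' x (ide (dom h')) \<cdot> pm (ide (cod h)) h x h' (ide (cod h)) y \<cdot> pair (ide (cod h)) h h (ide (dom h))"
    unfolding ax using ur' ci ci' P(15) ks ar by simp
  also have "pm (ide (cod h)) h x h' (ide (cod h)) y \<cdot> pair (ide (cod h)) h h (ide (dom h)) = pair x h' h y"
    using pm_pair(1)[OF ci P(15)] hs by simp
  also have "pm x h' (ide (cod h')) h' x (ide (dom h')) \<cdot> pair x h' h y = pair (ide (cod h')) h' (x \<cdot> h) y"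
    using pm_pair(1)[OF ci', of h y] pm_pair(2)[OF ci P(15)] hs by simp
  also have "\<dots> = pair (ide (cod h')) h' h' (ide (dom h')) \<cdot> y"
    using pair_comp(1)[OF P'(15), of y] hs by simp
  finally have "frob_fill f l h \<phi> (k, \<kappa>) s t = c \<cdot> up h' k' t' r' \<cdot> pair (ide (cod h')) h' h' (ide (dom h')) \<cdot> y" .
  also have "\<dots> = c \<cdot> frob_fill f' l' h' \<phi>' (k', \<kappa>') s' t' \<cdot> y"
    unfolding rP'(6) using ur' P'(15) hs ar by simp
  finally show ?thesis
    by (simp add: s_def t_def)
qed

proposition gen_frob_imp_frob: "frob_choice L forget R forget L (\<lambda>(f, l) (h, \<phi>). frob_fill f l h \<phi>)"
proof -
  have ob: "(pB f h, frob_fill f l h \<phi>) \<in> Ob L"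
    if f: "(f, l) \<in> Ob L" and h: "(h, \<phi>) \<in> Ob R" and fh: "cod f = cod h" for f l h \<phi>
    unfolding left_maps_Ob
  proof (intro conjI allI ballI impI)
    have fa: "arr f" "arr h" using structured_Ob[OF sL f] structured_Ob[OF sR h] by simp_all
    have c: "cospan f h" using fa fh by (simp add: cospan_def)
    show "arr (pB f h)" using c by simp
    show "if k \<in> Ob R \<and> square E (pB f h) (OM forget k) s t then filler E (pB f h) (OM forget k) s t (frob_fill f l h \<phi> k s t)
       else frob_fill f l h \<phi> k s t = undefined" for k s t
      using frob_fill_filler[OF f h fh, of "fst k" "snd k" s t] by (auto simp: frob_fill_def)
    fix \<sigma> s t assume \<sigma>: "\<sigma> \<in> Ar R" and sq: "square E (pB f h) (OM forget (Dom R \<sigma>)) s t"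
    obtain k' \<kappa>' c' d k \<kappa> where \<sigma>e: "\<sigma> = ((k', \<kappa>'), (k', (c', d), k), (k, \<kappa>))" and cd: "square E k' k c' d"
      using structured_ArE[OF sR \<sigma>] by metis
    have sq': "square E (pB f h) k' s t" using sq by (simp add: \<sigma>e R_simps)
    note q = sq'[unfolded square_iff]
    have fil: "filler E (pB f h) k' s t (frob_fill f l h \<phi> (k', \<kappa>') s t)"
      using frob_fill_filler[OF f h fh _ sq'] structured_Ar(1)[OF sR \<sigma>[unfolded \<sigma>e]] by simp
    have fm: "((f, l), (f, (ide (dom f), ide (cod h)), f), (f, l)) \<in> Ar L"
      using structured_ide_Ar[OF sL f] fh by simp
    have "pm f h f h (ide (dom f)) (ide (dom h)) = ide (PB f h)" by (rule pm_ide[OF c])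
    then show "top_of (AM forget \<sigma>) \<cdot> frob_fill f l h \<phi> (Dom R \<sigma>) s t =
        frob_fill f l h \<phi> (Cod R \<sigma>) (top_of (AM forget \<sigma>) \<cdot> s) (bot_of (AM forget \<sigma>) \<cdot> t)"
      using frob_fill_natural[OF fm structured_ide_Ar[OF sR h] \<sigma>[unfolded \<sigma>e] fh fh sq'] fil q c
      by (simp add: \<sigma>e R_simps filler_def)
  qed
  show ?thesis
    unfolding frob_choice_def
  proof (intro conjI ballI impI)
    fix X Y assume "X \<in> Ob L" "Y \<in> Ob R" "cod (OM forget X) = cod (OM forget Y)"
    then show "(pB (OM forget X) (OM forget Y), (\<lambda>(f, l) (h, \<phi>). frob_fill f l h \<phi>) X Y) \<in> Ob L"
      using ob by (cases X, cases Y) simp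
  next
    fix \<sigma> \<tau> assume \<sigma>: "\<sigma> \<in> Ar L" and \<tau>: "\<tau> \<in> Ar R" and b: "bot_of (AM forget \<sigma>) = bot_of (AM forget \<tau>)"
    obtain f l \<alpha> x f' l' where \<sigma>e: "\<sigma> = ((f, l), (f, (\<alpha>, x), f'), (f', l'))" "(f, l) \<in> Ob L" "(f', l') \<in> Ob L" and fsq: "square E f f' \<alpha> x"
      using structured_ArE[OF sL \<sigma>] by metis
    obtain h \<phi> y x' h' \<phi>' where \<tau>e: "\<tau> = ((h, \<phi>), (h, (y, x'), h'), (h', \<phi>'))" "(h, \<phi>) \<in> Ob R" "(h', \<phi>') \<in> Ob R" and hsq: "square E h h' y x'"
      using structured_ArE[OF sR \<tau>] by metis
    have x: "x' = x" using b by (simp add: \<sigma>e \<tau>e)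
    have fh: "cod f = cod h" "cod f' = cod h'" using fsq hsq by (simp_all add: x square_iff)
    have cm: "cospan_map f h f' h' \<alpha> y"
      using frob_cospan_map[OF structured_functor[OF category_E sL] structured_functor[OF category_E sR] \<sigma> \<tau> b]
      by (simp add: \<sigma>e \<tau>e R_simps L_simps)
    have "((pB f h, frob_fill f l h \<phi>), (pB f h, (pm f h f' h' \<alpha> y, y), pB f' h'), (pB f' h', frob_fill f' l' h' \<phi>')) \<in> Ar L"
      unfolding left_maps_Ar
    proof (intro conjI ballI allI impI)
      show "(pB f h, frob_fill f l h \<phi>) \<in> Ob L" "(pB f' h', frob_fill f' l' h' \<phi>') \<in> Ob L"
        using ob \<sigma>e \<tau>e fh by simp_all
      show "(pB f h, (pm f h f' h' \<alpha> y, y), pB f' h') \<in> hom (arrow_cat E) (pB f h) (pB f' h')"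
        using cm cospan_mapD[OF cm] by (simp add: square_iff)
      fix K s t assume K: "K \<in> Ob R" and sq: "square E (pB f' h') (OM forget K) s t"
      obtain k \<kappa> where k: "K = (k, \<kappa>)" by (cases K)
      have sq': "square E (pB f' h') k s t" using sq by (simp add: k)
      note q = sq'[unfolded square_iff]
      have fil: "filler E (pB f' h') k s t (frob_fill f' l' h' \<phi>' (k, \<kappa>) s t)"
        using frob_fill_filler[OF \<sigma>e(3) \<tau>e(3) fh(2) _ sq'] K by (simp add: k)
      have "ide (dom k) \<cdot> frob_fill f' l' h' \<phi>' (k, \<kappa>) s t \<cdot> y =
          frob_fill f l h \<phi> (k, \<kappa>) (ide (dom k) \<cdot> s \<cdot> pm f h f' h' \<alpha> y) (ide (cod k) \<cdot> t \<cdot> y)"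
        by (rule frob_fill_natural[OF \<sigma>[unfolded \<sigma>e] \<tau>[unfolded \<tau>e x] structured_ide_Ar[OF sR K[unfolded k]] fh sq'])
      then show "frob_fill f' l' h' \<phi>' K s t \<cdot> bot_of (pB f h, (pm f h f' h' \<alpha> y, y), pB f' h') =
          frob_fill f l h \<phi> K (s \<cdot> top_of (pB f h, (pm f h f' h' \<alpha> y, y), pB f' h')) (t \<cdot> bot_of (pB f h, (pm f h f' h' \<alpha> y, y), pB f' h'))"
        using fil q cm cospan_mapD[OF cm] by (simp add: k filler_def)
    qed
    then show "frob_mor L forget R forget (\<lambda>(f, l) (h, \<phi>). frob_fill f l h \<phi>) \<sigma> \<tau> \<in> Ar L"
      by (simp add: \<sigma>e(1) \<tau>e(1) L_simps R_simps)
  qed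
qed

end

section \<open>Algebraic weak factorization systems\<close>

lemma category_copointed_coalg:
  assumes T: "is_functor C C T"
  shows "category (copointed_coalg C T \<epsilon>)"
  unfolding copointed_coalg_def
proof (rule category_struct_cat, goal_cases)
  case 1
  show ?case by (rule is_functorD(1)[OF T])
next
  case (2 X) then show ?case by auto
next
  case (3 X)
  then show ?case
    using is_functorD[OF T] cat.comp_ide_dom[of C] cat.comp_ide_cod[of C] by (cases X) (auto simp: cat_def)
next
  case (4 X Y Z h k)
  interpret C: cat C using is_functorD(1)[OF T] by unfold_locales
  note F = is_functorD[OF T]
  obtain x \<alpha> y \<beta> z \<gamma> where X: "X = (x, \<alpha>)" "Y = (y, \<beta>)" "Z = (z, \<gamma>)"
    by (cases X, cases Y, cases Z) auto
  have h: "h \<in> Ar C" "Dom C h = x" "Cod C h = y" and k: "k \<in> Ar C" "Dom C k = y" "Cod C k = z"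
    and a: "\<alpha> \<in> Ar C" "Dom C \<alpha> = x" "Cod C \<alpha> = OM T x" "\<beta> \<in> Ar C" "Dom C \<beta> = y" "Cod C \<beta> = OM T y"
       "\<gamma> \<in> Ar C" "Dom C \<gamma> = z" "Cod C \<gamma> = OM T z"
    and e: "Comp C (AM T h) \<alpha> = Comp C \<beta> h" "Comp C (AM T k) \<beta> = Comp C \<gamma> k"
    using 4 by (auto simp: X)
  have "Comp C (AM T (Comp C k h)) \<alpha> = Comp C (AM T k) (Comp C \<beta> h)"
    using F h k a e(1) by simp
  also have "\<dots> = Comp C (Comp C \<gamma> k) h"
    using F h k a e(2) by (intro C.comp_eq_extend) simp_all
  also have "\<dots> = Comp C \<gamma> (Comp C k h)"
    using h k a by simp
  finally show ?case by (simp add: X)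
qed

lemma category_alg:
  assumes T: "is_functor C C T" and S: "\<And>x \<alpha>. (x, \<alpha>) \<in> S \<Longrightarrow> x \<in> Ob C \<and> \<alpha> \<in> hom C (OM T x) x"
  shows "category (struct_cat C S (\<lambda>(x, \<alpha>) h (y, \<beta>). Comp C h \<alpha> = Comp C \<beta> (AM T h)))"
proof (rule category_struct_cat, goal_cases)
  case 1
  show ?case by (rule is_functorD(1)[OF T])
next
  case (2 X) then show ?case using S[of "fst X" "snd X"] by auto
next
  case (3 X)
  then show ?case
    using is_functorD[OF T] cat.comp_ide_dom[of C] cat.comp_ide_cod[of C] S[of "fst X" "snd X"] by (cases X) (auto simp: cat_def)
next
  case (4 X Y Z h k)
  interpret C: cat C using is_functorD(1)[OF T] by unfold_locales
  note F = is_functorD[OF T]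
  obtain x \<alpha> y \<beta> z \<gamma> where X: "X = (x, \<alpha>)" "Y = (y, \<beta>)" "Z = (z, \<gamma>)"
    by (cases X, cases Y, cases Z) auto
  have h: "h \<in> Ar C" "Dom C h = x" "Cod C h = y" and k: "k \<in> Ar C" "Dom C k = y" "Cod C k = z"
    and a: "\<alpha> \<in> Ar C" "Dom C \<alpha> = OM T x" "Cod C \<alpha> = x" "\<beta> \<in> Ar C" "Dom C \<beta> = OM T y" "Cod C \<beta> = y"
       "\<gamma> \<in> Ar C" "Dom C \<gamma> = OM T z" "Cod C \<gamma> = z"
    and e: "Comp C h \<alpha> = Comp C \<beta> (AM T h)" "Comp C k \<beta> = Comp C \<gamma> (AM T k)"
    using 4 S by (auto simp: X)
  have "Comp C (Comp C k h) \<alpha> = Comp C k (Comp C \<beta> (AM T h))"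
    using F h k a e(1) by simp
  also have "\<dots> = Comp C (Comp C \<gamma> (AM T k)) (AM T h)"
    using F h k a e(2) by (intro C.comp_eq_extend) simp_all
  also have "\<dots> = Comp C \<gamma> (AM T (Comp C k h))"
    using F h k a by simp
  finally show ?case by (simp add: X)
qed

lemma struct_map_id: "struct_map K K snd"
  by (auto simp: struct_map_def)

context cat begin

definition restrict_fill :: "('a \<times> 'x, ('a \<times> 'x) \<times> 'a sq \<times> ('a \<times> 'x)) cat \<Rightarrow> ('a \<times> 'x \<Rightarrow> 'y) \<Rightarrow> 'a \<times> ('a \<times> 'y \<Rightarrow> 'a \<Rightarrow> 'a \<Rightarrow> 'a) \<Rightarrow>
    'a \<times> 'x \<Rightarrow> 'a \<Rightarrow> 'a \<Rightarrow> 'a" where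
  "restrict_fill J \<theta> = (\<lambda>(f, l) k s t. if k \<in> Ob J \<and> square E f (fst k) s t then l (fst k, \<theta> k) s t else undefined)"

text \<open>Left maps are contravariant in what they are lifted against.\<close>

lemma struct_map_left_maps:
  assumes J: "structured E J" and J': "structured E J'" and \<theta>: "struct_map J J' \<theta>"
  shows "struct_map (left_maps E J' forget) (left_maps E J forget) (restrict_fill J \<theta>)"
proof -
  note s = structured_simps[OF J] structured_simps[OF J']
  have \<theta>O: "\<And>k. k \<in> Ob J \<Longrightarrow> (fst k, \<theta> k) \<in> Ob J'" using \<theta> by (simp add: struct_map_def)
  have \<theta>A: "\<And>X h Y. (X, h, Y) \<in> Ar J \<Longrightarrow> ((fst X, \<theta> X), h, (fst Y, \<theta> Y)) \<in> Ar J'" using \<theta> unfolding struct_map_def by blast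
  have ob: "(f, restrict_fill J \<theta> (f, l)) \<in> Ob (left_maps E J forget)" if f: "(f, l) \<in> Ob (left_maps E J' forget)" for f l
    unfolding left_maps_Ob
  proof (intro conjI allI ballI impI)
    show "arr f" using f unfolding left_maps_Ob by blast
    show "if k \<in> Ob J \<and> square E f (OM forget k) s t then filler E f (OM forget k) s t (restrict_fill J \<theta> (f, l) k s t)
       else restrict_fill J \<theta> (f, l) k s t = undefined" for k s t
      using left_filler[OF f \<theta>O[of k], of s t] by (auto simp: restrict_fill_def filler_def)
    fix \<sigma> s t assume \<sigma>: "\<sigma> \<in> Ar J" and sq: "square E f (OM forget (Dom J \<sigma>)) s t"
    obtain k \<kappa> c d k' \<kappa>' where \<sigma>e: "\<sigma> = ((k, \<kappa>), (k, (c, d), k'), (k', \<kappa>'))" "(k, \<kappa>) \<in> Ob J" "(k', \<kappa>') \<in> Ob J" and cd: "square E k k' c d"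
      using structured_ArE[OF J \<sigma>] by metis
    have sq': "square E f k s t" using sq by (simp add: \<sigma>e s)
    show "top_of (AM forget \<sigma>) \<cdot> restrict_fill J \<theta> (f, l) (Dom J \<sigma>) s t =
       restrict_fill J \<theta> (f, l) (Cod J \<sigma>) (top_of (AM forget \<sigma>) \<cdot> s) (bot_of (AM forget \<sigma>) \<cdot> t)"
      using left_maps_nat[OF f \<theta>A[OF \<sigma>[unfolded \<sigma>e]], of s t] sq' square_comp[OF sq' cd] \<sigma>e(2,3)
      by (simp add: \<sigma>e(1) s restrict_fill_def)
  qed
  have "((fst X, restrict_fill J \<theta> X), h, (fst Y, restrict_fill J \<theta> Y)) \<in> Ar (left_maps E J forget)"
    if a: "(X, h, Y) \<in> Ar (left_maps E J' forget)" for X h Y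
  proof -
    obtain f l g m p q where X: "X = (f, l)" "Y = (g, m)" "h = (f, (p, q), g)"
      using structured_ArE[OF structured_left_maps a] by (metis prod.inject)
    note a' = a[unfolded X]
    have O: "(f, l) \<in> Ob (left_maps E J' forget)" "(g, m) \<in> Ob (left_maps E J' forget)" and sq: "square E f g p q"
      using a' unfolding left_maps_Ar by auto
    have "restrict_fill J \<theta> (g, m) k s t \<cdot> q = restrict_fill J \<theta> (f, l) k (s \<cdot> p) (t \<cdot> q)"
      if k: "k \<in> Ob J" "square E g (fst k) s t" for k s t
      using left_maps_mor[OF a' \<theta>O[OF k(1)], of s t] k square_comp[OF sq k(2)] by (simp add: restrict_fill_def)
    then show ?thesis
      unfolding X left_maps_Ar fst_conv using ob[OF O(1)] ob[OF O(2)] sq by simp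
  qed
  then show ?thesis
    unfolding struct_map_def using ob by auto
qed

end

locale awfs_cat = pb_cat E pb for E :: "('o, 'a) cat" and pb +
  fixes W :: "'a awfs_data"
  assumes awfs: "awfs E W"
begin

abbreviation "lf \<equiv> OM (LF W)"
abbreviation "rf \<equiv> OM (RF W)"
text \<open>The action of the functorial factorization on the middle objects.\<close>

definition "kf f g s t = bot_of (AM (LF W) (f, (s, t), g))"

lemma LF: "is_functor (arrow_cat E) (arrow_cat E) (LF W)" and RF: "is_functor (arrow_cat E) (arrow_cat E) (RF W)"
  using awfs by (auto simp: awfs_def functorial_factorization_def)

lemma factorization:
  assumes "arr f"
  shows "arr (lf f)" "arr (rf f)" "dom (lf f) = dom f" "cod (lf f) = dom (rf f)" "cod (rf f) = cod f" "rf f \<cdot> lf f = f"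
  using awfs is_functorD(3)[OF LF, of f] is_functorD(3)[OF RF, of f] assms by (auto simp: awfs_def functorial_factorization_def)

lemma fact_square:
  assumes q: "square E f g s t"
  shows "AM (LF W) (f, (s, t), g) = (lf f, (s, kf f g s t), lf g)" "AM (RF W) (f, (s, t), g) = (rf f, (kf f g s t, t), rf g)"
    "square E (lf f) (lf g) s (kf f g s t)" "square E (rf f) (rf g) (kf f g s t) t"
proof -
  note L = functor_square[OF LF q, simplified] and R = functor_square[OF RF q, simplified]
  have e: "top_of (AM (LF W) (f, (s, t), g)) = s" "bot_of (AM (LF W) (f, (s, t), g)) = top_of (AM (RF W) (f, (s, t), g))"
    "bot_of (AM (RF W) (f, (s, t), g)) = t"
    using awfs q by (force simp: awfs_def functorial_factorization_def)+
  show "AM (LF W) (f, (s, t), g) = (lf f, (s, kf f g s t), lf g)" "AM (RF W) (f, (s, t), g) = (rf f, (kf f g s t, t), rf g)"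
    using L(1) R(1) e by (simp_all add: kf_def)
  show "square E (lf f) (lf g) s (kf f g s t)" "square E (rf f) (rf g) (kf f g s t) t"
    using L(2) R(2) e by (simp_all add: kf_def)
qed

lemma kf_comp:
  assumes q: "square E f g s t" and q': "square E g h s' t'"
  shows "kf f h (s' \<cdot> s) (t' \<cdot> t) = kf g h s' t' \<cdot> kf f g s t"
  using is_functorD(8)[OF LF q q'] fact_square[OF q] fact_square[OF q'] fact_square[OF square_comp[OF q q']] by simp

text \<open>The counit is the identity on top, so the counit law forces the top of a coalgebra structure to be
an identity. What remains is a filler \<open>p\<close> of the square from \<open>f\<close> to \<open>rf f\<close> with the identity at the bottom.\<close>

lemma L_map_Ob: "(f, \<alpha>) \<in> Ob (L_map E W) \<longleftrightarrow> arr f \<and> (\<exists>p. \<alpha> = (f, (ide (dom f), p), lf f) \<and> arr p \<and> dom p = cod f \<and> cod p = dom (rf f) \<and>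
    p \<cdot> f = lf f \<and> rf f \<cdot> p = ide (cod f))" (is "?l \<longleftrightarrow> ?r")
proof
  assume l: ?l
  obtain f' p0 p g' where a: "\<alpha> = (f', (p0, p), g')" by (cases \<alpha>) auto
  from l have f: "arr f" and e: "f' = f" "g' = lf f" and q: "square E f (lf f) p0 p"
    and u: "ide (dom f) \<cdot> p0 = ide (dom f)" "rf f \<cdot> p = ide (cod f)"
    by (auto simp: L_map_def copointed_coalg_def a counit_def)
  note F = factorization[OF f] and q' = q[unfolded square_iff]
  have p0: "p0 = ide (dom f)" using u(1) q' F by simp
  have "p \<cdot> f = lf f" using q' F unfolding p0 by simp
  then show ?r using a e p0 u(2) q' f F(3-5) by simp
next
  assume ?r
  then show ?l
    using factorization[of f] by (auto simp: L_map_def copointed_coalg_def counit_def square_iff)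
qed

text \<open>Dually, an algebra structure is an identity at the bottom.\<close>

lemma R_map_Ob: "(g, \<beta>) \<in> Ob (R_map E W) \<longleftrightarrow> arr g \<and> (\<exists>p. \<beta> = (rf g, (p, ide (cod g)), g) \<and> arr p \<and> dom p = dom (rf g) \<and> cod p = dom g \<and>
    g \<cdot> p = rf g \<and> p \<cdot> lf g = ide (dom g))" (is "?l \<longleftrightarrow> ?r")
proof
  assume l: ?l
  then have f: "arr g" and d: "Dom (arrow_cat E) \<beta> = rf g" "Cod (arrow_cat E) \<beta> = g" and \<beta>: "\<beta> \<in> Ar (arrow_cat E)"
    and c: "Comp (arrow_cat E) \<beta> (unit E W g) = Ide (arrow_cat E) g"
    by (simp_all add: R_map_def pointed_alg_def)
  obtain p p1 where a: "\<beta> = (rf g, (p, p1), g)" using d by (cases \<beta>) auto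
  have u: "p \<cdot> lf g = ide (dom g)" "p1 \<cdot> ide (cod g) = ide (cod g)"
    using c by (simp_all add: a unit_def)
  note F = factorization[OF f] and q' = \<beta>[unfolded a square_iff]
  have p1: "p1 = ide (cod g)"
    by (metis comp_ide_dom q' F(5) u(2))
  have gp: "g \<cdot> p = rf g"
    using q' comp_ide_cod[of "rf g" "cod g"] F(5) unfolding p1 by metis
  have "arr p" "dom p = dom (rf g)" "cod p = dom g"
    using q' by simp_all
  then show ?r
    using a p1 u(1) f gp by blast
next
  assume ?r
  then show ?l
    using factorization[of g] by (auto simp: R_map_def pointed_alg_def unit_def square_iff)
qed

lemma L_map_Ar:
  assumes "((f, \<alpha>), h, (f', \<alpha>')) \<in> Ar (L_map E W)"
  obtains a b p p' where "h = (f, (a, b), f')" "square E f f' a b" "\<alpha> = (f, (ide (dom f), p), lf f)" "\<alpha>' = (f', (ide (dom f'), p'), lf f')"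
    "kf f f' a b \<cdot> p = p' \<cdot> b"
proof -
  from assms have O: "(f, \<alpha>) \<in> Ob (L_map E W)" "(f', \<alpha>') \<in> Ob (L_map E W)" and h: "h \<in> Ar (arrow_cat E)" "Dom (arrow_cat E) h = f" "Cod (arrow_cat E) h = f'"
    and e: "Comp (arrow_cat E) (AM (LF W) h) \<alpha> = Comp (arrow_cat E) \<alpha>' h"
    by (auto simp: L_map_def copointed_coalg_def)
  obtain a b where hh: "h = (f, (a, b), f')" using h by (cases h) auto
  obtain p p' where pp: "\<alpha> = (f, (ide (dom f), p), lf f)" "\<alpha>' = (f', (ide (dom f'), p'), lf f')" using O unfolding L_map_Ob by blast
  have sq: "square E f f' a b" using h hh by simp
  show ?thesis
    by (rule that[OF hh sq pp]) (use e fact_square[OF sq] in \<open>simp add: hh pp\<close>)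
qed

lemma R_map_Ar:
  assumes "((g, \<beta>), h, (g', \<beta>')) \<in> Ar (R_map E W)"
  obtains a b p p' where "h = (g, (a, b), g')" "square E g g' a b" "\<beta> = (rf g, (p, ide (cod g)), g)" "\<beta>' = (rf g', (p', ide (cod g')), g')"
    "a \<cdot> p = p' \<cdot> kf g g' a b"
proof -
  from assms have O: "(g, \<beta>) \<in> Ob (R_map E W)" "(g', \<beta>') \<in> Ob (R_map E W)" and h: "h \<in> Ar (arrow_cat E)" "Dom (arrow_cat E) h = g" "Cod (arrow_cat E) h = g'"
    and e: "Comp (arrow_cat E) h \<beta> = Comp (arrow_cat E) \<beta>' (AM (RF W) h)"
    by (auto simp: R_map_def pointed_alg_def)
  obtain a b where hh: "h = (g, (a, b), g')" using h by (cases h) auto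
  obtain p p' where pp: "\<beta> = (rf g, (p, ide (cod g)), g)" "\<beta>' = (rf g', (p', ide (cod g')), g')" using O unfolding R_map_Ob by blast
  have sq: "square E g g' a b" using h hh by simp
  show ?thesis
    by (rule that[OF hh sq pp]) (use e fact_square[OF sq] in \<open>simp add: hh pp\<close>)
qed

lemma structured_L_map: "structured E (L_map E W)"
  unfolding structured_def
proof
  show "category (L_map E W)" unfolding L_map_def by (rule category_copointed_coalg[OF LF])
  show "\<exists>S M. L_map E W = struct_cat (arrow_cat E) S M \<and> fst ` S \<subseteq> Ar E"
    unfolding L_map_def copointed_coalg_def by fastforce
qed

lemma structured_R_map: "structured E (R_map E W)"
  unfolding structured_def
proof
  show "category (R_map E W)" unfolding R_map_def pointed_alg_def by (rule category_alg[OF RF]) auto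
  show "\<exists>S M. R_map E W = struct_cat (arrow_cat E) S M \<and> fst ` S \<subseteq> Ar E"
    unfolding R_map_def pointed_alg_def by fastforce
qed

lemma structured_R_Map: "structured E (R_Map E W)"
  unfolding structured_def
proof
  show "category (R_Map E W)" unfolding R_Map_def monad_alg_def by (rule category_alg[OF RF]) auto
  show "\<exists>S M. R_Map E W = struct_cat (arrow_cat E) S M \<and> fst ` S \<subseteq> Ar E"
    unfolding R_Map_def monad_alg_def by fastforce
qed

lemma R_Map_R_map: "struct_map (R_Map E W) (R_map E W) snd"
  unfolding struct_map_def R_Map_def R_map_def monad_alg_def pointed_alg_def struct_cat_simps by auto

text \<open>The monad laws make the multiplication an algebra structure on \<open>rf f\<close>, and its naturality makes the
squares \<open>rf q\<close> morphisms of algebras.\<close>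

lemma free_R_Map: 
  assumes "arr f"
  shows "(rf f, mult W f) \<in> Ob (R_Map E W)"
  using assms awfs is_functorD(3)[OF RF, of f]
  by (auto simp: awfs_def monad_def nat_trans_def R_Map_def monad_alg_def)

lemma free_R_Map_Ar:
  assumes "square E f g s t"
  shows "((rf f, mult W f), (rf f, (kf f g s t, t), rf g), (rf g, mult W g)) \<in> Ar (R_Map E W)"
proof -
  have fg: "arr f" "arr g" using assms by (simp_all add: square_iff)
  have "Comp (arrow_cat E) (mult W g) (AM (RF W) (AM (RF W) (f, (s, t), g))) = Comp (arrow_cat E) (AM (RF W) (f, (s, t), g)) (mult W f)"
    using awfs assms by (force simp: awfs_def monad_def nat_trans_def)
  then show ?thesis
    using free_R_Map[OF fg(1)] free_R_Map[OF fg(2)] fact_square[OF assms]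
    unfolding R_Map_def monad_alg_def by simp
qed

text \<open>A coalgebra structure on \<open>f\<close> leads from its codomain to the middle object of its factorization, and an
algebra structure leads from the middle object back to the domain; a square connects the two
middle objects.\<close>

definition coalg_fill :: "'a \<times> 'a sq \<Rightarrow> 'a \<times> 'a sq \<Rightarrow> 'a \<Rightarrow> 'a \<Rightarrow> 'a" where
  "coalg_fill = (\<lambda>(f, \<alpha>) k s t. if k \<in> Ob (R_Map E W) \<and> square E f (fst k) s t
     then top_of (snd k) \<cdot> kf f (fst k) s t \<cdot> bot_of \<alpha> else undefined)"

lemma coalg_fill_filler:
  assumes f: "(f, \<alpha>) \<in> Ob (L_map E W)" and k: "k \<in> Ob (R_Map E W)" and q: "square E f (fst k) s t"
  shows "filler E f (fst k) s t (coalg_fill (f, \<alpha>) k s t)"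
proof -
  obtain p where p: "\<alpha> = (f, (ide (dom f), p), lf f)" "arr p" "dom p = cod f" "cod p = dom (rf f)" "p \<cdot> f = lf f" "rf f \<cdot> p = ide (cod f)" "arr f"
    using f unfolding L_map_Ob by blast
  obtain g \<beta> where kg: "k = (g, \<beta>)" by (cases k)
  have "(g, \<beta>) \<in> Ob (R_map E W)" using k R_Map_R_map unfolding struct_map_def kg by fastforce
  then obtain r where r: "\<beta> = (rf g, (r, ide (cod g)), g)" "arr r" "dom r = dom (rf g)" "cod r = dom g" "g \<cdot> r = rf g" "r \<cdot> lf g = ide (dom g)" "arr g"
    unfolding R_map_Ob by blast
  have q': "square E f g s t" using q by (simp add: kg)
  note s = q'[unfolded square_iff] and K = fact_square(3,4)[OF q', unfolded square_iff]
  note F = factorization[OF p(7)] factorization[OF r(7)]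
  let ?K = "kf f g s t"
  have 1: "r \<cdot> ?K \<cdot> p \<cdot> f = s"
  proof -
    have "r \<cdot> ?K \<cdot> p \<cdot> f = r \<cdot> lf g \<cdot> s" using p K by simp
    also have "\<dots> = ide (dom g) \<cdot> s" using r K F s by (intro comp_eq_extend) simp_all
    finally show ?thesis using s by simp
  qed
  have 2: "g \<cdot> r \<cdot> ?K \<cdot> p = t"
  proof -
    have "g \<cdot> r \<cdot> ?K \<cdot> p = rf g \<cdot> ?K \<cdot> p" using r K F p by (intro comp_eq_extend) simp_all
    also have "\<dots> = (t \<cdot> rf f) \<cdot> p" using r K F p by (intro comp_eq_extend) simp_all
    also have "\<dots> = t" using s F p by simp
    finally show ?thesis .
  qed
  show ?thesis
    using 1 2 k q' p r K F by (simp add: coalg_fill_def filler_def kg)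
qed

lemma L_map_left_maps: "struct_map (L_map E W) (left_maps E (R_Map E W) forget) coalg_fill"
proof -
  note sR = structured_R_Map and sL = structured_L_map
  have ob: "(f, coalg_fill (f, \<alpha>)) \<in> Ob (left_maps E (R_Map E W) forget)" if f: "(f, \<alpha>) \<in> Ob (L_map E W)" for f \<alpha>
    unfolding left_maps_Ob
  proof (intro conjI allI ballI impI)
    show "arr f" using f unfolding L_map_Ob by blast
    show "if k \<in> Ob (R_Map E W) \<and> square E f (OM forget k) s t then filler E f (OM forget k) s t (coalg_fill (f, \<alpha>) k s t)
       else coalg_fill (f, \<alpha>) k s t = undefined" for k s t
      using coalg_fill_filler[OF f, of k s t] by (auto simp: coalg_fill_def)
    fix \<sigma> s t assume \<sigma>: "\<sigma> \<in> Ar (R_Map E W)" and sq: "square E f (OM forget (Dom (R_Map E W) \<sigma>)) s t"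
    obtain k \<kappa> h k' \<kappa>' where \<sigma>e: "\<sigma> = ((k, \<kappa>), h, (k', \<kappa>'))" by (cases \<sigma>) auto
    have kO: "(k, \<kappa>) \<in> Ob (R_Map E W)" "(k', \<kappa>') \<in> Ob (R_Map E W)" using structured_Ar[OF sR \<sigma>[unfolded \<sigma>e]] by simp_all
    have "((k, \<kappa>), h, (k', \<kappa>')) \<in> Ar (R_map E W)"
      using \<sigma> R_Map_R_map unfolding struct_map_def \<sigma>e by fastforce
    then obtain c d r r' where h: "h = (k, (c, d), k')" "square E k k' c d" "\<kappa> = (rf k, (r, ide (cod k)), k)"
        "\<kappa>' = (rf k', (r', ide (cod k')), k')" "c \<cdot> r = r' \<cdot> kf k k' c d"
      and O: "(k, \<kappa>) \<in> Ob (R_map E W)" "(k', \<kappa>') \<in> Ob (R_map E W)"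
      using structured_Ar(1,2)[OF structured_R_map] by (metis R_map_Ar)
    have r: "arr r" "dom r = dom (rf k)" "cod r = dom k" "arr r'" "dom r' = dom (rf k')" "cod r' = dom k'"
      using O unfolding R_map_Ob h by auto
    obtain p where p: "\<alpha> = (f, (ide (dom f), p), lf f)" "arr p" "dom p = cod f" "cod p = dom (rf f)"
      using f unfolding L_map_Ob by blast
    have sq': "square E f k s t" using sq by (simp add: \<sigma>e structured_simps[OF sR])
    note q = square_comp[OF sq' h(2)]
    note K = fact_square(3,4)[OF sq', unfolded square_iff] fact_square(3,4)[OF h(2), unfolded square_iff] and hs = h(2)[unfolded square_iff]
    have "c \<cdot> r \<cdot> kf f k s t \<cdot> p = (r' \<cdot> kf k k' c d) \<cdot> kf f k s t \<cdot> p"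
      using r p K hs h(5) by (intro comp_eq_extend) simp_all
    also have "\<dots> = r' \<cdot> kf f k' (c \<cdot> s) (d \<cdot> t) \<cdot> p"
      unfolding kf_comp[OF sq' h(2)] using r p K by simp
    finally show "top_of (AM forget \<sigma>) \<cdot> coalg_fill (f, \<alpha>) (Dom (R_Map E W) \<sigma>) s t =
      coalg_fill (f, \<alpha>) (Cod (R_Map E W) \<sigma>) (top_of (AM forget \<sigma>) \<cdot> s) (bot_of (AM forget \<sigma>) \<cdot> t)"
      using kO sq' q by (simp add: \<sigma>e structured_simps[OF sR] coalg_fill_def h p(1))
  qed
  have "((fst X, coalg_fill X), h, (fst Y, coalg_fill Y)) \<in> Ar (left_maps E (R_Map E W) forget)" if a: "(X, h, Y) \<in> Ar (L_map E W)" for X h Y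
  proof -
    obtain f \<alpha> f' \<alpha>' where X: "X = (f, \<alpha>)" "Y = (f', \<alpha>')" by (cases X, cases Y)
    have O: "(f, \<alpha>) \<in> Ob (L_map E W)" "(f', \<alpha>') \<in> Ob (L_map E W)" using structured_Ar[OF sL a] by (simp_all add: X)
    obtain c d p p' where h: "h = (f, (c, d), f')" "square E f f' c d" and al: "\<alpha> = (f, (ide (dom f), p), lf f)" "\<alpha>' = (f', (ide (dom f'), p'), lf f')"
      and e: "kf f f' c d \<cdot> p = p' \<cdot> d"
      using L_map_Ar[OF a[unfolded X]] by metis
    have p: "arr p" "dom p = cod f" "cod p = dom (rf f)" "arr p'" "dom p' = cod f'" "cod p' = dom (rf f')"
      using O unfolding L_map_Ob al by auto
    have "coalg_fill (f', \<alpha>') k s t \<cdot> d = coalg_fill (f, \<alpha>) k (s \<cdot> c) (t \<cdot> d)"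
      if k: "k \<in> Ob (R_Map E W)" and sq: "square E f' (fst k) s t" for k s t
    proof -
      obtain g \<beta> where kg: "k = (g, \<beta>)" by (cases k)
      have "(g, \<beta>) \<in> Ob (R_map E W)" using k R_Map_R_map unfolding struct_map_def kg by fastforce
      then obtain r where r: "\<beta> = (rf g, (r, ide (cod g)), g)" "arr r" "dom r = dom (rf g)" "cod r = dom g"
        unfolding R_map_Ob by blast
      have sq': "square E f' g s t" using sq by (simp add: kg)
      note K = fact_square(3,4)[OF sq', unfolded square_iff] fact_square(3,4)[OF h(2), unfolded square_iff] and hs = h(2)[unfolded square_iff]
      have "(r \<cdot> kf f' g s t \<cdot> p') \<cdot> d = r \<cdot> kf f' g s t \<cdot> kf f f' c d \<cdot> p"
        using r p K hs e by simp
      also have "\<dots> = r \<cdot> kf f g (s \<cdot> c) (t \<cdot> d) \<cdot> p"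
        unfolding kf_comp[OF h(2) sq'] using r p K by simp
      finally show ?thesis
        using k sq' square_comp[OF h(2) sq'] by (simp add: coalg_fill_def kg al r(1))
    qed
    then show ?thesis
      unfolding X left_maps_Ar fst_conv using ob[OF O(1)] ob[OF O(2)] h by simp
  qed
  then show ?thesis
    unfolding struct_map_def using ob by auto
qed

text \<open>Conversely, a left map can be lifted against the free algebra on itself, and the filler of the
canonical square from \<open>f\<close> to \<open>rf f\<close> is a coalgebra structure.\<close>

definition fill_coalg where
  "fill_coalg = (\<lambda>(f, l). (f, (ide (dom f), l (rf f, mult W f) (lf f) (ide (cod f))), lf f))"

lemma left_maps_L_map: "struct_map (left_maps E (R_Map E W) forget) (L_map E W) fill_coalg"
proof -
  have sq: "square E f (rf f) (lf f) (ide (cod f))" if "arr f" for f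
    using that factorization[OF that] by (simp add: square_iff)
  have ob: "(f, fill_coalg (f, l)) \<in> Ob (L_map E W)" if f: "(f, l) \<in> Ob (left_maps E (R_Map E W) forget)" for f l
  proof -
    have fa: "arr f" using f unfolding left_maps_Ob by blast
    show ?thesis
      using left_filler[OF f free_R_Map[OF fa], of "lf f" "ide (cod f)"] sq[OF fa] fa unfolding L_map_Ob fill_coalg_def by simp
  qed
  have "((fst X, fill_coalg X), h, (fst Y, fill_coalg Y)) \<in> Ar (L_map E W)" if a: "(X, h, Y) \<in> Ar (left_maps E (R_Map E W) forget)" for X h Y
  proof -
    obtain f l g m c d where X: "X = (f, l)" "Y = (g, m)" "h = (f, (c, d), g)"
      using structured_ArE[OF structured_left_maps a] by (metis prod.inject)
    note a' = a[unfolded X]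
    have O: "(f, l) \<in> Ob (left_maps E (R_Map E W) forget)" "(g, m) \<in> Ob (left_maps E (R_Map E W) forget)" and hq: "square E f g c d"
      using a' unfolding left_maps_Ar by auto
    note hs = hq[unfolded square_iff]
    have fg: "arr f" "arr g" using hs by simp_all
    note K = fact_square[OF hq] and K' = fact_square(3,4)[OF hq, unfolded square_iff]
    have "kf f g c d \<cdot> l (rf f, mult W f) (lf f) (ide (cod f)) = l (rf g, mult W g) (kf f g c d \<cdot> lf f) (d \<cdot> ide (cod f))"
      using left_maps_nat[OF O(1) free_R_Map_Ar[OF hq], of "lf f" "ide (cod f)"] sq[OF fg(1)] by (simp add: structured_simps[OF structured_R_Map])
    also have "\<dots> = l (rf g, mult W g) (lf g \<cdot> c) (ide (cod g) \<cdot> d)"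
      using K' hs by simp
    also have "\<dots> = m (rf g, mult W g) (lf g) (ide (cod g)) \<cdot> d"
      using left_maps_mor[OF a' free_R_Map[OF fg(2)], of "lf g" "ide (cod g)"] sq[OF fg(2)] by simp
    finally show ?thesis
      using ob[OF O(1)] ob[OF O(2)] hq K hs
      unfolding X L_map_def copointed_coalg_def by (simp add: fill_coalg_def)
  qed
  then show ?thesis
    unfolding struct_map_def using ob by auto
qed

text \<open>An algebra structure \<open>(r, 1)\<close> for the pointed endofunctor makes \<open>h\<close> a retract of the free algebra \<open>rf h\<close>
in the slice over the codomain of \<open>h\<close>. Pulling \<open>f\<close> back along both shows that \<open>h\<^sup>*(f)\<close> is a retract of
\<open>(rf h)\<^sup>*(f)\<close>, and left maps are closed under retracts.\<close>

lemma frob_choice_R_map: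
  assumes A: "structured E A" and v: "is_functor J (arrow_cat E) v"
    and \<chi>: "frob_choice A forget (R_Map E W) forget (left_maps E J v) \<chi>"
  shows "\<exists>\<chi>'. frob_choice A forget (R_map E W) forget (left_maps E J v) \<chi>'"
proof -
  define \<chi>' where "\<chi>' = (\<lambda>X (h, \<beta>). retract_fill J v (pB (fst X) h) (\<chi> X (rf h, mult W h))
      (pm (fst X) (rf h) (fst X) h (ide (dom (fst X))) (top_of \<beta>)) (top_of \<beta>) (lf h))"
  have ret: "retract (pB f h) (pB f (rf h)) (pm f h f (rf h) (ide (dom f)) (lf h)) (lf h) (pm f (rf h) f h (ide (dom f)) r) r"
    and m1: "cospan_map f h f (rf h) (ide (dom f)) (lf h)" and m2: "cospan_map f (rf h) f h (ide (dom f)) r"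
    if f: "arr f" and h: "arr h" "arr r" "dom r = dom (rf h)" "cod r = dom h" "h \<cdot> r = rf h" "r \<cdot> lf h = ide (dom h)" and fh: "cod f = cod h"
    for f h r
  proof -
    note F = factorization[OF h(1)]
    show m1: "cospan_map f h f (rf h) (ide (dom f)) (lf h)" and m2: "cospan_map f (rf h) f h (ide (dom f)) r"
      using f h fh F unfolding cospan_map_def cospan_def by (auto intro!: exI[of _ "ide (cod h)"])
    have "pm f (rf h) f h (ide (dom f)) r \<cdot> pm f h f (rf h) (ide (dom f)) (lf h) = ide (PB f h)"
      using pm_comp[OF m1 m2] pm_ide[OF cospan_mapD(1)[OF m1]] f h by simp
    then show "retract (pB f h) (pB f (rf h)) (pm f h f (rf h) (ide (dom f)) (lf h)) (lf h) (pm f (rf h) f h (ide (dom f)) r) r"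
      using m1 m2 cospan_mapD[OF m1] cospan_mapD[OF m2] h F by (simp add: retract_def square_iff)
  qed
  have "frob_choice A forget (R_map E W) forget (left_maps E J v) \<chi>'"
    unfolding frob_choice_def
  proof (intro conjI ballI impI)
    fix X Y assume X: "X \<in> Ob A" and Y: "Y \<in> Ob (R_map E W)" and c: "cod (OM forget X) = cod (OM forget Y)"
    obtain f \<alpha> h \<beta> where XY: "X = (f, \<alpha>)" "Y = (h, \<beta>)" by (cases X, cases Y)
    obtain r where r: "\<beta> = (rf h, (r, ide (cod h)), h)" "arr h" "arr r" "dom r = dom (rf h)" "cod r = dom h" "h \<cdot> r = rf h" "r \<cdot> lf h = ide (dom h)"
      using Y unfolding XY R_map_Ob by blast
    have f: "arr f" "cod f = cod h" using structured_Ob[OF A X] c by (simp_all add: XY)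
    have "(pB f (rf h), \<chi> X (rf h, mult W h)) \<in> Ob (left_maps E J v)"
      using \<chi>[unfolded frob_choice_def, THEN conjunct1, rule_format, OF X free_R_Map[OF r(2)]] f factorization[OF r(2)] by (simp add: XY)
    from left_maps_retract_Ob[OF this ret[OF f(1) r(2-7) f(2)] v]
    show "(pB (OM forget X) (OM forget Y), \<chi>' X Y) \<in> Ob (left_maps E J v)"
      by (simp add: \<chi>'_def XY r(1))
  next
    fix \<sigma> \<tau> assume \<sigma>: "\<sigma> \<in> Ar A" and \<tau>: "\<tau> \<in> Ar (R_map E W)" and b: "bot_of (AM forget \<sigma>) = bot_of (AM forget \<tau>)"
    obtain f l \<alpha> x f' l' where \<sigma>e: "\<sigma> = ((f, l), (f, (\<alpha>, x), f'), (f', l'))" "(f, l) \<in> Ob A" "(f', l') \<in> Ob A" and fsq: "square E f f' \<alpha> x"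
      using structured_ArE[OF A \<sigma>] by metis
    obtain h \<beta> hh h' \<beta>' where \<tau>1: "\<tau> = ((h, \<beta>), hh, (h', \<beta>'))" by (cases \<tau>) auto
    obtain y x' r r' where hh: "hh = (h, (y, x'), h')" "square E h h' y x'" and \<beta>: "\<beta> = (rf h, (r, ide (cod h)), h)" "\<beta>' = (rf h', (r', ide (cod h')), h')"
      and yr: "y \<cdot> r = r' \<cdot> kf h h' y x'"
      using R_map_Ar[OF \<tau>[unfolded \<tau>1]] by metis
    have "x' = x" using b by (simp add: \<sigma>e \<tau>1 hh)
    note hh = hh[unfolded this] and yr = yr[unfolded this]
    have O: "(h, \<beta>) \<in> Ob (R_map E W)" "(h', \<beta>') \<in> Ob (R_map E W)"
      using structured_Ar[OF structured_R_map \<tau>[unfolded \<tau>1]] by simp_all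
    have r: "arr h" "arr r" "dom r = dom (rf h)" "cod r = dom h" "h \<cdot> r = rf h" "r \<cdot> lf h = ide (dom h)"
      and r': "arr h'" "arr r'" "dom r' = dom (rf h')" "cod r' = dom h'" "h' \<cdot> r' = rf h'" "r' \<cdot> lf h' = ide (dom h')"
      using O unfolding R_map_Ob \<beta> by auto
    note fs = fsq[unfolded square_iff] and hs = hh(2)[unfolded square_iff] and K = fact_square(3,4)[OF hh(2), unfolded square_iff]
    note F = factorization[OF r(1)] factorization[OF r'(1)]
    have fa: "arr f" "cod f = cod h" "arr f'" "cod f' = cod h'" using fs hs by simp_all
    let ?k = "kf h h' y x"
    have c1: "cospan_map f h f' h' \<alpha> y" and c2: "cospan_map f (rf h) f' (rf h') \<alpha> ?k"
      using fs hs K F unfolding cospan_map_def cospan_def by (auto intro!: exI[of _ x])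
    have ar: "((pB f (rf h), \<chi> (f, l) (rf h, mult W h)), (pB f (rf h), (pm f (rf h) f' (rf h') \<alpha> ?k, ?k), pB f' (rf h')),
        (pB f' (rf h'), \<chi> (f', l') (rf h', mult W h'))) \<in> Ar (left_maps E J v)"
      using \<chi>[unfolded frob_choice_def, THEN conjunct2, rule_format, OF \<sigma> free_R_Map_Ar[OF hh(2)]]
      by (simp add: \<sigma>e structured_simps[OF A] structured_simps[OF structured_R_Map])
    note R = ret[OF fa(1) r fa(2)] and R' = ret[OF fa(3) r' fa(4)]
    note M = m1[OF fa(1) r fa(2)] m2[OF fa(1) r fa(2)] m1[OF fa(3) r' fa(4)] m2[OF fa(3) r' fa(4)]
    have "((pB f h, retract_fill J v (pB f h) (\<chi> (f, l) (rf h, mult W h)) (pm f (rf h) f h (ide (dom f)) r) r (lf h)),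
       (pB f h, (pm f h f' h' \<alpha> y, y), pB f' h'),
       (pB f' h', retract_fill J v (pB f' h') (\<chi> (f', l') (rf h', mult W h')) (pm f' (rf h') f' h' (ide (dom f')) r') r' (lf h'))) \<in> Ar (left_maps E J v)"
    proof (rule left_maps_retract_Ar[OF ar R R' v])
      show "square E (pB f h) (pB f' h') (pm f h f' h' \<alpha> y) y"
        using c1 cospan_mapD[OF c1] by (simp add: square_iff)
      show "?k \<cdot> lf h = lf h' \<cdot> y" using K by simp
      show "r' \<cdot> ?k = y \<cdot> r" using yr by simp
      show "pm f' (rf h') f' h' (ide (dom f')) r' \<cdot> pm f (rf h) f' (rf h') \<alpha> ?k = pm f h f' h' \<alpha> y \<cdot> pm f (rf h) f h (ide (dom f)) r"
        using pm_comp[OF c2 M(4)] pm_comp[OF M(2) c1] fs yr by simp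
    qed
    then show "frob_mor A forget (R_map E W) forget \<chi>' \<sigma> \<tau> \<in> Ar (left_maps E J v)"
      by (simp add: \<sigma>e(1) \<tau>1 hh(1) \<chi>'_def \<beta> structured_simps[OF A] structured_simps[OF structured_R_map])
  qed
  then show ?thesis by blast
qed

end

section \<open>The equivalence\<close>

theorem theorem5p9:
  fixes \<kappa> :: "'k rel"
    and E :: "('o, 'a) cat"
    and pb :: "'a \<Rightarrow> 'a \<Rightarrow> 'a \<times> 'a"
    and I :: "('i, 's) cat"
    and u :: "('i, 's, 'a, 'a sq) func"
    and W :: "'a awfs_data"
  assumes "inaccessible \<kappa>"
    and "locally_presentable \<kappa> E"
    and "locally_cartesian_closed E pb"
    and "is_functor I (arrow_cat E) u"
    and "awfs E W"
    and "algebraically_free_on E W I u"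
  shows "(functorial_frobenius E pb W \<longleftrightarrow>
            generalized_frobenius E pb I u (right_maps E I u) forget
              (left_maps E (right_maps E I u) forget) forget) \<and>
         (functorial_frobenius E pb W \<longleftrightarrow>
            generalized_frobenius E pb I u (R_Map E W) forget (L_map E W) forget)"
proof -
  have "chosen_pullbacks E pb" and cat: "category E"
    using assms(3) by (auto simp: locally_cartesian_closed_def chosen_pullbacks_def)
  then interpret lcc_cat E pb
    using assms(3) by unfold_locales (auto simp: locally_cartesian_closed_def)
  interpret awfs_cat E pb W
    using assms(5) by unfold_locales
  note u = assms(4)
  let ?R = "right_maps E I u" and ?RM = "R_Map E W" and ?Rm = "R_map E W" and ?Lm = "L_map E W"
  let ?L = "left_maps E ?R forget" and ?LM = "left_maps E ?RM forget"
  note sR = structured_right_maps[of I u] and sL = structured_left_maps[of ?R forget]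
    and sRM = structured_R_Map and sRm = structured_R_map and sLm = structured_L_map
  note fn = structured_functor[OF cat]
  obtain F G where F: "is_functor ?RM ?R F" and G: "is_functor ?R ?RM G"
    and FG: "functor_eq ?R (comp_func F G) id_func" and Fo: "functor_eq ?RM (comp_func forget F) forget"
    using assms(6) unfolding algebraically_free_on_def iso_over_def by (elim exE conjE) (rule that)
  \<comment> \<open>The inverse of an isomorphism over the arrow category lies over it too.\<close>
  have Go: "functor_eq ?R (comp_func forget G) forget"
    unfolding functor_eq_def
  proof (intro conjI ballI)
    fix X assume X: "X \<in> Ob ?R"
    have "fst (OM F (OM G X)) = fst (OM G X)"
      using Fo is_functorD(3)[OF G X] unfolding functor_eq_def comp_func_simps forget_simps by blast
    moreover have "OM F (OM G X) = X"
      using FG X unfolding functor_eq_def comp_func_simps id_func_simps by blast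
    ultimately show "OM (comp_func forget G) X = OM forget X" by simp
  next
    fix q assume q: "q \<in> Ar ?R"
    have "AM forget (AM F (AM G q)) = AM forget (AM G q)"
      using Fo is_functorD(4)[OF G q] unfolding functor_eq_def comp_func_simps by blast
    moreover have "AM F (AM G q) = q"
      using FG q unfolding functor_eq_def comp_func_simps id_func_simps by blast
    ultimately show "AM (comp_func forget G) q = AM forget q" by simp
  qed
  note RMR = struct_map_of_functor[OF sRM sR F Fo] and RRM = struct_map_of_functor[OF sR sRM G Go]
  note LmL = struct_map_comp[OF L_map_left_maps struct_map_left_maps[OF sR sRM RRM]]
  note LLm = struct_map_comp[OF struct_map_left_maps[OF sRM sR RMR] left_maps_L_map]
  have FF: "functorial_frobenius E pb W \<longleftrightarrow> (\<exists>\<chi>. frob_choice ?Lm forget ?Rm forget ?Lm \<chi>)"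
    unfolding functorial_frobenius_def by (rule frob_lift_iff[OF fn[OF sLm] fn[OF sRm] sLm])
  have G1: "generalized_frobenius E pb I u ?R forget ?L forget \<longleftrightarrow> (\<exists>\<chi>. gen_frob_choice I u ?R forget ?L \<chi>)"
    unfolding generalized_frobenius_def by (rule gen_frob_lift_iff[OF u fn[OF sR] sL])
  have G2: "generalized_frobenius E pb I u ?RM forget ?Lm forget \<longleftrightarrow> (\<exists>\<chi>. gen_frob_choice I u ?RM forget ?Lm \<chi>)"
    unfolding generalized_frobenius_def by (rule gen_frob_lift_iff[OF u fn[OF sRM] sLm])
  have 1: "\<exists>\<chi>. gen_frob_choice I u ?R forget ?L \<chi>" if "\<exists>\<chi>. frob_choice ?Lm forget ?Rm forget ?Lm \<chi>"
  proof -
    from that obtain \<chi> where "frob_choice ?Lm forget ?Rm forget ?Lm \<chi>" by blast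
    from frob_choice_mono[OF this LLm struct_map_comp[OF RRM R_Map_R_map] LmL sLm sRm sL sR]
    show ?thesis by (rule frob_imp_gen_frob[OF u])
  qed
  have 2: "\<exists>\<chi>. frob_choice ?Lm forget ?Rm forget ?Lm \<chi>" if "\<exists>\<chi>. gen_frob_choice I u ?R forget ?L \<chi>"
  proof -
    from that obtain \<chi> where "gen_frob_choice I u ?R forget ?L \<chi>" by blast
    then interpret gen_frob E pb I u \<chi>
      using u by unfold_locales
    from frob_choice_mono[OF gen_frob_imp_frob struct_map_id RMR struct_map_id sL sR sL sRM]
    obtain \<chi>' where "frob_choice ?L forget ?Rm forget ?L \<chi>'"
      using frob_choice_R_map[OF sL fn[OF sR]] by blast
    from frob_choice_mono[OF this LmL struct_map_id LLm sL sRm sLm sRm]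
    show ?thesis by blast
  qed
  have 3: "(\<exists>\<chi>. gen_frob_choice I u ?R forget ?L \<chi>) \<longleftrightarrow> (\<exists>\<chi>. gen_frob_choice I u ?RM forget ?Lm \<chi>)"
    using gen_frob_choice_mono[OF _ RMR LLm sR sRM] gen_frob_choice_mono[OF _ RRM LmL sRM sR] by blast
  show ?thesis
    unfolding FF G1 G2 using 1 2 3 by blast
qed

end
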